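(* Let $f,g:\mathbb{R}\to\mathbb{R}$ and set $F(x)=\int_0^x f(\xi)\,d\xi$, $G(x)=\int_0^x g(\xi)\,d\xi$. Assume: (A) $f$ is continuous and $g$ is locally Lipschitz; (B) $f(0)<0$, there is some $\delta>0$ such that $f(x)>0$ for $|x|>\delta$, and $xg(x)>0$ for $x\neq 0$; (C) $F$ has only three real zeros, all transversal, located at $x_0=0$ and $x_2<0<x_1$, and $F$ is monotone increasing outside the interval $[x_2,x_1]$; (D) $G(x_1)=G(x_2)$; (E) $\limsup_{x\to+\infty}[G(x)+F(x)]=+\infty$ and $\limsup_{x\to-\infty}[G(x)-F(x)]=+\infty$. Then the planar system $$\dot x = y-F(x),\qquad \dot y=-g(x)$$ has a unique periodic orbit in the $(x,y)$-plane, and this periodic orbit is stable.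
   Context: A periodic orbit means the orbit of a nonconstant periodic solution (the equilibrium at the origin is not counted). "Stable" refers to stability of the periodic orbit as a limit cycle (orbital stability). A zero $x_i$ of $F$ is transversal if $F'(x_i)=f(x_i)\neq 0$. "Monotone increasing outside $[x_2,x_1]$" means increasing on $(-\infty,x_2]$ and on $[x_1,+\infty)$. *)

theory Defs
  imports "HOL-Analysis.Analysis"
begin

text \<open>
  The interval integral is oriented: for \<open>x < 0\<close> it equals
  \<open>- (LBINT \<xi>=x..0. h \<xi>)\<close>, as in the usual convention for \<open>\<integral>\<^sub>0\<^sup>x h\<close>.
\<close>
definition primitive :: "(real \<Rightarrow> real) \<Rightarrow> real \<Rightarrow> real" where
  "primitive h x = (LBINT \<xi>=0..ereal x. h \<xi>)"

definition lienard_field :: "(real \<Rightarrow> real) \<Rightarrow> (real \<Rightarrow> real) \<Rightarrow> real \<times> real \<Rightarrow> real \<times> real" where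
  "lienard_field f g = (\<lambda>(x, y). (y - primitive f x, - g x))"

definition solution_on ::
  "real set \<Rightarrow> ('a::real_normed_vector \<Rightarrow> 'a) \<Rightarrow> (real \<Rightarrow> 'a) \<Rightarrow> bool" where
  "solution_on S v z \<longleftrightarrow> (\<forall>t\<in>S. (z has_vector_derivative v (z t)) (at t within S))"

definition periodic_orbit :: "('a::real_normed_vector \<Rightarrow> 'a) \<Rightarrow> 'a set \<Rightarrow> bool" where
  "periodic_orbit v \<Gamma> \<longleftrightarrow>
     (\<exists>z T. solution_on UNIV v z \<and> T > 0 \<and> (\<forall>t. z (t + T) = z t) \<and>
            \<not> z constant_on UNIV \<and> \<Gamma> = range z)"

text \<open>
  Lyapunov stability of the orbit as a set. Existence of a solution for all \<open>t \<ge> 0\<close> is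
  part of the definition, so that the condition cannot hold vacuously through blow-up in
  finite time; for a locally Lipschitz field that solution is unique.
\<close>
definition orbitally_stable :: "('a::real_normed_vector \<Rightarrow> 'a) \<Rightarrow> 'a set \<Rightarrow> bool" where
  "orbitally_stable v \<Gamma> \<longleftrightarrow>
     (\<forall>\<epsilon>>0. \<exists>\<delta>>0. \<forall>p. infdist p \<Gamma> < \<delta> \<longrightarrow>
        (\<exists>z. solution_on {0..} v z \<and> z 0 = p) \<and>
        (\<forall>z. solution_on {0..} v z \<and> z 0 = p \<longrightarrow> (\<forall>t\<ge>0. infdist (z t) \<Gamma> < \<epsilon>)))"

text \<open>
  A stable limit cycle is an orbitally stable periodic orbit which nearby trajectories
  (on both sides of it) approach as \<open>t \<rightarrow> \<infinity>\<close>.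
\<close>
definition stable_limit_cycle :: "('a::real_normed_vector \<Rightarrow> 'a) \<Rightarrow> 'a set \<Rightarrow> bool" where
  "stable_limit_cycle v \<Gamma> \<longleftrightarrow>
     periodic_orbit v \<Gamma> \<and> orbitally_stable v \<Gamma> \<and>
     (\<exists>\<eta>>0. \<forall>z. solution_on {0..} v z \<and> infdist (z 0) \<Gamma> < \<eta> \<longrightarrow>
        ((\<lambda>t. infdist (z t) \<Gamma>) \<longlongrightarrow> 0) at_top)"

end

theory Submission
  imports Defs
begin

text \<open>
  Along a solution the energy \<open>y\<^sup>2 / 2 + G x\<close> has derivative \<open>- g x * F x\<close>, so it increases while
  \<open>x2 < x < x1\<close> and does not increase outside. A solution starting at \<open>(0, a)\<close> with \<open>a > 0\<close> crosses the
  right half plane, arrives at \<open>(0, - h a)\<close>, crosses the left half plane and returns at \<open>(0, P a)\<close>.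
  If \<open>a\<^sup>2 / 2 \<le> G x1 = G x2\<close> then \<open>P a > a\<close>; here the equality \<open>G x1 = G x2\<close> guarantees that an orbit
  that has passed \<open>x1\<close> also passes \<open>x2\<close>. If \<open>a\<^sup>2 / 2 \<ge> G x1\<close>, comparing two orbits shows that \<open>P\<close> is strictly
  increasing and the gain \<open>(P a)\<^sup>2 - a\<^sup>2\<close> strictly decreasing; it is negative for large \<open>a\<close>.
  Hence \<open>P\<close> has exactly one fixed point, and its iterates converge to it monotonically from both
  sides.

  Global existence of solutions is not available in general, so \<open>f\<close> and \<open>g\<close> are replaced by their values
  at \<open>max (- M) (min M x)\<close>, which makes the field globally Lipschitz. The conditions on \<open>G \<plusminus> F\<close> at infinity
  confine the cycle to a strip that does not depend on \<open>M\<close>.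
\<close>

section \<open>Flows of globally Lipschitz vector fields\<close>

text \<open>Why the gain is negative for large \<open>a\<close>: crossing the strip between
  \<open>x2\<close> and \<open>x1\<close> either ends with bounded energy or raises the energy by at
  most a constant, whereas on \<open>x >= \<zeta>\<close>, with \<open>F \<zeta> > 0\<close>, the
  orbit descends by at least \<open>a\<close> minus a constant and
  \<open>dE/dy = F >= F \<zeta>\<close> there. One such level on the right is enough; the left half
  plane only has to contribute a bounded gain. The comparison of two orbits works without formulas
  because distinct orbits cannot meet: matched at equal \<open>x\<close> or at equal
  \<open>y\<close>, inner and outer orbit keep their order. Confinement: at the rightmost point of
  an arc \<open>y = F x\<close>, so \<open>F x\<close> is at most the starting height, and
  \<open>C * y + G x\<close> does not increase when \<open>C\<close> bounds the horizontal speed, so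
  \<open>G x\<close> is bounded too. The bound on \<open>G x + F x\<close> involves only the
  starting height and a lower bound of \<open>F\<close> on the strip, hence no cut-off level.
  Convergence of the iterates becomes attraction of all nearby orbits because return times near the
  cycle are bounded and the flow is Lipschitz over bounded times.\<close>

lemma norm_integral_exp_le:
  fixes q :: "real \<Rightarrow> 'a::banach"
  assumes q: "continuous_on {0..s} q" and le: "\<And>u. u \<in> {0..s} \<Longrightarrow> norm (q u) \<le> C * exp (K * u)"
    and "0 < K" "0 \<le> s" "0 \<le> C"
  shows "norm (integral {0..s} q) \<le> C / K * exp (K * s)"
proof -
  have I: "((\<lambda>u. C * exp (K * u)) has_integral (C / K * exp (K * s) - C / K * exp (K * 0))) {0..s}"
    using \<open>0 < K\<close> \<open>0 \<le> s\<close>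
    by (intro fundamental_theorem_of_calculus)
      (auto intro!: derivative_eq_intros simp: has_real_derivative_iff_has_vector_derivative[symmetric])
  have "norm (integral {0..s} q) \<le> integral {0..s} (\<lambda>u. C * exp (K * u))"
    using I le q by (intro integral_norm_bound_integral) (auto intro: integrable_continuous_real)
  also have "\<dots> = C / K * exp (K * s) - C / K * exp (K * 0)"
    using I by (rule integral_unique)
  also have "\<dots> \<le> C / K * exp (K * s)"
    using assms by simp
  finally show ?thesis .
qed

text \<open>
  The Picard operator is written in terms of the rescaled function \<open>w t = exp (- K t) z t\<close>, so that
  it contracts the space of bounded functions on the whole half line at once.
\<close>
lemma lipschitz_forward_solution:
  fixes v :: "'a::banach \<Rightarrow> 'a"
  assumes lip: "L-lipschitz_on UNIV v"
  shows "\<exists>z. solution_on {0..} v z \<and> z 0 = p"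
proof -
  \<comment> \<open>Any positive rate with \<open>L / K <= 1 / 2\<close> would do; this quotient is
    the contraction constant, and the summand 1 keeps \<open>K\<close> positive when
    \<open>L = 0\<close>.\<close>
  define K where "K = 2 * (L + 1)"
  have L: "0 \<le> L" using lip by (rule lipschitz_on_nonneg)
  have K: "0 < K" "L / K \<le> 1 / 2" using L by (auto simp: K_def field_simps)
  have cv: "continuous_on S v" for S
    using lipschitz_on_continuous_on[OF lip] continuous_on_subset by blast
  define q where "q w u = v (exp (K * u) *\<^sub>R w u)" for w u
  have cq: "continuous_on S (q w)" if "continuous_on UNIV w" for w S
    unfolding q_def
    by (intro continuous_on_compose2[OF cv[of UNIV]] continuous_intros continuous_on_subset[OF that]) auto
  define I where "I w t = p + integral {0..t} (q w)" for w t
  \<comment> \<open>Freezing negative times at 0 gives functions on the whole line, as the type of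
    bounded continuous functions requires.\<close>
  define T where "T w t = exp (- K * max 0 t) *\<^sub>R I w (max 0 t)" for w t
  have dI: "(I w has_vector_derivative q w t) (at t within {0..})"
    if "continuous_on UNIV w" "0 \<le> t" for w t
  proof -
    have "((\<lambda>u. integral {0..u} (q w)) has_vector_derivative q w t) (at t within {0..t+1})"
      using that cq by (intro integral_has_vector_derivative) auto
    then have "(I w has_vector_derivative q w t) (at t within {0..t+1})"
      unfolding I_def by (auto intro!: derivative_eq_intros)
    moreover have "at t within {0..t+1} = at t within {0..}"
      using that(2) by (intro at_within_nhd[where S="{..<t+1}"]) auto
    ultimately show ?thesis by simp
  qed
  have cI: "continuous_on {0..} (I w)" if "continuous_on UNIV w" for w
    using dI[OF that] has_vector_derivative_continuous
    by (fastforce simp: continuous_on_eq_continuous_within)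
  have cT: "continuous_on UNIV (T w)" if "continuous_on UNIV w" for w
    unfolding T_def
    by (intro continuous_intros continuous_on_compose2[OF cI[OF that]]) auto
  have bT: "norm (T w t) \<le> norm p + (norm (v 0) + L * B) / K"
    if w: "continuous_on UNIV w" "\<And>t. norm (w t) \<le> B" for w t B
  proof -
    define s where "s = max 0 t"
    have s: "0 \<le> s" by (simp add: s_def)
    have B: "0 \<le> B" using w(2)[of 0] norm_ge_zero order_trans by blast
    have "norm (q w u) \<le> (norm (v 0) + L * B) * exp (K * u)" if "u \<in> {0..s}" for u
    proof -
      have "norm (q w u) \<le> norm (v 0) + norm (q w u - v 0)"
        using norm_triangle_sub by blast
      also have "norm (q w u - v 0) \<le> L * norm (exp (K * u) *\<^sub>R w u - 0)"
        unfolding q_def using lip by (intro lipschitz_on_normD) auto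
      also have "\<dots> \<le> L * (exp (K * u) * B)"
        using L w(2)[of u] by (intro mult_left_mono) auto
      also have "norm (v 0) \<le> norm (v 0) * exp (K * u)"
        using K that by (simp add: mult_le_cancel_left1)
      finally show ?thesis by (simp add: algebra_simps)
    qed
    then have "norm (integral {0..s} (q w)) \<le> (norm (v 0) + L * B) / K * exp (K * s)"
      using K L s B cq[OF w(1)] by (intro norm_integral_exp_le) auto
    then have "norm (I w s) \<le> norm p * exp (K * s) + (norm (v 0) + L * B) / K * exp (K * s)"
      unfolding I_def using norm_triangle_ineq[of p "integral {0..s} (q w)"] K s
        mult_left_mono[of 1 "exp (K * s)" "norm p"] by auto
    then have "exp (- K * s) * norm (I w s) \<le> exp (- K * s) * ((norm p + (norm (v 0) + L * B) / K) * exp (K * s))"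
      by (intro mult_left_mono) (auto simp: algebra_simps)
    also have "\<dots> = norm p + (norm (v 0) + L * B) / K"
      by (simp add: exp_minus)
    finally show ?thesis unfolding T_def s_def by simp
  qed
  have dT: "dist (T w1 t) (T w2 t) \<le> 1 / 2 * D"
    if w: "continuous_on UNIV w1" "continuous_on UNIV w2" "\<And>t. dist (w1 t) (w2 t) \<le> D" for w1 w2 t D
  proof -
    define s where "s = max 0 t"
    have s: "0 \<le> s" by (simp add: s_def)
    have D: "0 \<le> D" using w(3)[of 0] zero_le_dist order_trans by blast
    have "norm (q w1 u - q w2 u) \<le> L * D * exp (K * u)" for u
    proof -
      have "norm (q w1 u - q w2 u) \<le> L * norm (exp (K * u) *\<^sub>R w1 u - exp (K * u) *\<^sub>R w2 u)"
        unfolding q_def using lip by (intro lipschitz_on_normD) auto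
      also have "\<dots> \<le> L * (exp (K * u) * D)"
        using L w(3)[of u] by (intro mult_left_mono) (auto simp: dist_norm scaleR_diff_right[symmetric])
      finally show ?thesis by (simp add: algebra_simps)
    qed
    then have "norm (integral {0..s} (\<lambda>u. q w1 u - q w2 u)) \<le> L * D / K * exp (K * s)"
      using K L s D w cq by (intro norm_integral_exp_le continuous_intros) auto
    also have "integral {0..s} (\<lambda>u. q w1 u - q w2 u) = I w1 s - I w2 s"
      unfolding I_def using w cq by (subst integral_diff) (auto intro!: integrable_continuous_real)
    finally have "exp (- K * s) * norm (I w1 s - I w2 s) \<le> exp (- K * s) * (L * D / K * exp (K * s))"
      by (intro mult_left_mono) auto
    also have "\<dots> = L / K * D"
      by (simp add: exp_minus)
    also have "\<dots> \<le> 1 / 2 * D"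
      using K D by (intro mult_right_mono)
    finally show ?thesis
      unfolding T_def s_def[symmetric] dist_norm scaleR_diff_right[symmetric] norm_scaleR by simp
  qed
  have T_mem: "T (apply_bcontfun w) \<in> bcontfun" for w :: "real \<Rightarrow>\<^sub>C 'a"
  proof -
    obtain B where "\<And>t. norm (w t) \<le> B"
      using bounded_apply_bcontfun[of w] by (auto simp: bounded_iff)
    then show ?thesis
      using cT[of w] bT[of w B] by (auto simp: bcontfun_def bounded_iff)
  qed
  define TT where "TT w = Bcontfun (T (apply_bcontfun w))" for w :: "real \<Rightarrow>\<^sub>C 'a"
  have TT: "apply_bcontfun (TT w) = T w" for w
    unfolding TT_def using T_mem by (rule Bcontfun_inverse)
  have "\<exists>!w. TT w = w"
  proof (rule banach_fix_type)
    have "dist (TT w1) (TT w2) \<le> 1 / 2 * dist w1 w2" for w1 w2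
      unfolding TT[symmetric]
      by (rule dist_bound) (simp only: TT, rule dT, auto intro: dist_bounded)
    then show "\<forall>w1 w2. dist (TT w1) (TT w2) \<le> 1 / 2 * dist w1 w2" by blast
  qed auto
  then obtain w where w: "TT w = w" by blast
  define z where "z = I (apply_bcontfun w)"
  have zw: "exp (K * t) *\<^sub>R w t = z t" if "0 \<le> t" for t
  proof -
    have "w t = T w t" using w TT by metis
    then show ?thesis using that by (simp add: T_def z_def exp_minus)
  qed
  have "solution_on {0..} v z"
    unfolding solution_on_def
  proof
    fix t :: real assume "t \<in> {0..}"
    then show "(z has_vector_derivative v (z t)) (at t within {0..})"
      using dI[of w t] zw[of t] by (simp add: q_def z_def)
  qed
  moreover have "z 0 = p" by (simp add: z_def I_def)
  ultimately show ?thesis by blast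
qed

text \<open>Serves to glue a forward and a backward solution at time 0, where each of them has only
  a one-sided derivative.\<close>

lemma has_vector_derivative_within_Un:
  assumes "(z has_vector_derivative D) (at t within S)" "(z has_vector_derivative D) (at t within T)"
  shows "(z has_vector_derivative D) (at t within S \<union> T)"
proof -
  let ?q = "\<lambda>y. (1 / norm (y - t)) *\<^sub>R (z y - (z t + (y - t) *\<^sub>R D))"
  have "bounded_linear (\<lambda>h. h *\<^sub>R D)"
    using assms(1) by (simp add: has_vector_derivative_def has_derivative_def)
  moreover have "(?q \<longlongrightarrow> 0) (at t within S)" "(?q \<longlongrightarrow> 0) (at t within T)"
    using assms unfolding has_vector_derivative_def has_derivative_within by blast+
  then have "(?q \<longlongrightarrow> 0) (at t within S \<union> T)"
    unfolding at_within_union by (rule filterlim_sup)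
  ultimately show ?thesis
    unfolding has_vector_derivative_def has_derivative_within by blast
qed

lemma solution_on_subset:
  assumes "solution_on S v z" "T \<subseteq> S"
  shows "solution_on T v z"
  unfolding solution_on_def
proof
  fix t assume "t \<in> T"
  then have "(z has_vector_derivative v (z t)) (at t within S)"
    using assms by (auto simp: solution_on_def)
  then show "(z has_vector_derivative v (z t)) (at t within T)"
    by (rule has_vector_derivative_within_subset) fact
qed

lemma solution_on_reverse:
  assumes "solution_on S v z"
  shows "solution_on (uminus ` S) (\<lambda>p. - v p) (\<lambda>t. z (- t))"
  unfolding solution_on_def
proof
  fix t assume "t \<in> uminus ` S"
  then have "- t \<in> S" by auto
  then have "(z has_vector_derivative v (z (- t))) (at (- t) within uminus ` uminus ` S)"
    using assms by (simp add: solution_on_def image_image)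
  moreover have "((\<lambda>t. - t) has_vector_derivative - 1) (at t within uminus ` S)"
    by (auto intro!: derivative_eq_intros)
  ultimately have "((z \<circ> (\<lambda>t. - t)) has_vector_derivative (- 1) *\<^sub>R v (z (- t))) (at t within uminus ` S)"
    by (intro vector_diff_chain_within) auto
  then show "((\<lambda>t. z (- t)) has_vector_derivative - v (z (- t))) (at t within uminus ` S)"
    by (simp add: o_def)
qed

lemma solution_on_shift:
  assumes "solution_on UNIV v z"
  shows "solution_on UNIV v (\<lambda>t. z (t + s))"
  unfolding solution_on_def
proof
  fix t
  have "(z has_vector_derivative v (z (t + s))) (at (t + s))"
    using assms by (simp add: solution_on_def)
  moreover have "((\<lambda>t. t + s) has_vector_derivative 1) (at t)"
    by (auto intro!: derivative_eq_intros)
  ultimately have "((z \<circ> (\<lambda>t. t + s)) has_vector_derivative 1 *\<^sub>R v (z (t + s))) (at t)"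
    by (intro vector_diff_chain_at) auto
  then show "((\<lambda>t. z (t + s)) has_vector_derivative v (z (t + s))) (at t)"
    by (simp add: o_def)
qed

lemma solution_on_continuous:
  assumes "solution_on S v z"
  shows "continuous_on S z"
  unfolding continuous_on_eq_continuous_within
proof
  fix t assume "t \<in> S"
  then have "(z has_vector_derivative v (z t)) (at t within S)"
    using assms by (simp add: solution_on_def)
  then show "continuous (at t within S) z"
    by (rule has_vector_derivative_continuous)
qed

lemma solution_on_cong:
  "(\<And>t. t \<in> S \<Longrightarrow> v (z t) = w (z t)) \<Longrightarrow> solution_on S v z \<longleftrightarrow> solution_on S w z"
  by (simp add: solution_on_def)

text \<open>Lets periodic orbits pass between the given field and its cut-off, which agree on a
  strip containing the orbit.\<close>

lemma periodic_orbit_cong: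
  assumes "\<And>p. p \<in> \<Gamma> \<Longrightarrow> v p = w p"
  shows "periodic_orbit v \<Gamma> \<longleftrightarrow> periodic_orbit w \<Gamma>"
proof -
  have "solution_on UNIV v z \<longleftrightarrow> solution_on UNIV w z" if "\<Gamma> = range z" for z
    by (rule solution_on_cong) (use assms that in auto)
  then show ?thesis unfolding periodic_orbit_def by blast
qed

lemma periodic_orbit_compact:
  assumes "periodic_orbit v \<Gamma>"
  shows "compact \<Gamma>"
proof -
  obtain z T where z: "solution_on UNIV v z" "0 < T" "\<And>t. z (t + T) = z t" "\<Gamma> = range z"
    using assms unfolding periodic_orbit_def by blast
  have nT: "z (t + real n * T) = z t" for t n
  proof (induction n)
    case (Suc n)
    have "z (t + real (Suc n) * T) = z ((t + real n * T) + T)" by (simp add: algebra_simps)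
    then show ?case using Suc z(3) by simp
  qed simp
  have "z t \<in> z ` {0..T}" for t
  proof -
    define k where "k = \<lfloor>t / T\<rfloor>"
    define s where "s = t - of_int k * T"
    have s: "s \<in> {0..T}"
      using floor_divide_lower[OF z(2), of t] floor_divide_upper[OF z(2), of t]
      by (auto simp: s_def k_def algebra_simps)
    have "z t = z s"
    proof (cases "0 \<le> k")
      case True
      then show ?thesis using nT[of s "nat k"] by (simp add: s_def)
    next
      case False
      then show ?thesis using nT[of t "nat (- k)"] by (simp add: s_def)
    qed
    then show ?thesis using s by blast
  qed
  then have "\<Gamma> = z ` {0..T}" using z(4) by blast
  then show ?thesis
    using compact_continuous_image[OF continuous_on_subset[OF solution_on_continuous[OF z(1)]] compact_Icc]
    by simp
qed

text \<open>The backward half is a forward solution for \<open>- v\<close> run in reverse.\<close>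

lemma lipschitz_solution_exists:
  fixes v :: "'a::banach \<Rightarrow> 'a"
  assumes lip: "L-lipschitz_on UNIV v"
  shows "\<exists>z. solution_on UNIV v z \<and> z 0 = p"
proof -
  obtain z1 where z1: "solution_on {0..} v z1" "z1 0 = p"
    using lipschitz_forward_solution[OF lip] by blast
  have "L-lipschitz_on UNIV (\<lambda>p. - v p)"
    using lip by (simp add: lipschitz_on_def dist_minus)
  then obtain z2 where z2: "solution_on {0..} (\<lambda>p. - v p) z2" "z2 0 = p"
    using lipschitz_forward_solution by blast
  have z2': "solution_on {..0} v (\<lambda>t. z2 (- t))"
    using solution_on_reverse[OF z2(1)] by simp
  define z where "z t = (if 0 \<le> t then z1 t else z2 (- t))" for t
  have "(z has_vector_derivative v (z t)) (at t)" for t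
  proof -
    consider "t < 0" | "t = 0" | "0 < t" by linarith
    then show ?thesis
    proof cases
      case 1
      have "((\<lambda>t. z2 (- t)) has_vector_derivative v (z2 (- t))) (at t within {..0})"
        using z2' 1 by (simp add: solution_on_def)
      then have "((\<lambda>t. z2 (- t)) has_vector_derivative v (z2 (- t))) (at t)"
        using 1 by (simp add: at_within_interior[of t "{..0}"])
      then have "(z has_vector_derivative v (z2 (- t))) (at t)"
        by (rule has_vector_derivative_transform_within_open[where S="{..<0}"]) (use 1 in \<open>auto simp: z_def\<close>)
      then show ?thesis using 1 by (simp add: z_def)
    next
      case 2
      have "(z has_vector_derivative v (z1 0)) (at 0 within {0..})"
        by (rule has_vector_derivative_transform[where f=z1]) (use z1 in \<open>auto simp: z_def solution_on_def\<close>)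
      moreover have "(z has_vector_derivative v (z1 0)) (at 0 within {..0})"
      proof (rule has_vector_derivative_transform[where f="\<lambda>t. z2 (- t)"])
        show "((\<lambda>t. z2 (- t)) has_vector_derivative v (z1 0)) (at 0 within {..0})"
          using z2' z2(2) z1(2) unfolding solution_on_def
          by (metis atMost_iff minus_zero order_refl)
      qed (auto simp: z_def z1 z2)
      ultimately have "(z has_vector_derivative v (z1 0)) (at 0 within {0..} \<union> {..0})"
        by (rule has_vector_derivative_within_Un)
      moreover have "{0..} \<union> {..0} = (UNIV :: real set)" by auto
      ultimately show ?thesis by (simp add: 2 z_def)
    next
      case 3
      have "(z1 has_vector_derivative v (z1 t)) (at t within {0..})"
        using z1 3 by (simp add: solution_on_def)
      then have "(z1 has_vector_derivative v (z1 t)) (at t)"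
        using 3 by (simp add: at_within_interior[of t "{0..}"])
      then have "(z has_vector_derivative v (z1 t)) (at t)"
        by (rule has_vector_derivative_transform_within_open[where S="{0<..}"]) (use 3 in \<open>auto simp: z_def\<close>)
      then show ?thesis using 3 by (simp add: z_def)
    qed
  qed
  then have "solution_on UNIV v z" by (simp add: solution_on_def)
  moreover have "z 0 = p" by (simp add: z_def z1)
  ultimately show ?thesis by blast
qed

text \<open>Gronwall by monotonicity: \<open>exp (- 2 * L * s)\<close> times the squared distance
  has nonpositive derivative, by Cauchy-Schwarz. This is where the inner product enters.\<close>

lemma solution_dist_le:
  fixes z w :: "real \<Rightarrow> 'a::real_inner"
  assumes z: "solution_on {0..T} v z" and w: "solution_on {0..T} v w"
    and lip: "\<And>t. t \<in> {0..T} \<Longrightarrow> norm (v (z t) - v (w t)) \<le> L * norm (z t - w t)"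
    and t: "t \<in> {0..T}"
  shows "dist (z t) (w t) \<le> exp (L * t) * dist (z 0) (w 0)"
proof -
  define d where "d s = z s - w s" for s
  define D where "D s = exp (- 2 * L * s) * (d s \<bullet> d s)" for s
  have dd: "(d has_vector_derivative (v (z s) - v (w s))) (at s within {0..T})" if "s \<in> {0..T}" for s
    unfolding d_def using z w that by (auto intro!: derivative_eq_intros simp: solution_on_def)
  have cd: "continuous_on {0..T} d"
    using dd has_vector_derivative_continuous by (fastforce simp: continuous_on_eq_continuous_within)
  have "D t \<le> D 0"
  proof (rule DERIV_nonpos_imp_decreasing_open[where f=D and a=0 and b=t])
    show "0 \<le> t" using t by simp
    show "continuous_on {0..t} D"
      unfolding D_def using t by (intro continuous_intros continuous_on_subset[OF cd]) auto
    fix s assume s: "0 < s" "s < t"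
    define e where "e = v (z s) - v (w s)"
    have "(d has_vector_derivative e) (at s)"
      using dd[of s] s t by (simp add: at_within_Icc_at e_def)
    then have d': "(d has_derivative (\<lambda>h. h *\<^sub>R e)) (at s)"
      by (simp add: has_vector_derivative_def)
    have "((\<lambda>s. d s \<bullet> d s) has_derivative (\<lambda>h. d s \<bullet> (h *\<^sub>R e) + (h *\<^sub>R e) \<bullet> d s)) (at s)"
      by (rule has_derivative_inner[OF d' d'])
    moreover have "(\<lambda>h. d s \<bullet> (h *\<^sub>R e) + (h *\<^sub>R e) \<bullet> d s) = (*) (2 * (d s \<bullet> e))"
      by (auto simp: inner_commute)
    ultimately have "((\<lambda>s. d s \<bullet> d s) has_real_derivative 2 * (d s \<bullet> e)) (at s)"
      by (simp add: has_field_derivative_def)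
    then have "(D has_real_derivative (exp (- 2 * L * s) * (2 * (d s \<bullet> e - L * (d s \<bullet> d s))))) (at s)"
      unfolding D_def by (auto intro!: derivative_eq_intros simp: algebra_simps)
    moreover have "d s \<bullet> e \<le> L * (d s \<bullet> d s)"
    proof -
      have "d s \<bullet> e \<le> norm (d s) * norm e" by (rule norm_cauchy_schwarz)
      also have "\<dots> \<le> norm (d s) * (L * norm (d s))"
        using lip[of s] s t by (intro mult_left_mono) (auto simp: d_def e_def)
      finally show ?thesis by (simp add: dot_square_norm power2_eq_square algebra_simps)
    qed
    ultimately show "\<exists>y. (D has_real_derivative y) (at s) \<and> y \<le> 0"
      by (intro exI conjI) (auto simp: mult_nonneg_nonpos)
  qed
  then have "exp (- 2 * L * t) * (norm (d t))\<^sup>2 \<le> (norm (d 0))\<^sup>2"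
    by (simp add: D_def dot_square_norm)
  then have "exp (2 * L * t) * (exp (- 2 * L * t) * (norm (d t))\<^sup>2) \<le> exp (2 * L * t) * (norm (d 0))\<^sup>2"
    by (intro mult_left_mono) auto
  moreover have "exp (2 * L * t) = (exp (L * t))\<^sup>2" by (simp add: exp_double[symmetric] mult.assoc)
  moreover have "exp (2 * L * t) * (exp (- 2 * L * t) * (norm (d t))\<^sup>2) = (norm (d t))\<^sup>2"
    by (simp add: mult.assoc[symmetric] exp_add[symmetric])
  ultimately have "(norm (d t))\<^sup>2 \<le> (exp (L * t) * norm (d 0))\<^sup>2"
    by (metis power_mult_distrib)
  then have "norm (d t) \<le> exp (L * t) * norm (d 0)"
    by (rule power2_le_imp_le) simp
  then show ?thesis by (simp add: d_def dist_norm)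
qed

text \<open>For a globally Lipschitz \<open>v\<close> the choice is forced, see
  \<open>flow_unique\<close>; for other fields the value carries no meaning.\<close>

definition flow :: "('a::real_normed_vector \<Rightarrow> 'a) \<Rightarrow> real \<Rightarrow> 'a \<Rightarrow> 'a" where
  "flow v t p = (SOME z. solution_on UNIV v z \<and> z 0 = p) t"

locale lipschitz_field =
  fixes v :: "'a::{real_inner, banach} \<Rightarrow> 'a" and L :: real
  assumes lip: "L-lipschitz_on UNIV v"
begin

lemma L_nonneg: "0 \<le> L"
  using lip by (rule lipschitz_on_nonneg)

lemma flow_0: "flow v 0 p = p"
  and flow_solution: "solution_on UNIV v (\<lambda>t. flow v t p)"
proof -
  have "solution_on UNIV v (SOME z. solution_on UNIV v z \<and> z 0 = p) \<and>
    (SOME z. solution_on UNIV v z \<and> z 0 = p) 0 = p"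
    using someI_ex[OF lipschitz_solution_exists[OF lip]] .
  then show "flow v 0 p = p" "solution_on UNIV v (\<lambda>t. flow v t p)"
    by (simp_all add: flow_def)
qed

lemma flow_has_derivative: "((\<lambda>t. flow v t p) has_vector_derivative v (flow v t p)) (at t)"
  using flow_solution by (simp add: solution_on_def)

lemma flow_continuous: "continuous_on S (\<lambda>t. flow v t p)"
  using solution_on_continuous[OF flow_solution] by (rule continuous_on_subset) simp

lemma solution_dist_bound:
  assumes "solution_on UNIV v z" "solution_on UNIV v w"
  shows "dist (z t) (w t) \<le> exp (L * \<bar>t\<bar>) * dist (z 0) (w 0)"
proof (cases "0 \<le> t")
  case True
  then show ?thesis
    using assms lip by (intro order_trans[OF solution_dist_le[of t v z w L t]])
      (auto intro: solution_on_subset lipschitz_on_normD)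
next
  case False
  have r: "solution_on {0..- t} (\<lambda>p. - v p) (\<lambda>t. u (- t))" if "solution_on UNIV v u" for u
    using solution_on_reverse[OF that] by (rule solution_on_subset) (simp add: surj_uminus)
  have "norm (- v p + v q) \<le> L * norm (p - q)" for p q
    using lipschitz_on_normD[OF lip, of p q] by (simp add: norm_minus_commute)
  then have "dist (z (- (- t))) (w (- (- t))) \<le> exp (L * (- t)) * dist (z (- 0)) (w (- 0))"
    using False by (intro solution_dist_le[OF r[OF assms(1)] r[OF assms(2)]]) auto
  then show ?thesis using False by simp
qed

lemma flow_dist: "dist (flow v t p) (flow v t q) \<le> exp (L * \<bar>t\<bar>) * dist p q"
  using solution_dist_bound[OF flow_solution flow_solution, of t p q] by (simp add: flow_0)

lemma flow_unique: "solution_on UNIV v z \<Longrightarrow> z t = flow v t (z 0)"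
  using solution_dist_bound[OF _ flow_solution, of z t "z 0"] by (simp add: flow_0)

lemma flow_add: "flow v (s + t) p = flow v s (flow v t p)"
  using flow_unique[OF solution_on_shift[OF flow_solution], of s t p] by simp

text \<open>The form in which uniqueness is used later: orbits that meet are time shifts of each
  other.\<close>

lemma flow_cancel: "flow v t p = flow v s q \<Longrightarrow> flow v (t - s) p = q"
  using flow_add[of "- s" t p] flow_add[of "- s" s q] by (simp add: flow_0)

lemma flow_equilibrium: "v p = 0 \<Longrightarrow> flow v t p = p"
  using flow_unique[of "\<lambda>_. p" t] by (simp add: solution_on_def)

lemma periodic_flow:
  assumes "flow v T p = p"
  shows "flow v (t + real n * T) p = flow v t p"
proof (induction n)
  case (Suc n)
  have "flow v (t + real (Suc n) * T) p = flow v (t + real n * T) (flow v T p)"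
    by (simp add: flow_add[symmetric] algebra_simps)
  then show ?case using Suc assms by simp
qed simp

lemma periodic_flow_int:
  assumes "flow v T p = p"
  shows "flow v (of_int k * T) p = p"
proof (cases "0 \<le> k")
  case True
  then show ?thesis using periodic_flow[OF assms, of 0 "nat k"] by (simp add: flow_0)
next
  case False
  then show ?thesis using periodic_flow[OF assms, of "of_int k * T" "nat (- k)"] by (simp add: flow_0)
qed

text \<open>The third conclusion leads from any point of the orbit back to \<open>p\<close> within a
  time between 0 and \<open>T\<close>, so that Lipschitz constants along the cycle are
  uniform.\<close>

lemma periodic_flow_reduce:
  assumes "flow v T p = p" "0 < T"
  obtains s where "s \<in> {0..T}" "flow v t p = flow v s p" "flow v (T - s) (flow v t p) = p"
proof -
  define k where "k = \<lfloor>t / T\<rfloor>"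
  define s where "s = t - of_int k * T"
  have s: "s \<in> {0..T}"
    using floor_divide_lower[OF assms(2), of t] floor_divide_upper[OF assms(2), of t]
    by (auto simp: s_def k_def algebra_simps)
  have "flow v t p = flow v s (flow v (of_int k * T) p)"
    by (simp add: flow_add[symmetric] s_def)
  then have eq: "flow v t p = flow v s p" by (simp add: periodic_flow_int[OF assms(1)])
  have "flow v (T - s) (flow v s p) = p" by (simp add: flow_add[symmetric] assms(1))
  then show thesis using that s eq by metis
qed

lemma periodic_orbit_flow:
  assumes "flow v T p = p" "0 < T" "v p \<noteq> 0"
  shows "periodic_orbit v (range (\<lambda>t. flow v t p))"
  unfolding periodic_orbit_def
proof (intro exI conjI)
  show "\<forall>t. flow v (t + T) p = flow v t p" using assms(1) by (simp add: flow_add)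
  show "\<not> (\<lambda>t. flow v t p) constant_on UNIV"
  proof
    assume "(\<lambda>t. flow v t p) constant_on UNIV"
    then obtain c where "(\<lambda>t. flow v t p) = (\<lambda>t. c)" by (auto simp: constant_on_def)
    then have "((\<lambda>t. c) has_vector_derivative v p) (at 0)"
      using flow_has_derivative[of p 0] by (simp add: flow_0)
    moreover have "((\<lambda>t. c) has_vector_derivative 0) (at (0::real))"
      by (rule has_vector_derivative_const)
    ultimately show False using assms(3) vector_derivative_unique_at by blast
  qed
qed (use assms flow_solution in auto)

lemma periodic_orbitE:
  assumes "periodic_orbit v \<Gamma>"
  obtains T where "0 < T" "\<And>p. p \<in> \<Gamma> \<Longrightarrow> flow v T p = p"
    "\<And>p. p \<in> \<Gamma> \<Longrightarrow> \<Gamma> = range (\<lambda>t. flow v t p)" "\<And>p. p \<in> \<Gamma> \<Longrightarrow> v p \<noteq> 0"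
    "compact \<Gamma>" "\<Gamma> \<noteq> {}"
proof -
  obtain z T where z: "solution_on UNIV v z" "0 < T" "\<And>t. z (t + T) = z t"
    "\<not> z constant_on UNIV" "\<Gamma> = range z"
    using assms unfolding periodic_orbit_def by blast
  have fl: "z (t + s) = flow v t (z s)" for t s
    using flow_unique[OF solution_on_shift[OF z(1)], of t s] by simp
  have "compact \<Gamma>" using assms by (rule periodic_orbit_compact)
  moreover have "\<Gamma> = range (\<lambda>t. flow v t p)" if p: "p \<in> \<Gamma>" for p
  proof -
    obtain s where s: "p = z s" using p z(5) by auto
    have "z t = flow v (t - s) p" for t using fl[of "t - s" s] s by simp
    then have "range z \<subseteq> range (\<lambda>t. flow v t p)" by blast
    moreover have "range (\<lambda>t. flow v t p) \<subseteq> range z" using fl[symmetric] s by auto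
    ultimately show ?thesis using z(5) by blast
  qed
  moreover have "flow v T p = p" if p: "p \<in> \<Gamma>" for p
  proof -
    obtain s where s: "p = z s" using p z(5) by auto
    show ?thesis using fl[of T s] z(3)[of s] s by (simp add: add.commute)
  qed
  moreover have "v p \<noteq> 0" if p: "p \<in> \<Gamma>" for p
  proof
    assume "v p = 0"
    obtain s where s: "p = z s" using p z(5) by auto
    then have "z t = p" for t
      using fl[of "t - s" s] flow_equilibrium[OF \<open>v p = 0\<close>] by simp
    then show False using z(4) by (auto simp: constant_on_def)
  qed
  moreover have "\<Gamma> \<noteq> {}" using z(5) by auto
  ultimately show thesis using that z(2) by blast
qed

end

section \<open>Reparametrisation of monotone curves\<close>

lemma deriv_continuous_on:
  fixes u u' :: "real \<Rightarrow> real"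
  assumes "\<And>t. t \<in> S \<Longrightarrow> (u has_real_derivative u' t) (at t)"
  shows "continuous_on S u"
proof (intro continuous_at_imp_continuous_on ballI)
  fix t assume "t \<in> S"
  from assms[OF this] show "isCont u t" by (rule DERIV_isCont)
qed

lemma deriv_pos_less:
  fixes u u' :: "real \<Rightarrow> real"
  assumes "a < b" and d: "\<And>t. t \<in> {a..b} \<Longrightarrow> (u has_real_derivative u' t) (at t)"
    and "\<And>t. a < t \<Longrightarrow> t < b \<Longrightarrow> 0 < u' t"
  shows "u a < u b"
proof (rule DERIV_pos_imp_increasing_open[OF \<open>a < b\<close> _ deriv_continuous_on[OF d]])
  fix t assume "a < t" "t < b"
  then show "\<exists>y. (u has_real_derivative y) (at t) \<and> 0 < y"
    using d[of t] assms(3)[of t] by (intro exI[of _ "u' t"]) simp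
qed

lemma deriv_nonneg_le:
  fixes u u' :: "real \<Rightarrow> real"
  assumes "a \<le> b" and d: "\<And>t. t \<in> {a..b} \<Longrightarrow> (u has_real_derivative u' t) (at t)"
    and "\<And>t. a < t \<Longrightarrow> t < b \<Longrightarrow> 0 \<le> u' t"
  shows "u a \<le> u b"
proof (rule DERIV_nonneg_imp_increasing_open[OF \<open>a \<le> b\<close> _ deriv_continuous_on[OF d]])
  fix t assume "a < t" "t < b"
  then show "\<exists>y. (u has_real_derivative y) (at t) \<and> 0 \<le> y"
    using d[of t] assms(3)[of t] by (intro exI[of _ "u' t"]) simp
qed

lemma deriv_neg_less:
  fixes u u' :: "real \<Rightarrow> real"
  assumes "a < b" and d: "\<And>t. t \<in> {a..b} \<Longrightarrow> (u has_real_derivative u' t) (at t)"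
    and "\<And>t. a < t \<Longrightarrow> t < b \<Longrightarrow> u' t < 0"
  shows "u b < u a"
proof -
  have "- u a < - u b"
    by (rule deriv_pos_less[OF \<open>a < b\<close> DERIV_minus[OF d]]) (use assms(3) in auto)
  then show ?thesis by simp
qed

lemma deriv_nonpos_le:
  fixes u u' :: "real \<Rightarrow> real"
  assumes "a \<le> b" and d: "\<And>t. t \<in> {a..b} \<Longrightarrow> (u has_real_derivative u' t) (at t)"
    and "\<And>t. a < t \<Longrightarrow> t < b \<Longrightarrow> u' t \<le> 0"
  shows "u b \<le> u a"
proof -
  have "- u a \<le> - u b"
    by (rule deriv_nonneg_le[OF \<open>a \<le> b\<close> DERIV_minus[OF d]]) (use assms(3) in auto)
  then show ?thesis by simp
qed

text \<open>\<open>\<sigma>\<close> is the inverse of \<open>p2\<close> after \<open>p1\<close>. It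
  matches two arcs at equal values of a coordinate that increases along both, in place of describing
  them as graphs over that coordinate.\<close>

lemma reparametrisation:
  fixes p1 p2 p1' p2' :: "real \<Rightarrow> real"
  assumes le: "s1 \<le> t1" "s2 \<le> t2"
    and d1: "\<And>t. t \<in> {s1..t1} \<Longrightarrow> (p1 has_real_derivative p1' t) (at t)"
    and d2: "\<And>t. t \<in> {s2..t2} \<Longrightarrow> (p2 has_real_derivative p2' t) (at t)"
    and pos1: "\<And>t. t \<in> {s1..t1} \<Longrightarrow> 0 < p1' t"
    and pos2: "\<And>t. t \<in> {s2..t2} \<Longrightarrow> 0 < p2' t"
    and ends: "p1 s1 = p2 s2" "p1 t1 = p2 t2"
  obtains \<sigma> where "\<sigma> s1 = s2" "\<sigma> t1 = t2" "continuous_on {s1..t1} \<sigma>"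
    "\<And>t. t \<in> {s1..t1} \<Longrightarrow> \<sigma> t \<in> {s2..t2}" "\<And>t. t \<in> {s1..t1} \<Longrightarrow> p2 (\<sigma> t) = p1 t"
    "\<And>t. s1 < t \<Longrightarrow> t < t1 \<Longrightarrow> (\<sigma> has_real_derivative p1' t / p2' (\<sigma> t)) (at t)"
proof -
  have c1: "continuous_on {s1..t1} p1" and c2: "continuous_on {s2..t2} p2"
    by (rule deriv_continuous_on, erule d1) (rule deriv_continuous_on, erule d2)
  have mono1: "p1 s < p1 t" if "s \<in> {s1..t1}" "t \<in> {s1..t1}" "s < t" for s t
    by (rule deriv_pos_less[OF \<open>s < t\<close> d1 pos1]) (use that in auto)
  have mono2: "p2 s < p2 t" if "s \<in> {s2..t2}" "t \<in> {s2..t2}" "s < t" for s t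
    by (rule deriv_pos_less[OF \<open>s < t\<close> d2 pos2]) (use that in auto)
  have inj: "inj_on p2 {s2..t2}"
    by (rule linorder_inj_onI) (use mono2 in \<open>fastforce+\<close>)
  define q where "q = the_inv_into {s2..t2} p2"
  have q_p2: "q (p2 s) = s" if "s \<in> {s2..t2}" for s
    unfolding q_def using inj that by (rule the_inv_into_f_f)
  have img: "p2 ` {s2..t2} = {p2 s2..p2 t2}"
  proof
    show "p2 ` {s2..t2} \<subseteq> {p2 s2..p2 t2}"
      using mono2 le by (force simp: le_less)
    show "{p2 s2..p2 t2} \<subseteq> p2 ` {s2..t2}"
      using IVT'[of p2 s2 _ t2, OF _ _ le(2) c2] by force
  qed
  have "q y \<in> {s2..t2} \<and> p2 (q y) = y" if y: "y \<in> {p2 s2..p2 t2}" for y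
  proof -
    obtain s where "s \<in> {s2..t2}" "y = p2 s" using y img by blast
    then show ?thesis using q_p2[of s] by simp
  qed
  then have q_mem: "q y \<in> {s2..t2}" and p2_q: "p2 (q y) = y" if "y \<in> {p2 s2..p2 t2}" for y
    using that by blast+
  have cq: "continuous_on {p2 s2..p2 t2} q"
    using continuous_on_inv[OF c2 compact_Icc, of q] q_p2 unfolding img by blast
  have p1_mem: "p1 t \<in> {p2 s2..p2 t2}" if t: "t \<in> {s1..t1}" for t
  proof -
    have "p1 s1 \<le> p1 t" using mono1[of s1 t] t by (cases "t = s1") auto
    moreover have "p1 t \<le> p1 t1" using mono1[of t t1] t by (cases "t = t1") auto
    ultimately show ?thesis using ends by simp
  qed
  show thesis
  proof (rule that[of "\<lambda>t. q (p1 t)"])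
    show "q (p1 s1) = s2" "q (p1 t1) = t2" using q_p2 ends le by auto
    show "continuous_on {s1..t1} (\<lambda>t. q (p1 t))"
      by (rule continuous_on_compose2[OF cq c1]) (use p1_mem in auto)
    show "q (p1 t) \<in> {s2..t2}" "p2 (q (p1 t)) = p1 t" if "t \<in> {s1..t1}" for t
      using q_mem p2_q p1_mem that by blast+
    fix t assume t: "s1 < t" "t < t1"
    have y: "p2 s2 < p1 t" "p1 t < p2 t2"
      using mono1[of s1 t] mono1[of t t1] t ends by auto
    have "(q has_real_derivative inverse (p2' (q (p1 t)))) (at (p1 t))"
    proof (rule DERIV_inverse_function[where f=p2 and a="p2 s2" and b="p2 t2"])
      have m: "q (p1 t) \<in> {s2..t2}" using q_mem y by simp
      show "(p2 has_real_derivative p2' (q (p1 t))) (at (q (p1 t)))" using d2 m by blast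
      show "p2' (q (p1 t)) \<noteq> 0" using pos2[OF m] by simp
      show "isCont q (p1 t)"
        using cq y by (simp add: continuous_on_interior[of "{p2 s2..p2 t2}"])
    qed (use y p2_q in auto)
    from DERIV_chain2[OF this d1] show "((\<lambda>t. q (p1 t)) has_real_derivative p1' t / p2' (q (p1 t))) (at t)"
      using t by (simp add: divide_inverse mult.commute)
  qed
qed

text \<open>\<open>r1\<close> and \<open>r2\<close> are the rates \<open>dV/dp\<close> against the
  common coordinate. By the chain rule \<open>V2\<close> after \<open>\<sigma>\<close> has
  derivative \<open>r2 (\<sigma> t) * p1' t\<close>, so ordered rates give ordered
  increments.\<close>

lemma reparametrised_increment:
  fixes \<sigma> V1 V2 p1' p2' r1 r2 :: "real \<Rightarrow> real"
  assumes le: "s1 \<le> t1"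
    and \<sigma>: "continuous_on {s1..t1} \<sigma>" "\<And>t. t \<in> {s1..t1} \<Longrightarrow> \<sigma> t \<in> {\<sigma> s1..\<sigma> t1}"
      "\<And>t. s1 < t \<Longrightarrow> t < t1 \<Longrightarrow> (\<sigma> has_real_derivative p1' t / p2' (\<sigma> t)) (at t)"
    and pos1: "\<And>t. t \<in> {s1..t1} \<Longrightarrow> 0 < p1' t"
    and pos2: "\<And>t. t \<in> {\<sigma> s1..\<sigma> t1} \<Longrightarrow> 0 < p2' t"
    and V1: "\<And>t. t \<in> {s1..t1} \<Longrightarrow> (V1 has_real_derivative r1 t * p1' t) (at t)"
    and V2: "\<And>t. t \<in> {\<sigma> s1..\<sigma> t1} \<Longrightarrow> (V2 has_real_derivative r2 t * p2' t) (at t)"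
  shows "(\<And>t. s1 < t \<Longrightarrow> t < t1 \<Longrightarrow> r1 t \<le> r2 (\<sigma> t)) \<Longrightarrow> V1 t1 - V1 s1 \<le> V2 (\<sigma> t1) - V2 (\<sigma> s1)"
    and "s1 < t1 \<Longrightarrow> (\<And>t. s1 < t \<Longrightarrow> t < t1 \<Longrightarrow> r1 t < r2 (\<sigma> t)) \<Longrightarrow> V1 t1 - V1 s1 < V2 (\<sigma> t1) - V2 (\<sigma> s1)"
proof -
  define U where "U t = V2 (\<sigma> t) - V1 t" for t
  have "continuous_on {s1..t1} V1" "continuous_on {\<sigma> s1..\<sigma> t1} V2"
    by (rule deriv_continuous_on, erule V1) (rule deriv_continuous_on, erule V2)
  then have cU: "continuous_on {s1..t1} U"
    unfolding U_def using \<sigma>(1,2) by (intro continuous_intros continuous_on_compose2[of _ V2 _ \<sigma>]) auto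
  have dU: "(U has_real_derivative (r2 (\<sigma> t) - r1 t) * p1' t) (at t)" if t: "s1 < t" "t < t1" for t
  proof -
    have m: "\<sigma> t \<in> {\<sigma> s1..\<sigma> t1}" using \<sigma>(2) t by simp
    have "(U has_real_derivative r2 (\<sigma> t) * p2' (\<sigma> t) * (p1' t / p2' (\<sigma> t)) - r1 t * p1' t) (at t)"
      unfolding U_def using t V1 by (intro DERIV_diff DERIV_chain2[OF V2[OF m] \<sigma>(3)]) auto
    moreover have "r2 (\<sigma> t) * p2' (\<sigma> t) * (p1' t / p2' (\<sigma> t)) - r1 t * p1' t = (r2 (\<sigma> t) - r1 t) * p1' t"
      using pos2[OF m] by (simp add: field_simps)
    ultimately show ?thesis by simp
  qed
  {
    assume r: "\<And>t. s1 < t \<Longrightarrow> t < t1 \<Longrightarrow> r1 t \<le> r2 (\<sigma> t)"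
    have "U s1 \<le> U t1"
    proof (rule DERIV_nonneg_imp_increasing_open[OF le _ cU])
      fix t assume t: "s1 < t" "t < t1"
      then have "0 \<le> (r2 (\<sigma> t) - r1 t) * p1' t"
        using r[OF t] pos1[of t] by (intro mult_nonneg_nonneg) auto
      then show "\<exists>y. (U has_real_derivative y) (at t) \<and> 0 \<le> y" using dU[OF t] by blast
    qed
    then show "V1 t1 - V1 s1 \<le> V2 (\<sigma> t1) - V2 (\<sigma> s1)" by (simp add: U_def)
  next
    assume lt: "s1 < t1" and r: "\<And>t. s1 < t \<Longrightarrow> t < t1 \<Longrightarrow> r1 t < r2 (\<sigma> t)"
    have "U s1 < U t1"
    proof (rule DERIV_pos_imp_increasing_open[OF lt _ cU])
      fix t assume t: "s1 < t" "t < t1"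
      then have "0 < (r2 (\<sigma> t) - r1 t) * p1' t"
        using r[OF t] pos1[of t] by (intro mult_pos_pos) auto
      then show "\<exists>y. (U has_real_derivative y) (at t) \<and> 0 < y" using dU[OF t] by blast
    qed
    then show "V1 t1 - V1 s1 < V2 (\<sigma> t1) - V2 (\<sigma> s1)" by (simp add: U_def)
  }
qed

lemma eventually_below:
  fixes u u' :: "real \<Rightarrow> real"
  assumes d: "\<And>t. T \<le> t \<Longrightarrow> (u has_real_derivative u' t) (at t)" and le: "\<And>t. T \<le> t \<Longrightarrow> u' t \<le> - c"
    and "0 < c"
  shows "\<exists>t>T. u t < K"
proof -
  define t where "t = T + 1 + \<bar>u T - K\<bar> / c"
  have t: "T < t" using \<open>0 < c\<close> by (simp add: t_def add_pos_nonneg)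
  have "u t + c * t \<le> u T + c * T"
  proof (rule deriv_nonpos_le[where u="\<lambda>t. u t + c * t" and u'="\<lambda>t. u' t + c"])
    show "((\<lambda>t. u t + c * t) has_real_derivative u' s + c) (at s)" if "s \<in> {T..t}" for s
      using that d[of s] by (auto intro!: derivative_eq_intros)
    show "u' s + c \<le> 0" if "T < s" for s using le[of s] that by simp
  qed (use t in simp)
  moreover have "c * t = c * T + c + \<bar>u T - K\<bar>" using \<open>0 < c\<close> by (simp add: t_def field_simps)
  ultimately have "u t < K" using \<open>0 < c\<close> by linarith
  then show ?thesis using t by blast
qed

lemma continuous_nonzero_pos:
  fixes u :: "real \<Rightarrow> real"
  assumes "continuous_on {a..b} u" "\<And>t. t \<in> {a..b} \<Longrightarrow> u t \<noteq> 0" "0 < u a" "t \<in> {a..b}"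
  shows "0 < u t"
proof (rule ccontr)
  assume "\<not> 0 < u t"
  then obtain s where "a \<le> s" "s \<le> t" "u s = 0"
    using IVT2'[of u t 0 a] assms continuous_on_subset[OF assms(1), of "{a..t}"] by force
  then show False using assms(2)[of s] assms(4) by auto
qed

section \<open>Passage through the right half plane\<close>

text \<open>Signs are prescribed on \<open>x > 0\<close> only, so that the left half plane becomes a
  second instance after a rotation. For a cut-off field \<open>G_unbounded\<close> holds because
  \<open>G\<close> grows linearly.\<close>

locale half_lienard =
  fixes f F g G :: "real \<Rightarrow> real" and L x1 :: real
  assumes lipv: "L-lipschitz_on UNIV (\<lambda>(x, y). (y - F x, - g x))"
    and cont_f: "continuous_on UNIV f" and cont_g: "continuous_on UNIV g"
    and DF: "(F has_real_derivative f x) (at x)"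
    and DG: "(G has_real_derivative g x) (at x)"
    and F_0 [simp]: "F 0 = 0" and G_0 [simp]: "G 0 = 0" and g_0 [simp]: "g 0 = 0"
    and g_pos: "0 < x \<Longrightarrow> 0 < g x"
    and x1_pos: "0 < x1"
    and F_neg: "0 < x \<Longrightarrow> x < x1 \<Longrightarrow> F x < 0" and F_x1 [simp]: "F x1 = 0"
    and F_mono: "mono_on {x1..} F"
    and G_unbounded: "\<exists>x>0. K < G x"
begin

abbreviation v :: "real \<times> real \<Rightarrow> real \<times> real" where
  "v \<equiv> \<lambda>(x, y). (y - F x, - g x)"

sublocale lipschitz_field v L
  by standard (rule lipv)

definition X :: "real \<Rightarrow> real \<Rightarrow> real" where "X a t = fst (flow v t (0, a))"
definition Y :: "real \<Rightarrow> real \<Rightarrow> real" where "Y a t = snd (flow v t (0, a))"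
text \<open>The horizontal velocity, by \<open>DX\<close>.\<close>

definition W :: "real \<Rightarrow> real \<Rightarrow> real" where "W a t = Y a t - F (X a t)"
definition energy :: "real \<Rightarrow> real \<Rightarrow> real" where "energy a t = (Y a t)\<^sup>2 / 2 + G (X a t)"

lemma flow_XY: "flow v t (0, a) = (X a t, Y a t)"
  by (simp add: X_def Y_def)

lemma X_0 [simp]: "X a 0 = 0" and Y_0 [simp]: "Y a 0 = a"
  by (simp_all add: X_def Y_def flow_0)

lemma W_0 [simp]: "W a 0 = a"
  by (simp add: W_def)

lemma DX: "(X a has_real_derivative W a t) (at t)"
  and DY: "(Y a has_real_derivative - g (X a t)) (at t)"
proof -
  have d: "((\<lambda>t. flow v t (0, a)) has_vector_derivative (W a t, - g (X a t))) (at t)"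
    using flow_has_derivative[of "(0, a)" t] by (simp add: flow_XY W_def)
  show "(X a has_real_derivative W a t) (at t)"
    using bounded_linear.has_vector_derivative[OF bounded_linear_fst d]
    by (simp add: flow_XY has_real_derivative_iff_has_vector_derivative)
  show "(Y a has_real_derivative - g (X a t)) (at t)"
    using bounded_linear.has_vector_derivative[OF bounded_linear_snd d]
    by (simp add: flow_XY has_real_derivative_iff_has_vector_derivative)
qed

lemma DGX: "((\<lambda>t. G (X a t)) has_real_derivative g (X a t) * W a t) (at t)"
  by (rule DERIV_chain2[OF DG DX])

lemma DFX: "((\<lambda>t. F (X a t)) has_real_derivative f (X a t) * W a t) (at t)"
  by (rule DERIV_chain2[OF DF DX])

lemma D_energy: "(energy a has_real_derivative - g (X a t) * F (X a t)) (at t)"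
  unfolding energy_def
  by (auto intro!: derivative_eq_intros DY DGX simp: W_def algebra_simps)

lemma cont_X: "continuous_on S (X a)" and cont_Y: "continuous_on S (Y a)"
  by (rule deriv_continuous_on, rule DX) (rule deriv_continuous_on, rule DY)

lemma compact_X_le: "compact {t \<in> {s..u}. X a t \<le> c}"
  and compact_X_ge: "compact {t \<in> {s..u}. c \<le> X a t}"
proof -
  have "closed {t. X a t \<le> c}" "closed {t. c \<le> X a t}"
    by (intro closed_Collect_le cont_X continuous_on_const)+
  then have "compact ({s..u} \<inter> {t. X a t \<le> c})" "compact ({s..u} \<inter> {t. c \<le> X a t})"
    by (auto intro: compact_Int_closed)
  then show "compact {t \<in> {s..u}. X a t \<le> c}" "compact {t \<in> {s..u}. c \<le> X a t}"
    by (simp_all add: Int_def)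
qed

lemma cont_F: "continuous_on S F" and cont_G: "continuous_on S G"
  by (rule deriv_continuous_on, rule DF) (rule deriv_continuous_on, rule DG)

lemma g_nonneg: "0 \<le> x \<Longrightarrow> 0 \<le> g x"
  using g_pos[of x] by (cases "x = 0") auto

lemma G_less: "0 \<le> x \<Longrightarrow> x < y \<Longrightarrow> G x < G y"
  by (rule deriv_pos_less[OF _ DG]) (auto intro: g_pos)

lemma G_le: "0 \<le> x \<Longrightarrow> x \<le> y \<Longrightarrow> G x \<le> G y"
  using G_less[of x y] by (cases "x = y") auto

lemma G_pos: "0 < x \<Longrightarrow> 0 < G x"
  using G_less[of 0 x] by simp

lemma F_nonneg: "x1 \<le> x \<Longrightarrow> 0 \<le> F x"
  using mono_onD[OF F_mono, of x1 x] by simp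

lemma F_le: "x1 \<le> x \<Longrightarrow> x \<le> y \<Longrightarrow> F x \<le> F y"
  using mono_onD[OF F_mono, of x y] by simp

lemma F_nonpos: "0 \<le> x \<Longrightarrow> x \<le> x1 \<Longrightarrow> F x \<le> 0"
  using F_neg[of x] by (cases "x = 0 \<or> x = x1") auto

lemma F_lower_bound:
  obtains m where "0 \<le> m" "\<And>x. 0 \<le> x \<Longrightarrow> - m \<le> F x"
proof -
  have "bounded (F ` {0..x1})"
    by (intro compact_imp_bounded compact_continuous_image cont_F compact_Icc)
  then obtain m where m: "\<And>x. x \<in> {0..x1} \<Longrightarrow> norm (F x) \<le> m"
    unfolding bounded_iff by blast
  show thesis
  proof (rule that)
    show "0 \<le> m" using m[of 0] x1_pos by simp
    show "- m \<le> F x" if "0 \<le> x" for x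
      using m[of x] m[of 0] F_nonneg[of x] that x1_pos by (cases "x \<le> x1") auto
  qed
qed

lemma Y_decreasing:
  assumes "s < t" "\<And>r. s < r \<Longrightarrow> r < t \<Longrightarrow> 0 < X a r"
  shows "Y a t < Y a s"
  using assms by (intro deriv_neg_less[OF _ DY]) (auto intro: g_pos)

text \<open>
  With \<open>\<Phi>' = f (X a t)\<close> one has \<open>(W e\<^sup>\<Phi>)' = - g (X a t) e\<^sup>\<Phi> < 0\<close>, so \<open>W\<close> changes sign at most once
  and \<open>X\<close> is unimodal.
\<close>
lemma W_negative:
  assumes pos: "\<And>r. s < r \<Longrightarrow> r < t \<Longrightarrow> 0 < X a r" and "s < t" "W a s \<le> 0"
  shows "W a t < 0"
proof -
  \<comment> \<open>The interval is enlarged by 1 so that the antiderivative has a two-sided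
    derivative also at \<open>s\<close> and \<open>t\<close>.\<close>
  have "continuous_on {s - 1..t + 1} (\<lambda>t. f (X a t))"
    by (intro continuous_on_compose2[OF cont_f cont_X]) auto
  then obtain \<Phi> where \<Phi>: "\<And>r. r \<in> {s - 1..t + 1} \<Longrightarrow>
      (\<Phi> has_vector_derivative f (X a r)) (at r within {s - 1..t + 1})"
    using antiderivative_continuous by blast
  have d\<Phi>: "(\<Phi> has_real_derivative f (X a r)) (at r)" if "r \<in> {s..t}" for r
    using \<Phi>[of r] that at_within_Icc_at[of "s - 1" r "t + 1"]
    by (simp add: has_real_derivative_iff_has_vector_derivative)
  have "W a t * exp (\<Phi> t) < W a s * exp (\<Phi> s)"
  proof (rule deriv_neg_less[where u="\<lambda>t. W a t * exp (\<Phi> t)" and u'="\<lambda>t. - g (X a t) * exp (\<Phi> t)"])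
    show "((\<lambda>t. W a t * exp (\<Phi> t)) has_real_derivative - g (X a r) * exp (\<Phi> r)) (at r)"
      if r: "r \<in> {s..t}" for r
      unfolding W_def by (rule derivative_eq_intros DY DFX d\<Phi>[OF r] refl)+ (simp add: W_def algebra_simps)
  qed (use pos g_pos \<open>s < t\<close> in auto)
  also have "\<dots> \<le> 0" using \<open>W a s \<le> 0\<close> by (simp add: mult_nonpos_nonneg)
  finally show ?thesis by (simp add: mult_less_0_iff)
qed

text \<open>On \<open>{d..B}\<close> the continuous \<open>g\<close> has a positive minimum, so
  \<open>Y\<close> falls at least linearly and passes below any \<open>K\<close>.\<close>

lemma X_leaves:
  assumes "0 < d" and X: "\<And>t. T \<le> t \<Longrightarrow> d \<le> X a t \<and> X a t \<le> B"
    and Y: "\<And>t. T \<le> t \<Longrightarrow> K \<le> Y a t"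
  shows False
proof -
  have "d \<le> B" using X[of T] by simp
  then obtain x where x: "x \<in> {d..B}" "\<And>y. y \<in> {d..B} \<Longrightarrow> g x \<le> g y"
    using continuous_attains_inf[OF compact_Icc _ continuous_on_subset[OF cont_g], of d B] by auto
  obtain t where "T < t" "Y a t < K"
  proof (atomize_elim, rule eventually_below[OF DY])
    show "- g (X a t) \<le> - g x" if "T \<le> t" for t using X[OF that] x(2) by simp
    show "0 < g x" using x(1) \<open>0 < d\<close> by (intro g_pos) simp
  qed
  then show False using Y[of t] by simp
qed

lemma X_initially_positive:
  assumes "0 < a"
  obtains d where "0 < d" "\<And>t. 0 < t \<Longrightarrow> t < d \<Longrightarrow> 0 < X a t"
  using DERIV_pos_inc_right[OF DX[of a 0]] assms that by auto

text \<open>An orbit staying in \<open>x > 0\<close> would be bounded: with \<open>Y\<close> below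
  \<open>- m - 1\<close> it would move left at unit speed and cross the axis, and
  \<open>C * Y + G X\<close> then bounds \<open>X\<close>. By \<open>X_leaves\<close> it cannot keep
  away from the axis, so it turns back and approaches it. There \<open>F\<close> is close to 0 while
  \<open>Y\<close> lies below some \<open>- r\<close>, which forces a crossing after all.\<close>

lemma returns_to_axis:
  assumes "0 < a"
  shows "\<exists>t>0. X a t \<le> 0"
proof (rule ccontr)
  assume "\<not> ?thesis"
  then have pos: "0 < X a t" if "0 < t" for t using that by (simp add: not_le)
  have nonneg: "0 \<le> X a t" if "0 \<le> t" for t using pos[of t] that by (cases "t = 0") auto
  obtain m where m: "0 \<le> m" "\<And>x. 0 \<le> x \<Longrightarrow> - m \<le> F x"
    using F_lower_bound by blast
  have Y_le: "Y a t \<le> Y a s" if "0 \<le> s" "s \<le> t" for s t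
    using Y_decreasing[of s t a] pos that by (cases "s = t") auto
  have no_escape: False if W: "\<And>t. T \<le> t \<Longrightarrow> W a t \<le> - c" and "0 < c" "0 \<le> T" for T c
  proof -
    have "\<exists>t>T. X a t < 0" by (rule eventually_below[OF DX W \<open>0 < c\<close>])
    then obtain t where "T < t" "X a t < 0" by blast
    then show False using nonneg[of t] \<open>0 \<le> T\<close> by simp
  qed
  have Y_lower: "- m - 1 \<le> Y a T" if "0 \<le> T" for T
  proof (rule ccontr)
    assume T: "\<not> ?thesis"
    have "W a t \<le> - 1" if t: "T \<le> t" for t
      using T t \<open>0 \<le> T\<close> m(2)[OF nonneg[of t]] Y_le[of T t] by (simp add: W_def)
    then show False using no_escape[of T 1] \<open>0 \<le> T\<close> by simp
  qed
  \<comment> \<open>\<open>C\<close> bounds the speed \<open>W = Y - F X\<close> from above, so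
    \<open>C * Y + G X\<close> has the nonpositive derivative \<open>g X * (W - C)\<close>.\<close>
  define C where "C = a + m"
  have *: "C * Y a t + G (X a t) \<le> C * Y a 0 + G (X a 0)" if t: "0 \<le> t" for t
  proof (rule deriv_nonpos_le[where u="\<lambda>t. C * Y a t + G (X a t)"
        and u'="\<lambda>t. g (X a t) * (W a t - C)"])
    show "((\<lambda>t. C * Y a t + G (X a t)) has_real_derivative g (X a r) * (W a r - C)) (at r)" for r
      by (rule derivative_eq_intros DY DGX refl)+ (simp add: algebra_simps)
    show "g (X a r) * (W a r - C) \<le> 0" if "0 < r" for r
      using that g_nonneg[OF nonneg[of r]] m(2)[OF nonneg[of r]] Y_le[of 0 r]
      by (intro mult_nonneg_nonpos) (auto simp: W_def C_def)
  qed (rule t)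
  have **: "C * (- m - 1) \<le> C * Y a t" if "0 \<le> t" for t
    using Y_lower[OF that] m(1) \<open>0 < a\<close> by (intro mult_left_mono) (auto simp: C_def)
  have G_bound: "G (X a t) \<le> C * a + C * (m + 1)" if "0 \<le> t" for t
  proof -
    have "C * (- m - 1) = - (C * (m + 1))" by (simp add: algebra_simps)
    moreover have "C * Y a t + G (X a t) \<le> C * a" "C * (- m - 1) \<le> C * Y a t" using * ** that by auto
    ultimately show ?thesis by linarith
  qed
  obtain B where B: "0 < B" "C * a + C * (m + 1) < G B" using G_unbounded by blast
  have X_le: "X a t \<le> B" if "0 \<le> t" for t
  proof (rule ccontr)
    assume "\<not> X a t \<le> B"
    then have "G B \<le> G (X a t)" using B(1) by (intro G_le) simp_all
    then show False using G_bound[OF that] B(2) by simp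
  qed
  \<comment> \<open>If \<open>X\<close> never stopped increasing, it would stay between
    \<open>X a 1\<close> and \<open>B\<close>, against \<open>X_leaves\<close>.\<close>
  have "\<exists>T>0. W a T \<le> 0"
  proof (rule ccontr)
    assume "\<not> ?thesis"
    then have W: "0 < W a t" if "0 < t" for t using that by (simp add: not_le)
    have "X a 1 \<le> X a t" if "1 \<le> t" for t
    proof (rule deriv_nonneg_le[OF that DX])
      show "0 \<le> W a r" if "1 < r" for r using W[of r] that by simp
    qed
    then show False
      by (intro X_leaves[of "X a 1" 1 a B "- m - 1"] conjI X_le Y_lower) (use pos[of 1] in simp_all)
  qed
  then obtain T where T: "0 < T" "W a T \<le> 0" by blast
  have W: "W a t < 0" if "T < t" for t
    using T that pos by (intro W_negative[of T t]) auto
  have X_dec: "X a t \<le> X a s" if "T \<le> s" "s \<le> t" for s t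
  proof (rule deriv_nonpos_le[OF that(2) DX])
    show "W a r \<le> 0" if "s < r" for r using W[of r] that \<open>T \<le> s\<close> by simp
  qed
  have small: "\<exists>S>T. X a S < d" if "0 < d" for d
  proof (rule ccontr)
    assume "\<not> ?thesis"
    then have "d \<le> X a t" if "T + 1 \<le> t" for t using that by (auto simp: not_less not_le dest: spec[of _ t])
    then show False
      by (intro X_leaves[of d "T + 1" a B "- m - 1"] conjI X_le Y_lower) (use \<open>0 < d\<close> T(1) in simp_all)
  qed
  \<comment> \<open>Left of \<open>x1\<close> one has \<open>F <= 0\<close>, so \<open>W < 0\<close>
    yields \<open>Y < 0\<close> at time \<open>S\<close>; as \<open>Y\<close> decreases, it stays
    below \<open>- r\<close> from then on.\<close>
  obtain S where S: "T < S" "X a S < x1" using small[OF x1_pos] by blast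
  define r where "r = - Y a S"
  have "F (X a S) \<le> 0" using S T(1) nonneg[of S] by (intro F_nonpos) auto
  then have r: "0 < r" using W[OF S(1)] by (simp add: W_def r_def)
  have "isCont F 0" by (rule DERIV_isCont[OF DF])
  then obtain d where d: "0 < d" "\<And>x. \<bar>x\<bar> < d \<Longrightarrow> \<bar>F x\<bar> < r / 2"
  proof -
    have "0 < r / 2" using r by simp
    then obtain d where "0 < d" "\<forall>x. dist x 0 < d \<longrightarrow> dist (F x) (F 0) < r / 2"
      using \<open>isCont F 0\<close> unfolding continuous_at_eps_delta by blast
    then show thesis using that by (simp add: dist_real_def)
  qed
  obtain S' where S': "T < S'" "X a S' < d" using small[OF d(1)] by blast
  have "W a t \<le> - (r / 2)" if t: "max S S' \<le> t" for t
  proof -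
    have "\<bar>X a t\<bar> < d" using X_dec[of S' t] nonneg[of t] t S' T(1) by auto
    moreover have "Y a t \<le> - r" using Y_le[of S t] t S T(1) by (simp add: r_def)
    ultimately show ?thesis using d(2)[of "X a t"] by (simp add: W_def abs_less_iff)
  qed
  then show False using no_escape[of "max S S'" "r / 2"] r S T(1) by (simp add: le_max_iff_disj)
qed

section \<open>Passage time and half return map\<close>

definition \<tau> :: "real \<Rightarrow> real" where
  "\<tau> a = (SOME t. 0 < t \<and> X a t = 0 \<and> (\<forall>s. 0 < s \<and> s < t \<longrightarrow> 0 < X a s))"

text \<open>The minus sign makes \<open>h\<close> positive, so that after the rotation the left half
  plane starts from \<open>h a\<close> exactly as the right one starts from
  \<open>a\<close>.\<close>

definition h :: "real \<Rightarrow> real" where "h a = - Y a (\<tau> a)"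

lemma passage:
  assumes "0 < a"
  shows \<tau>_pos: "0 < \<tau> a" and X_\<tau>: "X a (\<tau> a) = 0"
    and X_pos: "\<And>s. 0 < s \<Longrightarrow> s < \<tau> a \<Longrightarrow> 0 < X a s"
proof -
  obtain d where d: "0 < d" "\<And>t. 0 < t \<Longrightarrow> t < d \<Longrightarrow> 0 < X a t"
    using X_initially_positive[OF assms] by blast
  obtain t0 where t0: "0 < t0" "X a t0 \<le> 0" using returns_to_axis[OF assms] by blast
  have dt0: "d \<le> t0" using d(2)[of t0] t0 by force
  \<comment> \<open>Starting at \<open>d\<close> excludes the zero of \<open>X a\<close> at time
    0.\<close>
  have "compact {t \<in> {d..t0}. X a t \<le> 0}" by (rule compact_X_le)
  moreover have "t0 \<in> {t \<in> {d..t0}. X a t \<le> 0}" using t0 dt0 by simp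
  ultimately obtain t where t: "t \<in> {d..t0}" "X a t \<le> 0"
    and least: "\<And>s. s \<in> {d..t0} \<Longrightarrow> X a s \<le> 0 \<Longrightarrow> t \<le> s"
    using compact_attains_inf[of "{t \<in> {d..t0}. X a t \<le> 0}"] by blast
  have pos: "0 < X a s" if "0 < s" "s < t" for s
    using d(2)[of s] least[of s] that t(1) by force
  have "X a t = 0"
  proof (rule ccontr)
    assume "X a t \<noteq> 0"
    then have lt: "X a t < 0" using t by simp
    have "0 < X a (d / 2)" using d by simp
    then obtain s where "d / 2 \<le> s" "s \<le> t" "X a s = 0"
      using IVT2'[of "X a" t 0 "d / 2"] lt t(1) d(1) cont_X by auto
    then show False using pos[of s] lt d(1) by (cases "s = t") auto
  qed
  then have "0 < t \<and> X a t = 0 \<and> (\<forall>s. 0 < s \<and> s < t \<longrightarrow> 0 < X a s)"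
    using pos t(1) d(1) by auto
  then have *: "0 < \<tau> a \<and> X a (\<tau> a) = 0 \<and> (\<forall>s. 0 < s \<and> s < \<tau> a \<longrightarrow> 0 < X a s)"
    unfolding \<tau>_def by (rule someI)
  show "0 < \<tau> a" "X a (\<tau> a) = 0" using * by auto
  show "0 < X a s" if "0 < s" "s < \<tau> a" for s using * that by blast
qed

lemma X_nonneg: "0 < a \<Longrightarrow> t \<in> {0..\<tau> a} \<Longrightarrow> 0 \<le> X a t"
  using X_pos[of a t] X_\<tau>[of a] by (cases "t = 0 \<or> t = \<tau> a") auto

lemma Y_less: "0 < a \<Longrightarrow> 0 \<le> s \<Longrightarrow> s < t \<Longrightarrow> t \<le> \<tau> a \<Longrightarrow> Y a t < Y a s"
  using X_pos[of a] by (intro Y_decreasing) auto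

lemma Y_le: "0 < a \<Longrightarrow> 0 \<le> s \<Longrightarrow> s \<le> t \<Longrightarrow> t \<le> \<tau> a \<Longrightarrow> Y a t \<le> Y a s"
  using Y_less[of a s t] by (cases "s = t") auto

lemma W_neg: "0 < a \<Longrightarrow> 0 \<le> s \<Longrightarrow> s < t \<Longrightarrow> t \<le> \<tau> a \<Longrightarrow> W a s \<le> 0 \<Longrightarrow> W a t < 0"
  using X_pos[of a] by (intro W_negative[of s t]) auto

text \<open>The arc cannot end at the origin, which is an equilibrium, and \<open>W > 0\<close> at
  the end would make \<open>X\<close> negative just before it.\<close>

lemma h_pos:
  assumes "0 < a"
  shows "0 < h a"
proof -
  have nz: "Y a (\<tau> a) \<noteq> 0"
  proof
    assume "Y a (\<tau> a) = 0"
    then have "flow v (\<tau> a) (0, a) = flow v 0 (0, 0)"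
      using X_\<tau>[OF assms] by (simp add: flow_XY flow_0)
    from flow_cancel[OF this[symmetric]] have "flow v (0 - \<tau> a) (0, 0) = (0, a)" .
    moreover have "flow v (0 - \<tau> a) (0, 0) = (0, 0)" by (rule flow_equilibrium) (simp add: zero_prod_def)
    ultimately show False using assms by simp
  qed
  have "\<not> 0 < W a (\<tau> a)"
  proof
    assume "0 < W a (\<tau> a)"
    then obtain d where d: "0 < d" "\<And>e. 0 < e \<Longrightarrow> e < d \<Longrightarrow> X a (\<tau> a - e) < X a (\<tau> a)"
      using DERIV_pos_inc_left[OF DX] by blast
    define e where "e = min d (\<tau> a) / 2"
    have "0 < e" "e < d" "e < \<tau> a" using d(1) \<tau>_pos[OF assms] by (auto simp: e_def)
    then show False using d(2)[of e] X_pos[OF assms, of "\<tau> a - e"] X_\<tau>[OF assms] by simp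
  qed
  then show ?thesis using nz X_\<tau>[OF assms] by (simp add: W_def h_def)
qed

lemma Y_\<tau>: "Y a (\<tau> a) = - h a"
  by (simp add: h_def)

lemma flow_\<tau>: "0 < a \<Longrightarrow> flow v (\<tau> a) (0, a) = (0, - h a)"
  by (simp add: flow_XY X_\<tau> Y_\<tau>)

text \<open>If the arcs meet, a time shift carries one starting point to the other; but an arc meets
  the axis only at its two ends, and the lower end has negative height.\<close>

lemma orbits_disjoint:
  assumes "0 < a" "0 < b" "s \<in> {0..\<tau> a}" "t \<in> {0..\<tau> b}" "X a s = X b t" "Y a s = Y b t"
  shows "a = b"
proof -
  have *: "a = b" if a: "0 < a" "0 < b" and s: "s \<le> \<tau> a" "0 \<le> t" "t \<le> s"
    and eq: "flow v s (0, a) = flow v t (0, b)" for a b s t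
  proof -
    have "flow v (s - t) (0, a) = (0, b)" using flow_cancel[OF eq] .
    then have st: "X a (s - t) = 0" "Y a (s - t) = b" by (auto simp: flow_XY)
    then have "s - t = 0 \<or> s - t = \<tau> a" using X_pos[OF a(1), of "s - t"] s by fastforce
    then show ?thesis using st Y_\<tau>[of a] h_pos[OF a(1)] a by auto
  qed
  have "flow v s (0, a) = flow v t (0, b)" using assms by (simp add: flow_XY)
  then show ?thesis using *[of a b s t] *[of b a t s] assms by (cases "t \<le> s") auto
qed

section \<open>Energy along one passage and comparison of two passages\<close>

lemma energy_less:
  assumes "0 < a" "0 \<le> s" "s < t" "t \<le> \<tau> a" "\<And>r. s < r \<Longrightarrow> r < t \<Longrightarrow> X a r < x1"
  shows "energy a s < energy a t"
proof (rule deriv_pos_less[OF \<open>s < t\<close> D_energy])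
  fix r assume r: "s < r" "r < t"
  then have "0 < X a r" using X_pos[OF \<open>0 < a\<close>, of r] assms by simp
  then have "0 < g (X a r)" "F (X a r) < 0" using g_pos F_neg assms(5)[OF r] by auto
  then show "0 < - g (X a r) * F (X a r)" by (simp add: mult_pos_neg)
qed

lemma energy_le:
  assumes "0 < a" "s \<le> t" "\<And>r. s < r \<Longrightarrow> r < t \<Longrightarrow> x1 \<le> X a r"
  shows "energy a t \<le> energy a s"
proof (rule deriv_nonpos_le[OF \<open>s \<le> t\<close> D_energy])
  fix r assume r: "s < r" "r < t"
  have "0 \<le> g (X a r)" "0 \<le> F (X a r)" using assms(3)[OF r] x1_pos by (auto intro: g_nonneg F_nonneg)
  then show "- g (X a r) * F (X a r) \<le> 0" by simp
qed

lemma energy_0: "energy a 0 = a\<^sup>2 / 2"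
  by (simp add: energy_def)

lemma energy_\<tau>: "0 < a \<Longrightarrow> energy a (\<tau> a) = (h a)\<^sup>2 / 2"
  by (simp add: energy_def X_\<tau> Y_\<tau>)

text \<open>To fall below \<open>c\<close> the orbit must have \<open>W <= 0\<close> at some moment;
  by \<open>W_neg\<close> it moves left ever after and cannot come back to \<open>c\<close>.\<close>

lemma X_unimodal:
  assumes "0 < a" "0 \<le> s" "s \<le> t" "t \<le> u" "u \<le> \<tau> a" "c \<le> X a s" "c \<le> X a u"
  shows "c \<le> X a t"
proof (rule ccontr)
  assume c: "\<not> c \<le> X a t"
  have "\<exists>r. s < r \<and> r < t \<and> W a r \<le> 0"
  proof (rule ccontr)
    assume "\<not> ?thesis"
    then have "0 \<le> W a r" if "s < r" "r < t" for r using that by (auto simp: not_le less_imp_le)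
    then have "X a s \<le> X a t" by (intro deriv_nonneg_le[OF \<open>s \<le> t\<close> DX])
    then show False using c assms by simp
  qed
  then obtain r where r: "s < r" "r < t" "W a r \<le> 0" by blast
  have "X a u \<le> X a t"
  proof (rule deriv_nonpos_le[OF \<open>t \<le> u\<close> DX])
    show "W a q \<le> 0" if "t < q" "q < u" for q
      using W_neg[OF \<open>0 < a\<close>, of r q] that r assms by simp
  qed
  then show False using c assms by simp
qed

lemma last_visit:
  assumes "0 < a" "0 < c" "t0 \<in> {0..\<tau> a}" "c \<le> X a t0"
  obtains t where "t0 \<le> t" "t < \<tau> a" "X a t = c" "W a t \<le> 0"
    "\<And>s. t < s \<Longrightarrow> s \<le> \<tau> a \<Longrightarrow> X a s < c"
proof -
  have "{t \<in> {0..\<tau> a}. c \<le> X a t} \<noteq> {}" using assms by blast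
  then obtain t where t: "t \<in> {0..\<tau> a}" "c \<le> X a t"
    and sup: "\<And>s. s \<in> {0..\<tau> a} \<Longrightarrow> c \<le> X a s \<Longrightarrow> s \<le> t"
    using compact_attains_sup[OF compact_X_ge[of 0 "\<tau> a" c a]] by blast
  have after: "X a s < c" if "t < s" "s \<le> \<tau> a" for s
    using sup[of s] that t(1) by force
  have t\<tau>: "t < \<tau> a" using X_\<tau>[OF \<open>0 < a\<close>] t \<open>0 < c\<close> by (cases "t = \<tau> a") auto
  have Xt: "X a t = c"
  proof (rule ccontr)
    assume "X a t \<noteq> c"
    then have "c < X a t" using t by simp
    then obtain s where "t \<le> s" "s \<le> \<tau> a" "X a s = c"
      using IVT2'[of "X a" "\<tau> a" c t] cont_X X_\<tau>[OF \<open>0 < a\<close>] \<open>0 < c\<close> t\<tau> by auto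
    then show False using after[of s] \<open>X a t \<noteq> c\<close> by (cases "s = t") auto
  qed
  have "W a t \<le> 0"
  proof (rule ccontr)
    assume "\<not> W a t \<le> 0"
    then obtain d where d: "0 < d" "\<And>e. 0 < e \<Longrightarrow> e < d \<Longrightarrow> X a t < X a (t + e)"
      using DERIV_pos_inc_right[OF DX[of a t]] by auto
    define e where "e = min d (\<tau> a - t) / 2"
    have "0 < e" "e < d" "t + e \<le> \<tau> a" using d(1) t\<tau> by (auto simp: e_def min_def field_simps)
    then show False using d(2)[of e] after[of "t + e"] Xt by simp
  qed
  then show thesis using that[of t] sup[OF assms(3,4)] t\<tau> Xt after by blast
qed

lemma first_visit:
  assumes "0 < a" "0 < c" "t0 \<in> {0..\<tau> a}" "c \<le> X a t0"
  obtains t where "0 < t" "t \<le> t0" "X a t = c" "\<And>s. 0 \<le> s \<Longrightarrow> s < t \<Longrightarrow> X a s < c"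
proof -
  have "{t \<in> {0..\<tau> a}. c \<le> X a t} \<noteq> {}" using assms by blast
  then obtain t where t: "t \<in> {0..\<tau> a}" "c \<le> X a t"
    and inf: "\<And>s. s \<in> {0..\<tau> a} \<Longrightarrow> c \<le> X a s \<Longrightarrow> t \<le> s"
    using compact_attains_inf[OF compact_X_ge[of 0 "\<tau> a" c a]] by blast
  have before: "X a s < c" if "0 \<le> s" "s < t" for s
    using inf[of s] that t(1) by force
  have t0: "0 < t" using t \<open>0 < c\<close> by (cases "t = 0") auto
  have "X a t = c"
  proof (rule ccontr)
    assume "X a t \<noteq> c"
    then have "c < X a t" using t by simp
    then obtain s where "0 \<le> s" "s \<le> t" "X a s = c"
      using IVT'[of "X a" 0 c t] cont_X \<open>0 < c\<close> t0 by auto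
    then show False using before[of s] \<open>X a t \<noteq> c\<close> by (cases "s = t") auto
  qed
  then show thesis using that[of t] t0 inf[OF assms(3,4)] before by blast
qed

text \<open>If the arc stays left of \<open>x1\<close>, its energy grows all the way. Otherwise the
  energy grows after the last visit to \<open>x1\<close>, where it is already at least
  \<open>G x1\<close>.\<close>

lemma h_gt:
  assumes "0 < a"
  shows "a < h a \<or> G x1 < (h a)\<^sup>2 / 2" and "G x1 \<le> a\<^sup>2 / 2 \<Longrightarrow> G x1 < (h a)\<^sup>2 / 2"
proof -
  have "(a < h a \<and> a\<^sup>2 / 2 < (h a)\<^sup>2 / 2) \<or> G x1 < (h a)\<^sup>2 / 2"
  proof (cases "\<forall>t. 0 < t \<and> t < \<tau> a \<longrightarrow> X a t < x1")
    case True
    then have "energy a 0 < energy a (\<tau> a)"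
      using energy_less[OF assms, of 0 "\<tau> a"] \<tau>_pos[OF assms] by auto
    then have *: "a\<^sup>2 / 2 < (h a)\<^sup>2 / 2" by (simp add: energy_0 energy_\<tau>[OF assms])
    then have "a < h a" using power2_less_imp_less[of a "h a"] h_pos[OF assms] by simp
    then show ?thesis using * by blast
  next
    case False
    then obtain t0 where "0 < t0" "t0 < \<tau> a" "x1 \<le> X a t0" by (auto simp: not_less)
    then have "t0 \<in> {0..\<tau> a}" "x1 \<le> X a t0" by auto
    then obtain t where t: "t0 \<le> t" "t < \<tau> a" "X a t = x1"
      "\<And>s. t < s \<Longrightarrow> s \<le> \<tau> a \<Longrightarrow> X a s < x1"
      using last_visit[OF assms x1_pos] by metis
    have "energy a t < energy a (\<tau> a)"
      using energy_less[OF assms, of t "\<tau> a"] t \<open>t0 \<in> {0..\<tau> a}\<close> by auto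
    moreover have "G x1 \<le> energy a t" by (simp add: energy_def t)
    ultimately show ?thesis by (simp add: energy_\<tau>[OF assms])
  qed
  then show "a < h a \<or> G x1 < (h a)\<^sup>2 / 2" "G x1 \<le> a\<^sup>2 / 2 \<Longrightarrow> G x1 < (h a)\<^sup>2 / 2"
    by auto
qed

text \<open>The cuts are the first and the last visit to \<open>x1\<close>. The threshold on
  \<open>a\<close> forces the arc to get there with \<open>Y > 0\<close>: a zero of \<open>Y\<close>
  with \<open>X <= x1\<close> has energy at most \<open>G x1\<close>, whereas the energy of an arc
  that is still left of \<open>x1\<close> has risen above \<open>a\<^sup>2 / 2\<close>.\<close>

lemma stages:
  assumes a: "0 < a" and high: "G x1 \<le> a\<^sup>2 / 2"
  obtains tA tB where "0 < tA" "tA < tB" "tB < \<tau> a" "X a tA = x1" "X a tB = x1"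
    "\<And>t. t \<in> {0..tA} \<Longrightarrow> 0 < Y a t" "\<And>t. t \<in> {0..tA} \<Longrightarrow> 0 < W a t"
    "\<And>t. 0 < t \<Longrightarrow> t < tA \<Longrightarrow> 0 < X a t \<and> X a t < x1"
    "\<And>t. t \<in> {tA..tB} \<Longrightarrow> x1 \<le> X a t"
    "Y a tB < 0" "\<And>t. t \<in> {tB..\<tau> a} \<Longrightarrow> W a t < 0"
    "\<And>t. tB < t \<Longrightarrow> t < \<tau> a \<Longrightarrow> 0 < X a t \<and> X a t < x1"
proof -
  have "Y a (\<tau> a) \<le> 0" using Y_\<tau>[of a] h_pos[OF a] by simp
  then obtain tz where tz: "0 \<le> tz" "tz \<le> \<tau> a" "Y a tz = 0"
    using IVT2'[of "Y a" "\<tau> a" 0 0] a \<tau>_pos[OF a] cont_Y by auto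
  have tz0: "0 < tz" using tz a by (cases "tz = 0") auto
  have nozero: "Y a t \<noteq> 0" if t: "0 < t" "t \<le> \<tau> a" "\<And>s. 0 \<le> s \<Longrightarrow> s < t \<Longrightarrow> X a s < x1" "X a t \<le> x1" for t
  proof
    assume "Y a t = 0"
    have "energy a 0 < energy a t" using energy_less[OF a, of 0 t] t by simp
    moreover have "energy a t \<le> G x1"
      using \<open>Y a t = 0\<close> X_nonneg[OF a, of t] t by (auto simp: energy_def intro: G_le)
    ultimately show False using high by (simp add: energy_0)
  qed
  have "\<exists>t0 \<in> {0..tz}. x1 \<le> X a t0"
  proof (rule ccontr)
    assume "\<not> ?thesis"
    then have "X a t < x1" if "t \<in> {0..tz}" for t using that by (auto simp: not_le)
    then show False using nozero[of tz] tz tz0 by (simp add: less_imp_le)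
  qed
  then obtain t0 where t0: "t0 \<in> {0..tz}" "x1 \<le> X a t0" by blast
  then have t0': "t0 \<in> {0..\<tau> a}" using tz by simp
  obtain tA where tA: "0 < tA" "tA \<le> t0" "X a tA = x1" "\<And>s. 0 \<le> s \<Longrightarrow> s < tA \<Longrightarrow> X a s < x1"
    using first_visit[OF a x1_pos t0' t0(2)] by metis
  obtain tB where tB: "t0 \<le> tB" "tB < \<tau> a" "X a tB = x1" "W a tB \<le> 0"
    "\<And>s. tB < s \<Longrightarrow> s \<le> \<tau> a \<Longrightarrow> X a s < x1"
    using last_visit[OF a x1_pos t0' t0(2)] by metis
  have "Y a tA \<noteq> 0" using nozero[of tA] tA t0 tz by simp
  then have YA: "0 < Y a tA" using Y_le[OF a, of tA tz] tz tA t0 by simp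
  have Y: "0 < Y a t" if "t \<in> {0..tA}" for t
    using Y_le[OF a, of t tA] that YA tA t0 tz by simp
  have W: "0 < W a t" if t: "t \<in> {0..tA}" for t
  proof -
    have "X a t \<le> x1" using tA(3,4) t by (cases "t = tA") (auto intro: less_imp_le)
    then have "F (X a t) \<le> 0" using X_nonneg[OF a, of t] t tA t0 tz by (intro F_nonpos) auto
    then show ?thesis using Y[OF t] by (simp add: W_def)
  qed
  have "tA \<noteq> tB" using W[of tA] tA(1) tB(4) by auto
  then have AB: "tA < tB" using tA tB by simp
  \<comment> \<open>With \<open>W a tB = 0\<close>, \<open>W_neg\<close> would leave
    \<open>W > 0\<close> between the two visits, and \<open>X\<close> could not take the value
    \<open>x1\<close> at both.\<close>
  have "W a tB \<noteq> 0"
  proof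
    assume W0: "W a tB = 0"
    have "X a tA < X a tB"
    proof (rule deriv_pos_less[OF AB DX])
      show "0 < W a t" if "tA < t" "t < tB" for t
        using W_neg[OF a, of t tB] that W0 tA(1) tB(2) by force
    qed
    then show False using tA tB by simp
  qed
  then have WB: "W a tB < 0" using tB by simp
  show thesis
  proof (rule that[of tA tB])
    show "0 < X a t \<and> X a t < x1" if "0 < t" "t < tA" for t
      using that tA(4) X_pos[OF a, of t] AB tB(2) by simp
    show "x1 \<le> X a t" if "t \<in> {tA..tB}" for t
      using X_unimodal[OF a, of tA t tB x1] that tA tB by simp
    show "Y a tB < 0" using WB tB(3) by (simp add: W_def)
    show "W a t < 0" if "t \<in> {tB..\<tau> a}" for t
      using W_neg[OF a, of tB t] that WB tA(1) AB by (cases "t = tB") auto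
    show "0 < X a t \<and> X a t < x1" if "tB < t" "t < \<tau> a" for t
      using that tB(5) X_pos[OF a, of t] AB tA(1) by simp
  qed (use tA tB AB Y W in simp_all)
qed

text \<open>
  The outer orbit gains less energy than the inner one: over \<open>0 \<le> x \<le> x1\<close> both are graphs over the
  \<open>x\<close>-axis with \<open>dE/dx = - g F / (y - F)\<close>, and over \<open>x \<ge> x1\<close> they are graphs over the \<open>y\<close>-axis with
  \<open>dE/dy = F\<close>.
\<close>
lemma h_comparison:
  assumes a: "0 < a" and ab: "a < b" and high: "G x1 \<le> a\<^sup>2 / 2"
  shows "h a < h b" "(h b)\<^sup>2 - b\<^sup>2 < (h a)\<^sup>2 - a\<^sup>2"
proof -
  have b: "0 < b" using a ab by simp
  have "a\<^sup>2 < b\<^sup>2" using a ab by (simp add: power_strict_mono)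
  then have highb: "G x1 \<le> b\<^sup>2 / 2" using high by simp
  obtain tA tB where A: "0 < tA" "tA < tB" "tB < \<tau> a" "X a tA = x1" "X a tB = x1"
    "\<And>t. t \<in> {0..tA} \<Longrightarrow> 0 < Y a t" "\<And>t. t \<in> {0..tA} \<Longrightarrow> 0 < W a t"
    "\<And>t. 0 < t \<Longrightarrow> t < tA \<Longrightarrow> 0 < X a t \<and> X a t < x1"
    "\<And>t. t \<in> {tA..tB} \<Longrightarrow> x1 \<le> X a t"
    "Y a tB < 0" "\<And>t. t \<in> {tB..\<tau> a} \<Longrightarrow> W a t < 0"
    "\<And>t. tB < t \<Longrightarrow> t < \<tau> a \<Longrightarrow> 0 < X a t \<and> X a t < x1"
    using stages[OF a high] by blast
  obtain sA sB where B: "0 < sA" "sA < sB" "sB < \<tau> b" "X b sA = x1" "X b sB = x1"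
    "\<And>t. t \<in> {0..sA} \<Longrightarrow> 0 < Y b t" "\<And>t. t \<in> {0..sA} \<Longrightarrow> 0 < W b t"
    "\<And>t. 0 < t \<Longrightarrow> t < sA \<Longrightarrow> 0 < X b t \<and> X b t < x1"
    "\<And>t. t \<in> {sA..sB} \<Longrightarrow> x1 \<le> X b t"
    "Y b sB < 0" "\<And>t. t \<in> {sB..\<tau> b} \<Longrightarrow> W b t < 0"
    "\<And>t. sB < t \<Longrightarrow> t < \<tau> b \<Longrightarrow> 0 < X b t \<and> X b t < x1"
    using stages[OF b highb] by blast
  have disj: False if "s \<in> {0..\<tau> a}" "t \<in> {0..\<tau> b}" "X a s = X b t" "Y a s = Y b t" for s t
    using orbits_disjoint[OF a b that] ab by simp

  obtain \<sigma> where \<sigma>: "\<sigma> 0 = 0" "\<sigma> tA = sA" "continuous_on {0..tA} \<sigma>"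
    "\<And>t. t \<in> {0..tA} \<Longrightarrow> \<sigma> t \<in> {0..sA}" "\<And>t. t \<in> {0..tA} \<Longrightarrow> X b (\<sigma> t) = X a t"
    "\<And>t. 0 < t \<Longrightarrow> t < tA \<Longrightarrow> (\<sigma> has_real_derivative W a t / W b (\<sigma> t)) (at t)"
    by (rule reparametrisation[of 0 tA 0 sA "X a" "W a" "X b" "W b"]) (use A B DX in auto)
  \<comment> \<open>The order at the start persists because equality of heights at equal
    \<open>x\<close> would be a meeting of two different orbits.\<close>
  have up: "Y a t < Y b (\<sigma> t)" if t: "t \<in> {0..tA}" for t
  proof -
    have "0 < Y b (\<sigma> t) - Y a t"
    proof (rule continuous_nonzero_pos[OF _ _ _ t])
      show "continuous_on {0..tA} (\<lambda>t. Y b (\<sigma> t) - Y a t)"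
        by (intro continuous_intros cont_Y continuous_on_compose2[OF cont_Y[of UNIV] \<sigma>(3)]) auto
      show "Y b (\<sigma> s) - Y a s \<noteq> 0" if "s \<in> {0..tA}" for s
        using disj[of s "\<sigma> s"] \<sigma>(4,5)[OF that] that A(2,3) B(2,3) by auto
    qed (simp add: \<sigma>(1) ab)
    then show ?thesis by simp
  qed
  have "energy b (\<sigma> tA) - energy b (\<sigma> 0) < energy a tA - energy a 0"
  proof -
    \<comment> \<open>The rate of minus the energy against \<open>x\<close>. Here
      \<open>g * F < 0\<close> and the outer orbit has the larger \<open>W\<close>, so its rate is
      closer to 0 and hence larger.\<close>
    define r where "r a t = g (X a t) * F (X a t) / W a t" for a t
    have D: "((\<lambda>t. - energy c t) has_real_derivative r c t * W c t) (at t)" if "W c t \<noteq> 0" for c t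
      using DERIV_minus[OF D_energy[of c t]] that by (simp add: r_def)
    have "- energy a tA - (- energy a 0) < - energy b (\<sigma> tA) - (- energy b (\<sigma> 0))"
    proof (rule reparametrised_increment(2)[where ?s1.0=0 and ?t1.0=tA and ?r1.0="r a" and ?r2.0="r b" and \<sigma>=\<sigma>
          and p1'="W a" and p2'="W b"])
      fix t assume t: "0 < t" "t < tA"
      have X: "0 < X a t" "X a t < x1" using A(8)[OF t] by auto
      have W: "0 < W a t" "W a t < W b (\<sigma> t)"
        using A(7)[of t] up[of t] \<sigma>(5)[of t] t by (auto simp: W_def)
      have "g (X a t) * F (X a t) < 0" using X by (intro mult_pos_neg g_pos F_neg)
      then show "r a t < r b (\<sigma> t)"
        using \<sigma>(5)[of t] t W by (simp add: r_def divide_strict_left_mono_neg)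
    next
      show "((\<lambda>t. - energy a t) has_real_derivative r a t * W a t) (at t)" if "t \<in> {0..tA}" for t
        using D A(7)[OF that] by simp
      show "((\<lambda>t. - energy b t) has_real_derivative r b t * W b t) (at t)" if "t \<in> {\<sigma> 0..\<sigma> tA}" for t
        using D B(7)[of t] that \<sigma>(1,2) by simp
    qed (use A B \<sigma> in auto)
    then show ?thesis by simp
  qed
  then have E1: "energy b sA - energy b 0 < energy a tA - energy a 0" using \<sigma> by simp

  have YA: "Y a tA < Y b sA" using up[of tA] A(1) \<sigma>(2) by simp
  \<comment> \<open>The outer orbit enters \<open>x >= x1\<close> above the inner one; it is
    compared only after it has come down to the inner entry height.\<close>
  obtain s where s: "sA \<le> s" "s \<le> sB" "Y b s = Y a tA"
    using IVT2'[of "Y b" sB "Y a tA" sA] YA A(6)[of tA] B(10) A(1) B(2) cont_Y by auto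
  \<comment> \<open>A height that both orbits reach within \<open>x >= x1\<close>, since it is not
    yet known which of them leaves at the lower height.\<close>
  define y where "y = max (Y a tB) (Y b sB)"
  have y: "y < Y a tA" using A(6)[of tA] A(1,10) B(10) by (simp add: y_def)
  obtain u where u: "tA \<le> u" "u \<le> tB" "Y a u = y"
    using IVT2'[of "Y a" tB y tA] y A(2) cont_Y by (auto simp: y_def)
  obtain u' where u': "s \<le> u'" "u' \<le> sB" "Y b u' = y"
    using IVT2'[of "Y b" sB y s] y s cont_Y by (auto simp: y_def)
  have gpos: "0 < g (X a t)" if "t \<in> {tA..tB}" for t using A(9)[OF that] x1_pos by (intro g_pos) simp
  have gposb: "0 < g (X b t)" if "t \<in> {sA..sB}" for t using B(9)[OF that] x1_pos by (intro g_pos) simp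
  have DmY: "((\<lambda>t. - Y c t) has_real_derivative g (X c t)) (at t)" for c t
    using DERIV_minus[OF DY[of c t]] by simp
  obtain \<rho> where \<rho>: "\<rho> tA = s" "\<rho> u = u'" "continuous_on {tA..u} \<rho>"
    "\<And>t. t \<in> {tA..u} \<Longrightarrow> \<rho> t \<in> {s..u'}" "\<And>t. t \<in> {tA..u} \<Longrightarrow> - Y b (\<rho> t) = - Y a t"
    "\<And>t. tA < t \<Longrightarrow> t < u \<Longrightarrow> (\<rho> has_real_derivative g (X a t) / g (X b (\<rho> t))) (at t)"
    by (rule reparametrisation[of tA u s u' "\<lambda>t. - Y a t" "\<lambda>t. g (X a t)" "\<lambda>t. - Y b t" "\<lambda>t. g (X b t)"])
      (use u u' s gpos gposb DmY in auto)
  have out: "X a t < X b (\<rho> t)" if t: "t \<in> {tA..u}" for t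
  proof -
    have nz: "X b (\<rho> t) - X a t \<noteq> 0" if "t \<in> {tA..u}" for t
      using disj[of t "\<rho> t"] \<rho>(4,5)[OF that] that A(1,3) B(1,3) u u' s by auto
    have "0 < X b (\<rho> t) - X a t"
    proof (rule continuous_nonzero_pos[OF _ nz _ t])
      show "continuous_on {tA..u} (\<lambda>t. X b (\<rho> t) - X a t)"
        by (intro continuous_intros cont_X continuous_on_compose2[OF cont_X[of UNIV] \<rho>(3)]) auto
      have "x1 \<le> X b s" using B(9)[of s] s by simp
      then show "0 < X b (\<rho> tA) - X a tA" using nz[of tA] u A(4) \<rho>(1) by simp
    qed
    then show ?thesis by simp
  qed
  \<comment> \<open>Otherwise the matched outer piece would end at its exit, thus at
    \<open>x1\<close>, though it lies strictly to the right of a point with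
    \<open>x >= x1\<close>.\<close>
  have YB: "Y b sB < Y a tB"
  proof (rule ccontr)
    assume n: "\<not> ?thesis"
    have "u' = sB"
    proof (rule ccontr)
      assume "u' \<noteq> sB"
      then have "Y b sB < Y b u'" using u' s B(1,3) by (intro Y_less[OF b]) auto
      then show False using n u'(3) by (simp add: y_def)
    qed
    then have "X b (\<rho> u) = x1" using \<rho>(2) B(5) by simp
    then show False using out[of u] A(9)[of u] u by simp
  qed
  have "u = tB"
  proof (rule ccontr)
    assume "u \<noteq> tB"
    then have "Y a tB < Y a u" using u A(1,3) by (intro Y_less[OF a]) auto
    then show False using YB u(3) by (simp add: y_def)
  qed
  have "energy b u' - energy b s \<le> energy a u - energy a tA"
  proof -
    have "- energy a u - (- energy a tA) \<le> - energy b (\<rho> u) - (- energy b (\<rho> tA))"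
    proof (rule reparametrised_increment(1)[where ?s1.0=tA and ?t1.0=u and ?r1.0="\<lambda>t. F (X a t)"
          and ?r2.0="\<lambda>t. F (X b t)" and \<sigma>=\<rho> and p1'="\<lambda>t. g (X a t)" and p2'="\<lambda>t. g (X b t)"])
      fix t assume t: "tA < t" "t < u"
      then show "F (X a t) \<le> F (X b (\<rho> t))"
        using out[of t] A(9)[of t] u by (intro F_le) auto
    next
      fix t
      show "((\<lambda>t. - energy a t) has_real_derivative F (X a t) * g (X a t)) (at t)"
        "((\<lambda>t. - energy b t) has_real_derivative F (X b t) * g (X b t)) (at t)"
        using DERIV_minus[OF D_energy[of _ t]] by (simp_all add: mult.commute)
    qed (use \<rho> u u' s gpos gposb in auto)
    then show ?thesis using \<rho> by simp
  qed
  \<comment> \<open>The pieces of the outer orbit that were cut away, before \<open>s\<close> and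
    after \<open>u'\<close>, lie in \<open>x >= x1\<close> and can only lower its energy.\<close>
  moreover have "energy b s \<le> energy b sA" "energy b sB \<le> energy b u'"
    using s u' B(9) by (auto intro!: energy_le[OF b])
  ultimately have E2: "energy b sB - energy b sA \<le> energy a tB - energy a tA"
    using \<open>u = tB\<close> by simp

  have DmX: "((\<lambda>t. - X c t) has_real_derivative - W c t) (at t)" for c t
    by (rule DERIV_minus[OF DX])
  obtain \<omega> where \<omega>: "\<omega> tB = sB" "\<omega> (\<tau> a) = \<tau> b" "continuous_on {tB..\<tau> a} \<omega>"
    "\<And>t. t \<in> {tB..\<tau> a} \<Longrightarrow> \<omega> t \<in> {sB..\<tau> b}" "\<And>t. t \<in> {tB..\<tau> a} \<Longrightarrow> - X b (\<omega> t) = - X a t"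
    "\<And>t. tB < t \<Longrightarrow> t < \<tau> a \<Longrightarrow> (\<omega> has_real_derivative - W a t / - W b (\<omega> t)) (at t)"
    by (rule reparametrisation[of tB "\<tau> a" sB "\<tau> b" "\<lambda>t. - X a t" "\<lambda>t. - W a t" "\<lambda>t. - X b t" "\<lambda>t. - W b t"])
      (use A B DmX X_\<tau>[OF a] X_\<tau>[OF b] in auto)
  have down: "Y b (\<omega> t) < Y a t" if t: "t \<in> {tB..\<tau> a}" for t
  proof -
    have "0 < Y a t - Y b (\<omega> t)"
    proof (rule continuous_nonzero_pos[OF _ _ _ t])
      show "continuous_on {tB..\<tau> a} (\<lambda>t. Y a t - Y b (\<omega> t))"
        by (intro continuous_intros cont_Y continuous_on_compose2[OF cont_Y[of UNIV] \<omega>(3)]) auto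
      show "Y a q - Y b (\<omega> q) \<noteq> 0" if "q \<in> {tB..\<tau> a}" for q
        using disj[of q "\<omega> q"] \<omega>(4,5)[OF that] that A(1,2) B(1,2) by auto
    qed (simp add: \<omega>(1) YB)
    then show ?thesis by simp
  qed
  have "energy b (\<omega> (\<tau> a)) - energy b (\<omega> tB) < energy a (\<tau> a) - energy a tB"
  proof -
    \<comment> \<open>On the way back \<open>- x\<close> is the increasing coordinate, with speed
      \<open>- W\<close>; again \<open>g * F < 0\<close> and the outer orbit is the faster
      one.\<close>
    define r where "r a t = - (g (X a t) * F (X a t)) / W a t" for a t
    have D: "((\<lambda>t. - energy c t) has_real_derivative r c t * - W c t) (at t)" if "W c t \<noteq> 0" for c t
      using DERIV_minus[OF D_energy[of c t]] that by (simp add: r_def)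
    have "- energy a (\<tau> a) - (- energy a tB) < - energy b (\<omega> (\<tau> a)) - (- energy b (\<omega> tB))"
    proof (rule reparametrised_increment(2)[where ?s1.0=tB and ?t1.0="\<tau> a" and ?r1.0="r a" and ?r2.0="r b" and \<sigma>=\<omega>
          and p1'="\<lambda>t. - W a t" and p2'="\<lambda>t. - W b t"])
      fix t assume t: "tB < t" "t < \<tau> a"
      have X: "0 < X a t" "X a t < x1" using A(12)[OF t] by auto
      have W: "W a t < 0" "W b (\<omega> t) < W a t"
        using A(11)[of t] down[of t] \<omega>(5)[of t] t by (auto simp: W_def)
      have "g (X a t) * F (X a t) < 0" using X by (intro mult_pos_neg g_pos F_neg)
      then show "r a t < r b (\<omega> t)"
        using \<omega>(5)[of t] t W by (simp add: r_def divide_simps mult_less_cancel_left)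
    next
      show "((\<lambda>t. - energy a t) has_real_derivative r a t * - W a t) (at t)" if "t \<in> {tB..\<tau> a}" for t
        using D A(11)[OF that] by simp
      show "((\<lambda>t. - energy b t) has_real_derivative r b t * - W b t) (at t)" if "t \<in> {\<omega> tB..\<omega> (\<tau> a)}" for t
        using D B(11)[of t] that \<omega>(1,2) by simp
    qed (use A B \<omega> in auto)
    then show ?thesis by simp
  qed
  then have E3: "energy b (\<tau> b) - energy b sB < energy a (\<tau> a) - energy a tB" using \<omega> by simp

  show "h a < h b" using down[of "\<tau> a"] A(3) \<omega>(2) by (simp add: Y_\<tau>)
  have "energy b (\<tau> b) - energy b 0 < energy a (\<tau> a) - energy a 0"
    using E1 E2 E3 by simp
  then show "(h b)\<^sup>2 - b\<^sup>2 < (h a)\<^sup>2 - a\<^sup>2"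
    by (simp add: energy_0 energy_\<tau>[OF a] energy_\<tau>[OF b])
qed

section \<open>A priori bounds: width of a passage and energy gained in it\<close>

text \<open>At the rightmost point \<open>W = 0\<close>, so \<open>F X = Y <= A\<close>. Since
  \<open>C = A + m\<close> bounds \<open>W\<close>, the quantity \<open>C * Y + G X\<close> does not
  increase, which gives \<open>G X <= (A + m) * A\<close> there. Beyond \<open>x1\<close> neither
  \<open>F\<close> nor \<open>G\<close> decreases, so \<open>\<xi>\<close> cannot have been reached.
  Beyond the strip, only the values at the single point \<open>\<xi>\<close> enter.\<close>

lemma X_bound:
  assumes a: "0 < a" "a \<le> A" and m: "0 \<le> m" "\<And>x. x \<in> {0..x1} \<Longrightarrow> - m \<le> F x"
    and \<xi>: "x1 \<le> \<xi>" "A + (A + m) * A < G \<xi> + F \<xi>" and t: "t \<in> {0..\<tau> a}"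
  shows "X a t < \<xi>"
proof (rule ccontr)
  assume "\<not> X a t < \<xi>"
  then have Xt: "\<xi> \<le> X a t" by simp
  have "{0..\<tau> a} \<noteq> {}" using \<tau>_pos[OF a(1)] by simp
  then obtain u where u: "u \<in> {0..\<tau> a}" "\<And>s. s \<in> {0..\<tau> a} \<Longrightarrow> X a s \<le> X a u"
    using continuous_attains_sup[OF compact_Icc _ cont_X, of 0 "\<tau> a" a] by blast
  have Xu: "\<xi> \<le> X a u" using u(2)[OF t] Xt by simp
  then have "u \<noteq> 0" "u \<noteq> \<tau> a" using \<xi>(1) x1_pos X_\<tau>[OF a(1)] by auto
  then have u': "0 < u" "u < \<tau> a" using u(1) by auto
  have "W a u = 0"
  proof (rule DERIV_local_max[OF DX[of a u]])
    show "0 < min u (\<tau> a - u)" using u' by simp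
    show "\<forall>y. \<bar>u - y\<bar> < min u (\<tau> a - u) \<longrightarrow> X a y \<le> X a u"
      using u(2) by (auto simp: abs_less_iff)
  qed
  then have Yu: "Y a u = F (X a u)" by (simp add: W_def)
  have "Y a u \<le> a" using Y_le[OF a(1), of 0 u] u' by simp
  moreover have "F \<xi> \<le> F (X a u)" using F_le[OF \<xi>(1) Xu] .
  ultimately have F\<xi>: "F \<xi> \<le> A" using Yu a by simp
  define C where "C = A + m"
  have C: "0 \<le> C" using a m by (simp add: C_def)
  have Flow: "- m \<le> F x" if "0 \<le> x" for x
    using m(2)[of x] F_nonneg[of x] m(1) that by (cases "x \<le> x1") auto
  have "C * Y a u + G (X a u) \<le> C * Y a 0 + G (X a 0)"
  proof (rule deriv_nonpos_le[where u="\<lambda>t. C * Y a t + G (X a t)"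
        and u'="\<lambda>t. g (X a t) * (W a t - C)"])
    show "((\<lambda>t. C * Y a t + G (X a t)) has_real_derivative g (X a r) * (W a r - C)) (at r)" for r
      by (rule derivative_eq_intros DY DGX refl)+ (simp add: algebra_simps)
    show "g (X a r) * (W a r - C) \<le> 0" if "0 < r" "r < u" for r
    proof (rule mult_nonneg_nonpos)
      have X: "0 \<le> X a r" using X_nonneg[OF a(1), of r] that u' by simp
      then show "0 \<le> g (X a r)" by (rule g_nonneg)
      show "W a r - C \<le> 0" using Flow[OF X] Y_le[OF a(1), of 0 r] that u' a(2) by (simp add: W_def C_def)
    qed
  qed (use u' in simp)
  moreover have "C * a \<le> C * A" using a C by (intro mult_left_mono)
  moreover have "0 \<le> C * Y a u" using C Yu F_nonneg[of "X a u"] Xu \<xi>(1) by simp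
  moreover have "G \<xi> \<le> G (X a u)" using Xu \<xi>(1) x1_pos by (intro G_le) auto
  ultimately show False using F\<xi> \<xi>(2) by (simp add: C_def)
qed

text \<open>As long as \<open>Y <= - (m + 1)\<close>, the speed to the left is at least 1 and
  \<open>energy + m * G X\<close> does not increase, so the gain is at most \<open>m * G x1\<close>.
  The three cases are: this depth is never exceeded, it is there from the start of the stage, or it
  is reached on the way, at a moment of energy at most
  \<open>(m + 1)\<^sup>2 / 2 + G x1\<close>.\<close>

lemma lower_stage_energy:
  assumes a: "0 < a" and m: "\<And>x. x \<in> {0..x1} \<Longrightarrow> \<bar>F x\<bar> \<le> m"
    and tB: "0 < tB" "tB < \<tau> a" "X a tB = x1" "\<And>t. tB < t \<Longrightarrow> t < \<tau> a \<Longrightarrow> 0 < X a t \<and> X a t < x1"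
  shows "(h a)\<^sup>2 / 2 \<le> max (energy a tB) ((m + 1)\<^sup>2 / 2 + G x1) + m * G x1"
proof -
  have m0: "0 \<le> m" using m[of 0] x1_pos by simp
  have G1: "0 < G x1" using x1_pos by (rule G_pos)
  have Xin: "X a t \<in> {0..x1}" if "tB \<le> t" "t \<le> \<tau> a" for t
    using tB(4)[of t] that tB(3) X_\<tau>[OF a] x1_pos by (cases "t = tB \<or> t = \<tau> a") (auto simp: less_imp_le)
  have step: "energy a (\<tau> a) \<le> energy a s + m * G x1" if s: "tB \<le> s" "s \<le> \<tau> a" "Y a s \<le> - (m + 1)" for s
  proof -
    have "energy a (\<tau> a) + m * G (X a (\<tau> a)) \<le> energy a s + m * G (X a s)"
    proof (rule deriv_nonpos_le[where u="\<lambda>t. energy a t + m * G (X a t)"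
          and u'="\<lambda>t. g (X a t) * (m * W a t - F (X a t))"])
      show "((\<lambda>t. energy a t + m * G (X a t)) has_real_derivative g (X a r) * (m * W a r - F (X a r))) (at r)" for r
        by (rule derivative_eq_intros D_energy DGX refl)+ (simp add: algebra_simps)
      fix r assume r: "s < r" "r < \<tau> a"
      have X: "X a r \<in> {0..x1}" using Xin[of r] r s by simp
      have "\<bar>F (X a r)\<bar> \<le> m" using m[OF X] .
      moreover have "Y a r \<le> - (m + 1)" using Y_le[OF a, of s r] r s tB by simp
      ultimately have "W a r \<le> - 1" "- F (X a r) \<le> m" by (auto simp: W_def abs_le_iff)
      then have "m * W a r - F (X a r) \<le> 0" using mult_left_mono[of "W a r" "- 1" m] m0 by simp
      moreover have "0 \<le> g (X a r)" using X by (intro g_nonneg) simp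
      ultimately show "g (X a r) * (m * W a r - F (X a r)) \<le> 0" by (rule mult_nonneg_nonpos[rotated])
    qed (rule s(2))
    moreover have "m * G (X a s) \<le> m * G x1" using Xin[OF s(1,2)] m0 by (intro mult_left_mono G_le) auto
    ultimately show ?thesis using X_\<tau>[OF a] by simp
  qed
  consider "h a \<le> m + 1" | "m + 1 < h a" "Y a tB \<le> - (m + 1)" | "m + 1 < h a" "- (m + 1) < Y a tB"
    by linarith
  then show ?thesis
  proof cases
    case 1
    then have "(h a)\<^sup>2 \<le> (m + 1)\<^sup>2" using h_pos[OF a] by (intro power_mono) auto
    moreover have "0 \<le> m * G x1" using m0 G1 by simp
    ultimately show ?thesis using G1 by linarith
  next
    case 2
    then have "energy a (\<tau> a) \<le> energy a tB + m * G x1" using step[of tB] tB by simp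
    then show ?thesis
      using energy_\<tau>[OF a] max.cobounded1[of "energy a tB" "(m + 1)\<^sup>2 / 2 + G x1"] by linarith
  next
    case 3
    then obtain s where s: "tB \<le> s" "s \<le> \<tau> a" "Y a s = - (m + 1)"
      using IVT2'[of "Y a" "\<tau> a" "- (m + 1)" tB] tB(2) cont_Y Y_\<tau>[of a] by auto
    have "G (X a s) \<le> G x1" using Xin[OF s(1,2)] by (intro G_le) auto
    then have "energy a s \<le> (m + 1)\<^sup>2 / 2 + G x1"
      unfolding energy_def s(3) by (simp add: power2_eq_square algebra_simps)
    moreover have "energy a (\<tau> a) \<le> energy a s + m * G x1" using step[of s] s by simp
    ultimately show ?thesis
      using energy_\<tau>[OF a] max.cobounded2[of "(m + 1)\<^sup>2 / 2 + G x1" "energy a tB"] by linarith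
  qed
qed

lemma upper_stage_energy:
  assumes a: "0 < a" and tA: "X a tA = x1" "0 < Y a tA" "0 \<le> tA" "tA \<le> \<tau> a"
  shows "energy a tA \<le> a\<^sup>2 / 2 + G x1"
proof -
  have "Y a tA \<le> a" using Y_le[OF a, of 0 tA] tA by simp
  then have "(Y a tA)\<^sup>2 \<le> a\<^sup>2" using tA by (intro power_mono) auto
  then show ?thesis by (simp add: energy_def tA)
qed

text \<open>The crude bound, in which the passage through \<open>x >= x1\<close> is only known not
  to gain energy. It serves for the left half plane and for bounding the depth of the cycle.\<close>

lemma h_estimate:
  assumes a: "0 < a" and high: "G x1 \<le> a\<^sup>2 / 2" and m: "\<And>x. x \<in> {0..x1} \<Longrightarrow> \<bar>F x\<bar> \<le> m"
  shows "(h a)\<^sup>2 / 2 \<le> max (a\<^sup>2 / 2 + G x1) ((m + 1)\<^sup>2 / 2 + G x1) + m * G x1"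
proof -
  obtain tA tB where A: "0 < tA" "tA < tB" "tB < \<tau> a" "X a tA = x1" "X a tB = x1"
    "\<And>t. t \<in> {0..tA} \<Longrightarrow> 0 < Y a t"
    "\<And>t. t \<in> {tA..tB} \<Longrightarrow> x1 \<le> X a t"
    "\<And>t. tB < t \<Longrightarrow> t < \<tau> a \<Longrightarrow> 0 < X a t \<and> X a t < x1"
    using stages[OF a high] by metis
  have "energy a tB \<le> energy a tA" using A by (intro energy_le[OF a]) auto
  also have "\<dots> \<le> a\<^sup>2 / 2 + G x1" using A by (intro upper_stage_energy[OF a]) auto
  finally have "max (energy a tB) ((m + 1)\<^sup>2 / 2 + G x1) \<le> max (a\<^sup>2 / 2 + G x1) ((m + 1)\<^sup>2 / 2 + G x1)"
    by (rule max.mono) simp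
  moreover have "(h a)\<^sup>2 / 2 \<le> max (energy a tB) ((m + 1)\<^sup>2 / 2 + G x1) + m * G x1"
    using A by (intro lower_stage_energy[OF a m]) auto
  ultimately show ?thesis by linarith
qed

text \<open>The time spent in \<open>x \<ge> \<xi>\<close>, where \<open>F \<ge> F \<xi> > 0\<close>, costs an amount of energy that grows linearly in \<open>a\<close>.\<close>
lemma h_estimate_dissipative:
  assumes a: "0 < a" and high: "G x1 \<le> a\<^sup>2 / 2" and m: "\<And>x. x \<in> {0..\<xi>} \<Longrightarrow> \<bar>F x\<bar> \<le> m"
    and \<xi>: "x1 < \<xi>" and big: "G \<xi> + m + 1 \<le> a"
  shows "(h a)\<^sup>2 / 2 \<le> max (a\<^sup>2 / 2 + G x1 - F \<xi> * (a - G \<xi> - F \<xi>)) ((m + 1)\<^sup>2 / 2 + G x1) + m * G x1"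
proof -
  obtain tA tB where A: "0 < tA" "tA < tB" "tB < \<tau> a" "X a tA = x1" "X a tB = x1"
    "\<And>t. t \<in> {0..tA} \<Longrightarrow> 0 < Y a t"
    "\<And>t. 0 < t \<Longrightarrow> t < tA \<Longrightarrow> 0 < X a t \<and> X a t < x1"
    "\<And>t. t \<in> {tA..tB} \<Longrightarrow> x1 \<le> X a t"
    "\<And>t. tB < t \<Longrightarrow> t < \<tau> a \<Longrightarrow> 0 < X a t \<and> X a t < x1"
    using stages[OF a high] by metis
  have \<xi>0: "0 < \<xi>" using \<xi> x1_pos by simp
  have m0: "0 \<le> m" using m[of 0] \<xi>0 by simp
  \<comment> \<open>As \<open>\<xi> > x1\<close>, the level \<open>\<xi>\<close> is reached only in
    the middle stage, where energy cannot grow.\<close>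
  have middle: "tA \<le> t \<and> t \<le> tB" if "t \<in> {0..\<tau> a}" "\<xi> \<le> X a t" for t
  proof -
    have "\<not> (0 < t \<and> t < tA)" "\<not> (tB < t \<and> t < \<tau> a)" using A(7)[of t] A(9)[of t] that \<xi> by auto
    moreover have "t \<noteq> 0" "t \<noteq> \<tau> a" using that \<xi>0 X_\<tau>[OF a] by auto
    ultimately show ?thesis using that(1) by auto
  qed
  have "0 < G \<xi>" using \<xi>0 by (rule G_pos)
  then obtain tu where tu: "0 \<le> tu" "tu \<le> \<tau> a" "Y a tu = m + 1"
    using IVT2'[of "Y a" "\<tau> a" "m + 1" 0] big m0 Y_\<tau>[of a] h_pos[OF a] \<tau>_pos[OF a] cont_Y by auto
  \<comment> \<open>While \<open>Y >= m + 1\<close> and \<open>X < \<xi>\<close>, the speed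
    \<open>W\<close> is at least 1, so \<open>Y + G X\<close> does not decrease: the way to
    \<open>\<xi>\<close> costs at most \<open>G \<xi>\<close> in height. The assumption
    \<open>big\<close> leaves enough height to arrive there.\<close>
  have rise: "a \<le> Y a t + G (X a t)" if t: "0 \<le> t" "t \<le> tu" "\<And>s. 0 \<le> s \<Longrightarrow> s < t \<Longrightarrow> X a s < \<xi>" for t
  proof -
    have "Y a 0 + G (X a 0) \<le> Y a t + G (X a t)"
    proof (rule deriv_nonneg_le[where u="\<lambda>t. Y a t + G (X a t)" and u'="\<lambda>t. g (X a t) * (W a t - 1)"])
      show "((\<lambda>t. Y a t + G (X a t)) has_real_derivative g (X a r) * (W a r - 1)) (at r)" for r
        by (rule derivative_eq_intros DY DGX refl)+ (simp add: algebra_simps)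
      fix r assume r: "0 < r" "r < t"
      have X: "0 \<le> X a r" using X_nonneg[OF a, of r] r t tu by simp
      have "\<bar>F (X a r)\<bar> \<le> m" using m[of "X a r"] X t(3)[of r] r by simp
      moreover have "m + 1 \<le> Y a r" using Y_le[OF a, of r tu] tu r t by simp
      ultimately have "0 \<le> W a r - 1" by (simp add: W_def abs_le_iff)
      then show "0 \<le> g (X a r) * (W a r - 1)" using g_nonneg[OF X] by simp
    qed (rule t(1))
    then show ?thesis by simp
  qed
  have "\<exists>t0\<in>{0..tu}. \<xi> \<le> X a t0"
  proof (rule ccontr)
    assume "\<not> ?thesis"
    then have n: "X a t < \<xi>" if "t \<in> {0..tu}" for t using that by (auto simp: not_le)
    then have "a \<le> Y a tu + G (X a tu)" using rise[of tu] tu by auto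
    moreover have "G (X a tu) < G \<xi>" using n[of tu] tu X_nonneg[OF a, of tu] by (intro G_less) auto
    ultimately show False using big tu by simp
  qed
  then obtain t0 where t0: "t0 \<in> {0..tu}" "\<xi> \<le> X a t0" by blast
  then have t0': "t0 \<in> {0..\<tau> a}" using tu by simp
  obtain sA where sA: "0 < sA" "sA \<le> t0" "X a sA = \<xi>" "\<And>s. 0 \<le> s \<Longrightarrow> s < sA \<Longrightarrow> X a s < \<xi>"
    using first_visit[OF a \<xi>0 t0' t0(2)] by metis
  obtain sB where sB: "t0 \<le> sB" "sB < \<tau> a" "X a sB = \<xi>" "W a sB \<le> 0"
    using last_visit[OF a \<xi>0 t0' t0(2)] by metis
  have mid: "tA \<le> sA" "sB \<le> tB" using middle[of sA] middle[of sB] sA sB t0' by auto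
  \<comment> \<open>The form of \<open>dE/dy = F >= F \<xi>\<close> that needs no change of
    variable; the drop in height is at least \<open>a - G \<xi> - F \<xi>\<close>, since
    \<open>W <= 0\<close> at \<open>sB\<close>.\<close>
  have "energy a sB - F \<xi> * Y a sB \<le> energy a sA - F \<xi> * Y a sA"
  proof (rule deriv_nonpos_le[where u="\<lambda>t. energy a t - F \<xi> * Y a t" and u'="\<lambda>t. g (X a t) * (F \<xi> - F (X a t))"])
    show "((\<lambda>t. energy a t - F \<xi> * Y a t) has_real_derivative g (X a r) * (F \<xi> - F (X a r))) (at r)" for r
      by (rule derivative_eq_intros D_energy DY refl)+ (simp add: algebra_simps)
    fix r assume r: "sA < r" "r < sB"
    have "\<xi> \<le> X a r" using X_unimodal[OF a, of sA r sB \<xi>] r sA sB by simp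
    then have "F \<xi> \<le> F (X a r)" "0 \<le> g (X a r)" using \<xi> \<xi>0 by (auto intro!: F_le g_nonneg)
    then show "g (X a r) * (F \<xi> - F (X a r)) \<le> 0" by (simp add: mult_nonneg_nonpos)
  qed (use sA sB in simp)
  moreover have "energy a sA \<le> energy a tA" "energy a tB \<le> energy a sB"
    using A(8) sA sB mid by (auto intro!: energy_le[OF a])
  moreover have "energy a tA \<le> a\<^sup>2 / 2 + G x1" using A by (intro upper_stage_energy[OF a]) auto
  moreover have "F \<xi> * (a - G \<xi> - F \<xi>) \<le> F \<xi> * (Y a sA - Y a sB)"
  proof (rule mult_left_mono)
    have "a \<le> Y a sA + G \<xi>" using rise[of sA] sA t0 by simp
    moreover have "Y a sB \<le> F \<xi>" using sB by (simp add: W_def)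
    ultimately show "a - G \<xi> - F \<xi> \<le> Y a sA - Y a sB" by simp
    show "0 \<le> F \<xi>" using \<xi> by (intro F_nonneg) simp
  qed
  ultimately have "energy a tB \<le> a\<^sup>2 / 2 + G x1 - F \<xi> * (a - G \<xi> - F \<xi>)"
    by (simp add: right_diff_distrib)
  then have "max (energy a tB) ((m + 1)\<^sup>2 / 2 + G x1)
      \<le> max (a\<^sup>2 / 2 + G x1 - F \<xi> * (a - G \<xi> - F \<xi>)) ((m + 1)\<^sup>2 / 2 + G x1)"
    by (rule max.mono) simp
  moreover have "(h a)\<^sup>2 / 2 \<le> max (energy a tB) ((m + 1)\<^sup>2 / 2 + G x1) + m * G x1"
    using A \<xi> by (intro lower_stage_energy[OF a m]) auto
  ultimately show ?thesis by linarith
qed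

section \<open>Continuity of the passage time and of the half return map\<close>

lemma XY_dist:
  shows "\<bar>X b t - X a t\<bar> \<le> exp (L * \<bar>t\<bar>) * \<bar>b - a\<bar>" and "\<bar>Y b t - Y a t\<bar> \<le> exp (L * \<bar>t\<bar>) * \<bar>b - a\<bar>"
proof -
  have d: "dist (flow v t (0, b)) (flow v t (0, a)) \<le> exp (L * \<bar>t\<bar>) * \<bar>b - a\<bar>"
    using flow_dist[of t "(0, b)" "(0, a)"] by (simp add: dist_Pair_Pair dist_real_def)
  show "\<bar>X b t - X a t\<bar> \<le> exp (L * \<bar>t\<bar>) * \<bar>b - a\<bar>"
    using dist_fst_le[of "flow v t (0, b)" "flow v t (0, a)"] d by (simp add: X_def dist_real_def)
  show "\<bar>Y b t - Y a t\<bar> \<le> exp (L * \<bar>t\<bar>) * \<bar>b - a\<bar>"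
    using dist_snd_le[of "flow v t (0, b)" "flow v t (0, a)"] d by (simp add: Y_def dist_real_def)
qed

text \<open>The axis is crossed with \<open>W < 0\<close>, so \<open>X a\<close> is negative at
  \<open>\<tau> a + e\<close> and bounded below by a positive number on
  \<open>{tq..\<tau> a - e}\<close>; both survive for nearby \<open>b\<close>. Before
  \<open>tq\<close> this fails because \<open>X a\<close> starts at 0, and the height is used
  instead: an arc can end only where \<open>Y\<close> is negative.\<close>

lemma isCont_\<tau>:
  assumes a: "0 < a"
  shows "isCont \<tau> a"
  unfolding continuous_at_eps_delta
proof (intro allI impI)
  fix \<eta> :: real assume \<eta>: "0 < \<eta>"
  obtain tq where tq: "0 \<le> tq" "tq \<le> \<tau> a" "Y a tq = a / 2"
    using IVT2'[of "Y a" "\<tau> a" "a / 2" 0] a Y_\<tau>[of a] h_pos[OF a] \<tau>_pos[OF a] cont_Y by auto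
  have tq': "0 < tq" "tq < \<tau> a"
    using tq a Y_\<tau>[of a] h_pos[OF a] by (cases "tq = 0"; cases "tq = \<tau> a"; auto)+
  have "W a (\<tau> a) < 0" using h_pos[OF a] X_\<tau>[OF a] Y_\<tau>[of a] by (simp add: W_def)
  then obtain d where d: "0 < d" "\<And>e. 0 < e \<Longrightarrow> e < d \<Longrightarrow> X a (\<tau> a + e) < X a (\<tau> a)"
    using DERIV_neg_dec_right[OF DX] by blast
  define e where "e = min \<eta> (min d (\<tau> a - tq)) / 2"
  have e: "0 < e" "e < \<eta>" "e < d" "e < \<tau> a - tq"
    using \<eta> d(1) tq' by (auto simp: e_def min_def field_simps)
  have "{tq..\<tau> a - e} \<noteq> {}" using e by simp
  then obtain u where u: "u \<in> {tq..\<tau> a - e}" "\<And>s. s \<in> {tq..\<tau> a - e} \<Longrightarrow> X a u \<le> X a s"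
    using continuous_attains_inf[OF compact_Icc _ cont_X] by blast
  \<comment> \<open>One tolerance for all three tests: positivity of \<open>X\<close> on the middle
    interval, negativity at \<open>\<tau> a + e\<close>, and height at least \<open>a / 2\<close> up
    to \<open>tq\<close>.\<close>
  define \<mu> where "\<mu> = min (X a u) (min (- X a (\<tau> a + e)) (a / 2))"
  have "0 < X a u" using X_pos[OF a, of u] u(1) e tq' by simp
  moreover have "0 < - X a (\<tau> a + e)" using d(2)[OF e(1,3)] X_\<tau>[OF a] by simp
  ultimately have \<mu>: "0 < \<mu>" using a by (simp add: \<mu>_def)
  define \<delta> where "\<delta> = min a (\<mu> / exp (L * (\<tau> a + e)))"
  have \<delta>: "0 < \<delta>" using a \<mu> by (simp add: \<delta>_def)
  have "dist (\<tau> b) (\<tau> a) < \<eta>" if ba: "dist b a < \<delta>" for b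
  proof -
    have b: "0 < b" using ba by (auto simp: \<delta>_def dist_real_def abs_less_iff)
    have close: "exp (L * \<bar>t\<bar>) * \<bar>b - a\<bar> < \<mu>" if t: "0 \<le> t" "t \<le> \<tau> a + e" for t
    proof -
      have "exp (L * \<bar>t\<bar>) * \<bar>b - a\<bar> \<le> exp (L * (\<tau> a + e)) * \<bar>b - a\<bar>"
        using t L_nonneg by (intro mult_right_mono) (auto intro: mult_left_mono)
      also have "\<dots> < \<mu>" using ba by (simp add: \<delta>_def dist_real_def field_simps)
      finally show ?thesis .
    qed
    have Xc: "\<bar>X b t - X a t\<bar> < \<mu>" and Yc: "\<bar>Y b t - Y a t\<bar> < \<mu>" if "0 \<le> t" "t \<le> \<tau> a + e" for t
      using XY_dist[of b t a] close[OF that] by auto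
    have "tq < \<tau> b"
    proof (rule ccontr)
      assume n: "\<not> tq < \<tau> b"
      have "a / 2 \<le> Y a (\<tau> b)"
        using Y_le[OF a, of "\<tau> b" tq] n tq \<tau>_pos[OF b] by simp
      moreover have "\<mu> \<le> a / 2" by (simp add: \<mu>_def)
      ultimately have "0 < Y b (\<tau> b)" using Yc[of "\<tau> b"] \<tau>_pos[OF b] n tq' e by simp
      then show False using h_pos[OF b] by (simp add: Y_\<tau>)
    qed
    moreover have "\<not> (tq \<le> \<tau> b \<and> \<tau> b \<le> \<tau> a - e)"
    proof
      assume n: "tq \<le> \<tau> b \<and> \<tau> b \<le> \<tau> a - e"
      have "\<mu> \<le> X a u" by (simp add: \<mu>_def)
      moreover have "X a u \<le> X a (\<tau> b)" using u(2) n by simp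
      ultimately have "0 < X b (\<tau> b)" using Xc[of "\<tau> b"] n tq' e by simp
      then show False using X_\<tau>[OF b] by simp
    qed
    moreover have "\<tau> b \<le> \<tau> a + e"
    proof (rule ccontr)
      assume n: "\<not> \<tau> b \<le> \<tau> a + e"
      have "\<mu> \<le> - X a (\<tau> a + e)" by (simp add: \<mu>_def)
      then have "X b (\<tau> a + e) < 0" using Xc[of "\<tau> a + e"] e \<tau>_pos[OF a] by simp
      then show False using X_pos[OF b, of "\<tau> a + e"] n e \<tau>_pos[OF a] by simp
    qed
    ultimately show ?thesis using e by (simp add: dist_real_def abs_less_iff)
  qed
  then show "\<exists>d>0. \<forall>x'. dist x' a < d \<longrightarrow> dist (\<tau> x') (\<tau> a) < \<eta>" using \<delta> by blast
qed

lemma isCont_h: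
  assumes a: "0 < a"
  shows "isCont h a"
proof -
  have \<tau>: "(\<tau> \<longlongrightarrow> \<tau> a) (at a)" using isCont_\<tau>[OF a] by (simp add: isCont_def)
  have "((\<lambda>b. exp (L * \<bar>\<tau> b\<bar>) * \<bar>b - a\<bar>) \<longlongrightarrow> exp (L * \<bar>\<tau> a\<bar>) * \<bar>a - a\<bar>) (at a)"
    by (intro tendsto_intros \<tau>)
  then have "((\<lambda>b. exp (L * \<bar>\<tau> b\<bar>) * \<bar>b - a\<bar>) \<longlongrightarrow> 0) (at a)" by simp
  then have "((\<lambda>b. Y b (\<tau> b) - Y a (\<tau> b)) \<longlongrightarrow> 0) (at a)"
    by (rule Lim_null_comparison[rotated]) (simp add: XY_dist)
  moreover have "((\<lambda>b. Y a (\<tau> b)) \<longlongrightarrow> Y a (\<tau> a)) (at a)"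
    by (rule isCont_tendsto_compose[OF DERIV_isCont[OF DY] \<tau>])
  ultimately have "((\<lambda>b. - (Y b (\<tau> b) - Y a (\<tau> b) + Y a (\<tau> b))) \<longlongrightarrow> - (0 + Y a (\<tau> a))) (at a)"
    by (intro tendsto_intros)
  moreover have "h = (\<lambda>b. - Y b (\<tau> b))" by (simp add: fun_eq_iff h_def)
  ultimately show ?thesis by (simp add: isCont_def)
qed

end

section \<open>The return map\<close>

locale lienard =
  fixes f F g G :: "real \<Rightarrow> real" and L x1 x2 :: real
  assumes lipv: "L-lipschitz_on UNIV (\<lambda>(x, y). (y - F x, - g x))"
    and cont_f: "continuous_on UNIV f" and cont_g: "continuous_on UNIV g"
    and DF: "(F has_real_derivative f x) (at x)"
    and DG: "(G has_real_derivative g x) (at x)"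
    and F_0: "F 0 = 0" and G_0: "G 0 = 0" and g_0: "g 0 = 0"
    and xg_pos: "x \<noteq> 0 \<Longrightarrow> 0 < x * g x"
    and x2_neg: "x2 < 0" and x1_pos: "0 < x1"
    and F_x1: "F x1 = 0" and F_x2: "F x2 = 0"
    and F_neg: "0 < x \<Longrightarrow> x < x1 \<Longrightarrow> F x < 0" and F_pos: "x2 < x \<Longrightarrow> x < 0 \<Longrightarrow> 0 < F x"
    and F_mono: "mono_on {x1..} F" "mono_on {..x2} F"
    and G_eq: "G x1 = G x2"
    and G_unbounded: "\<exists>x>0. K < G x" "\<exists>x<0. K < G x"
begin

sublocale right: half_lienard f F g G L x1
proof
  show "0 < x \<Longrightarrow> 0 < g x" for x using xg_pos[of x] by (simp add: zero_less_mult_iff)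
qed (use lipv cont_f cont_g DF DG F_0 G_0 g_0 x1_pos F_x1 F_neg F_mono G_unbounded in auto)

text \<open>The rotation \<open>(x, y) \<mapsto> (- x, - y)\<close> turns the left half plane into a right half plane.\<close>
sublocale left: half_lienard "\<lambda>x. f (- x)" "\<lambda>x. - F (- x)" "\<lambda>x. - g (- x)" "\<lambda>x. G (- x)" L "- x2"
proof
  show "L-lipschitz_on UNIV (\<lambda>(x, y). (y - - F (- x), - (- g (- x))))"
  proof (rule lipschitz_onI)
    fix p q :: "real \<times> real"
    obtain x y x' y' where pq: "p = (x, y)" "q = (x', y')" by fastforce
    have "dist (- y - F (- x), - g (- x)) (- y' - F (- x'), - g (- x')) \<le> L * dist (- x, - y) (- x', - y')"
      using lipschitz_onD[OF lipv, of "(- x, - y)" "(- x', - y')"] by simp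
    moreover have "dist (- y - F (- x), - g (- x)) (- y' - F (- x'), - g (- x'))
        = dist (y - - F (- x), - (- g (- x))) (y' - - F (- x'), - (- g (- x')))"
      using dist_minus[of "(- y - F (- x), - g (- x))" "(- y' - F (- x'), - g (- x'))"]
      by (simp add: add.commute)
    moreover have "dist (- x, - y) (- x', - y') = dist (x, y) (x', y')"
      using dist_minus[of "(x, y)" "(x', y')"] by simp
    ultimately show "dist (case p of (x, y) \<Rightarrow> (y - - F (- x), - (- g (- x))))
        (case q of (x, y) \<Rightarrow> (y - - F (- x), - (- g (- x)))) \<le> L * dist p q"
      by (simp add: pq)
  qed (rule right.L_nonneg)
  show "continuous_on UNIV (\<lambda>x. f (- x))" "continuous_on UNIV (\<lambda>x. - g (- x))"
    by (intro continuous_intros continuous_on_compose2[OF cont_f] continuous_on_compose2[OF cont_g]; simp)+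
  show "((\<lambda>x. - F (- x)) has_real_derivative f (- x)) (at x)" for x
    using DERIV_minus[OF DERIV_chain2[OF DF DERIV_minus[OF DERIV_ident]]] by simp
  show "((\<lambda>x. G (- x)) has_real_derivative - g (- x)) (at x)" for x
    using DERIV_chain2[OF DG DERIV_minus[OF DERIV_ident]] by simp
  show "0 < - g (- x)" if "0 < x" for x
    using xg_pos[of "- x"] that by (simp add: mult_less_0_iff)
  show "mono_on {- x2..} (\<lambda>x. - F (- x))"
    using mono_onD[OF F_mono(2)] by (auto intro!: mono_onI)
  show "\<exists>x>0. K < G (- x)" for K
  proof -
    obtain x where "x < 0" "K < G x" using G_unbounded(2) by blast
    then show ?thesis by (intro exI[of _ "- x"]) simp
  qed
qed (use F_0 G_0 g_0 x2_neg F_x2 F_pos in auto)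

abbreviation v :: "real \<times> real \<Rightarrow> real \<times> real" where "v \<equiv> right.v"

lemma flow_left: "flow left.v t p = - flow v t (- p)"
proof -
  have "solution_on UNIV left.v (\<lambda>t. - flow v t (- p))"
    unfolding solution_on_def
  proof
    fix t
    have eq: "left.v (- q) = - v q" for q by (cases q) simp
    show "((\<lambda>t. - flow v t (- p)) has_vector_derivative left.v (- flow v t (- p))) (at t)"
      unfolding eq by (rule has_vector_derivative_minus[OF right.flow_has_derivative])
  qed
  from left.flow_unique[OF this, of t] show ?thesis by (simp add: right.flow_0)
qed

lemma flow_left_start: "flow v t (0, - b) = (- left.X b t, - left.Y b t)"
proof -
  have "flow v t (0, - b) = - flow left.v t (0, b)" unfolding flow_left by simp
  also have "\<dots> = - (left.X b t, left.Y b t)" by (simp only: left.flow_XY)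
  finally show ?thesis by simp
qed

definition P :: "real \<Rightarrow> real" where "P a = left.h (right.h a)"
definition T :: "real \<Rightarrow> real" where "T a = right.\<tau> a + left.\<tau> (right.h a)"

lemma P_pos: "0 < a \<Longrightarrow> 0 < P a"
  by (simp add: P_def left.h_pos right.h_pos)

lemma T_pos: "0 < a \<Longrightarrow> 0 < T a"
  by (simp add: T_def add_pos_pos left.\<tau>_pos right.\<tau>_pos right.h_pos)

lemma flow_left_\<tau>: "0 < b \<Longrightarrow> flow v (left.\<tau> b) (0, - b) = (0, left.h b)"
  by (simp add: flow_left_start left.X_\<tau> left.Y_\<tau>)

lemma flow_T: "0 < a \<Longrightarrow> flow v (T a) (0, a) = (0, P a)"
  using right.flow_add[of "left.\<tau> (right.h a)" "right.\<tau> a" "(0, a)"]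
  by (simp add: T_def P_def add.commute right.flow_\<tau> flow_left_\<tau> right.h_pos)

lemma isCont_P: "0 < a \<Longrightarrow> isCont P a"
  unfolding P_def using isCont_o2[OF right.isCont_h left.isCont_h] right.h_pos by simp

lemma isCont_T: "0 < a \<Longrightarrow> isCont T a"
  unfolding T_def
  by (intro continuous_intros right.isCont_\<tau> isCont_o2[OF right.isCont_h left.isCont_\<tau>] right.h_pos)

text \<open>By \<open>G_eq\<close> this is also \<open>G x2\<close>, so one threshold serves both
  half planes.\<close>

definition E0 :: real where "E0 = G x1"

lemma E0_pos: "0 < E0"
  unfolding E0_def by (rule right.G_pos[OF x1_pos])

text \<open>\<open>h_gt\<close> is applied twice. If the right arc ends with energy at least
  \<open>E0\<close>, the left arc ends above \<open>E0\<close> and so above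
  \<open>a\<^sup>2 / 2\<close>. Otherwise the right arc has increased the height, and the left arc
  increases it again or lifts the energy above \<open>E0\<close>.\<close>

lemma P_low:
  assumes a: "0 < a" and low: "a\<^sup>2 / 2 \<le> E0"
  shows "a < P a"
proof -
  define b where "b = right.h a"
  have b: "0 < b" unfolding b_def by (rule right.h_pos[OF a])
  have Pb: "P a = left.h b" by (simp add: P_def b_def)
  have GE: "G (- (- x2)) = E0" by (simp add: E0_def G_eq)
  have sq: "a < P a" if "E0 < (P a)\<^sup>2 / 2"
    using power2_less_imp_less[of a "P a"] P_pos[OF a] that low by simp
  show ?thesis
  proof (cases "E0 \<le> b\<^sup>2 / 2")
    case True
    then show ?thesis using left.h_gt(2)[OF b] sq unfolding GE Pb by blast
  next
    case False
    then have "a < b" using right.h_gt(1)[OF a] by (auto simp: b_def E0_def)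
    then show ?thesis using left.h_gt(1)[OF b] sq unfolding GE Pb by force
  qed
qed

text \<open>By \<open>h_gt\<close> the energy is still above \<open>E0\<close> halfway, so the
  comparison applies in the left half plane as well, and the two inequalities for the gains add
  up.\<close>

lemma P_high:
  assumes a: "0 < a" and high: "E0 \<le> a\<^sup>2 / 2" and ab: "a < b"
  shows "P a < P b" "(P b)\<^sup>2 - b\<^sup>2 < (P a)\<^sup>2 - a\<^sup>2"
proof -
  have GE: "G (- (- x2)) = E0" by (simp add: E0_def G_eq)
  have r: "right.h a < right.h b" "(right.h b)\<^sup>2 - b\<^sup>2 < (right.h a)\<^sup>2 - a\<^sup>2"
    using right.h_comparison[OF a ab] high by (auto simp: E0_def)
  have "E0 \<le> (right.h a)\<^sup>2 / 2"
    using right.h_gt(2)[OF a] high by (simp add: E0_def)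
  then have "P a < P b" "(P b)\<^sup>2 - (right.h b)\<^sup>2 < (P a)\<^sup>2 - (right.h a)\<^sup>2"
    using left.h_comparison[OF right.h_pos[OF a] r(1)] unfolding GE P_def by auto
  then show "P a < P b" "(P b)\<^sup>2 - b\<^sup>2 < (P a)\<^sup>2 - a\<^sup>2" using r by auto
qed

lemma right_h_estimate:
  assumes "0 < a" "E0 \<le> a\<^sup>2 / 2" and m: "\<And>x. x \<in> {0..x1} \<Longrightarrow> \<bar>F x\<bar> \<le> m"
  shows "(right.h a)\<^sup>2 / 2 \<le> max (a\<^sup>2 / 2 + E0) ((m + 1)\<^sup>2 / 2 + E0) + m * E0"
  using right.h_estimate[OF assms(1) _ m] assms(2) by (simp add: E0_def)

text \<open>Dissipation is used on the right only. For large \<open>a\<close> the sole term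
  competing with \<open>a\<^sup>2 / 2\<close> is the innermost one, and it contains
  \<open>- F \<xi> * a\<close>.\<close>

lemma P_estimate:
  assumes a: "0 < a" and high: "E0 \<le> a\<^sup>2 / 2" and \<xi>: "x1 < \<xi>"
    and m: "\<And>x. x \<in> {x2..\<xi>} \<Longrightarrow> \<bar>F x\<bar> \<le> m" and big: "G \<xi> + m + 1 \<le> a"
  shows "(P a)\<^sup>2 / 2 \<le> max (max (a\<^sup>2 / 2 + E0 - F \<xi> * (a - G \<xi> - F \<xi>)) ((m + 1)\<^sup>2 / 2 + E0) + m * E0 + E0)
    ((m + 1)\<^sup>2 / 2 + E0) + m * E0"
proof -
  have GE: "G (- (- x2)) = E0" by (simp add: E0_def G_eq)
  define b where "b = right.h a"
  have b: "0 < b" unfolding b_def by (rule right.h_pos[OF a])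
  have 1: "b\<^sup>2 / 2 \<le> max (a\<^sup>2 / 2 + E0 - F \<xi> * (a - G \<xi> - F \<xi>)) ((m + 1)\<^sup>2 / 2 + E0) + m * E0"
    using right.h_estimate_dissipative[OF a _ m \<xi> big] high x2_neg by (simp add: E0_def b_def)
  have "E0 \<le> b\<^sup>2 / 2"
    using right.h_gt(2)[OF a] high by (simp add: E0_def b_def)
  moreover have "\<bar>- F (- x)\<bar> \<le> m" if "x \<in> {0..- x2}" for x using m[of "- x"] that \<xi> x1_pos by simp
  ultimately have "(left.h b)\<^sup>2 / 2 \<le> max (b\<^sup>2 / 2 + E0) ((m + 1)\<^sup>2 / 2 + E0) + m * E0"
    using left.h_estimate[OF b, of m] unfolding GE by blast
  then have "(P a)\<^sup>2 / 2 \<le> max (b\<^sup>2 / 2 + E0) ((m + 1)\<^sup>2 / 2 + E0) + m * E0"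
    by (simp add: P_def b_def)
  also have "\<dots> \<le> max (max (a\<^sup>2 / 2 + E0 - F \<xi> * (a - G \<xi> - F \<xi>)) ((m + 1)\<^sup>2 / 2 + E0) + m * E0 + E0)
    ((m + 1)\<^sup>2 / 2 + E0) + m * E0"
    using 1 by (intro add_right_mono max.mono) auto
  finally show ?thesis .
qed

lemma fixed_point_exists:
  assumes a0: "0 < a0" "E0 \<le> a0\<^sup>2 / 2" "P a0 < a0"
  obtains c where "0 < c" "c < a0" "E0 < c\<^sup>2 / 2" "P c = c"
    "\<And>a. 0 < a \<Longrightarrow> a < c \<Longrightarrow> a < P a" "\<And>a. c < a \<Longrightarrow> P a < a"
proof -
  \<comment> \<open>The height of energy exactly \<open>E0\<close>, where \<open>P_low\<close> still
    applies and \<open>P_high\<close> already does. At the fixed point the gain is 0, and its strict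
    decrease fixes its sign on both sides.\<close>
  define e where "e = sqrt (2 * E0)"
  have e: "0 < e" "e\<^sup>2 / 2 = E0" using E0_pos by (auto simp: e_def)
  have Pe: "e < P e" using P_low[of e] e by simp
  have "e\<^sup>2 \<le> a0\<^sup>2" using e a0 by simp
  then have "e \<le> a0" by (rule power2_le_imp_le) (use a0 in simp)
  moreover have "continuous_on {e..a0} (\<lambda>a. P a - a)"
    by (intro continuous_intros continuous_at_imp_continuous_on ballI isCont_P) (use e in auto)
  ultimately obtain c where c: "e \<le> c" "c \<le> a0" "P c = c"
    using IVT2'[of "\<lambda>a. P a - a" a0 0 e] Pe a0 by auto
  have ec: "e < c" using c Pe by (cases "c = e") auto
  have ca: "c < a0" using c a0 by (cases "c = a0") auto
  have high: "E0 \<le> a\<^sup>2 / 2" if "e \<le> a" for a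
    using power_mono[OF that, of 2] e by simp
  have "e\<^sup>2 < c\<^sup>2" using ec e by (intro power_strict_mono) auto
  then have "E0 < c\<^sup>2 / 2" using e by simp
  moreover have "a < P a" if a: "0 < a" "a < c" for a
  proof (cases "a\<^sup>2 / 2 \<le> E0")
    case True
    then show ?thesis using P_low a by simp
  next
    case False
    then have "(P c)\<^sup>2 - c\<^sup>2 < (P a)\<^sup>2 - a\<^sup>2" using P_high(2)[OF a(1) _ a(2)] by simp
    then show ?thesis using c power2_less_imp_less[of a "P a"] P_pos[OF a(1)] by simp
  qed
  moreover have "P a < a" if a: "c < a" for a
  proof -
    have "(P a)\<^sup>2 - a\<^sup>2 < (P c)\<^sup>2 - c\<^sup>2" using P_high(2)[OF _ high[of c] a] ec e by simp
    then show ?thesis using c power2_less_imp_less[of "P a" a] a ec e by simp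
  qed
  ultimately show thesis using that[of c] c ca ec e by simp
qed

end

section \<open>The limit cycle\<close>

locale lienard_cycle = lienard +
  fixes c :: real
  assumes c_pos: "0 < c" and c_high: "E0 < c\<^sup>2 / 2" and P_c: "P c = c"
    and P_below: "0 < a \<Longrightarrow> a < c \<Longrightarrow> a < P a" and P_above: "c < a \<Longrightarrow> P a < a"
begin

definition \<Gamma> :: "(real \<times> real) set" where "\<Gamma> = range (\<lambda>t. flow v t (0, c))"

lemma flow_T_c: "flow v (T c) (0, c) = (0, c)"
  using flow_T[OF c_pos] P_c by simp

lemma periodic_\<Gamma>: "periodic_orbit v \<Gamma>"
  unfolding \<Gamma>_def
  by (rule right.periodic_orbit_flow[OF flow_T_c T_pos[OF c_pos]]) (use c_pos in \<open>simp add: F_0 zero_prod_def\<close>)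

lemma flow_mem_\<Gamma>: "flow v t (0, c) \<in> \<Gamma>"
  by (simp add: \<Gamma>_def)

lemma flow_\<Gamma>: "p \<in> \<Gamma> \<Longrightarrow> flow v t p \<in> \<Gamma>"
  by (auto simp: \<Gamma>_def right.flow_add[symmetric])

section \<open>Convergence of the iterates of the return map\<close>

lemma P_mono:
  assumes "0 < a" "E0 \<le> a\<^sup>2 / 2" "a \<le> b"
  shows "P a \<le> P b"
  using P_high(1)[OF assms(1,2), of b] assms(3) by (cases "a = b") auto

lemma P_between:
  assumes a: "0 < a" "E0 \<le> a\<^sup>2 / 2"
  shows "a \<le> c \<Longrightarrow> a \<le> P a \<and> P a \<le> c" and "c \<le> a \<Longrightarrow> c \<le> P a \<and> P a \<le> a"
proof -
  show "a \<le> P a \<and> P a \<le> c" if "a \<le> c"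
    using P_mono[OF a that] P_below[of a] P_c a that by (cases "a = c") auto
  show "c \<le> P a \<and> P a \<le> a" if "c \<le> a"
    using P_mono[OF c_pos less_imp_le[OF c_high] that] P_above[of a] P_c that by (cases "a = c") auto
qed

lemma high_mono: "E0 \<le> a\<^sup>2 / 2 \<Longrightarrow> 0 \<le> a \<Longrightarrow> a \<le> b \<Longrightarrow> E0 \<le> b\<^sup>2 / 2"
  using power_mono[of a b 2] by linarith

lemma iterate_pos: "0 < a \<Longrightarrow> 0 < (P ^^ n) a"
  by (induction n) (auto intro: P_pos)

lemma iterate_limit:
  assumes a: "0 < a" and lim: "(\<lambda>n. (P ^^ n) a) \<longlonglongrightarrow> l" and l: "0 < l"
  shows "l = c"
proof -
  have "(\<lambda>n. P ((P ^^ n) a)) \<longlonglongrightarrow> P l"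
    by (rule isCont_tendsto_compose[OF isCont_P[OF l] lim])
  moreover have "(\<lambda>n. P ((P ^^ n) a)) \<longlonglongrightarrow> l"
    using LIMSEQ_Suc[OF lim] by simp
  ultimately have "P l = l" by (rule LIMSEQ_unique)
  then show ?thesis using P_below[OF l] P_above[of l] by force
qed

lemma iterates_tend_high:
  assumes a: "0 < a" "E0 \<le> a\<^sup>2 / 2"
  shows "(\<lambda>n. (P ^^ n) a) \<longlonglongrightarrow> c"
proof (cases "a \<le> c")
  case True
  have b: "a \<le> (P ^^ n) a \<and> (P ^^ n) a \<le> c \<and> (P ^^ n) a \<le> (P ^^ Suc n) a" for n
  proof (induction n)
    case 0
    then show ?case using P_between(1)[OF a True] True by simp
  next
    case (Suc n)
    then have *: "0 < (P ^^ Suc n) a" "E0 \<le> ((P ^^ Suc n) a)\<^sup>2 / 2"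
      using iterate_pos[OF a(1), of "Suc n"] high_mono[OF a(2), of "(P ^^ Suc n) a"] a(1) by (auto intro: order_trans)
    have "0 < (P ^^ n) a" "E0 \<le> ((P ^^ n) a)\<^sup>2 / 2"
      using iterate_pos[OF a(1), of n] high_mono[OF a(2), of "(P ^^ n) a"] a(1) Suc by auto
    then have "(P ^^ Suc n) a \<le> c" using P_between(1)[of "(P ^^ n) a"] Suc by simp
    then show ?case using P_between(1)[OF *] Suc by simp
  qed
  then have "incseq (\<lambda>n. (P ^^ n) a)" by (intro incseq_SucI) blast
  then obtain l where l: "(\<lambda>n. (P ^^ n) a) \<longlonglongrightarrow> l" "\<forall>n. (P ^^ n) a \<le> l"
    using incseq_convergent[of "\<lambda>n. (P ^^ n) a" c] b by blast
  have "0 < l" using l(2)[rule_format, of 0] a by simp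
  then show ?thesis using iterate_limit[OF a(1) l(1)] l(1) by simp
next
  case False
  have b: "c \<le> (P ^^ n) a \<and> (P ^^ Suc n) a \<le> (P ^^ n) a" for n
  proof (induction n)
    case 0
    then show ?case using P_between(2)[OF a] False by simp
  next
    case (Suc n)
    have "0 < (P ^^ n) a" "E0 \<le> ((P ^^ n) a)\<^sup>2 / 2"
      using c_pos high_mono[OF less_imp_le[OF c_high], of "(P ^^ n) a"] Suc by auto
    then have c: "c \<le> (P ^^ Suc n) a" using P_between(2)[of "(P ^^ n) a"] Suc by simp
    then have *: "0 < (P ^^ Suc n) a" "E0 \<le> ((P ^^ Suc n) a)\<^sup>2 / 2"
      using c_pos high_mono[OF less_imp_le[OF c_high], of "(P ^^ Suc n) a"] by auto
    show ?case using P_between(2)[OF *] c by simp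
  qed
  then have "decseq (\<lambda>n. (P ^^ n) a)" by (intro decseq_SucI) blast
  then obtain l where l: "(\<lambda>n. (P ^^ n) a) \<longlonglongrightarrow> l" "\<forall>n. l \<le> (P ^^ n) a"
    using decseq_convergent[of "\<lambda>n. (P ^^ n) a" c] b by blast
  have "c \<le> l" using b by (intro LIMSEQ_le_const[OF l(1)]) blast
  then show ?thesis using iterate_limit[OF a(1) l(1)] l(1) c_pos by simp
qed

text \<open>Below the energy \<open>E0\<close> only \<open>a < P a\<close> is at hand, not
  monotonicity of \<open>P\<close>. It suffices: the iterates either enter the range of
  \<open>iterates_tend_high\<close> or increase while bounded by \<open>c\<close>, and then their
  limit is the fixed point.\<close>

lemma iterates_tend:
  assumes a: "0 < a"
  shows "(\<lambda>n. (P ^^ n) a) \<longlonglongrightarrow> c"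
proof (cases "\<exists>n. E0 \<le> ((P ^^ n) a)\<^sup>2 / 2")
  case True
  then obtain n where n: "E0 \<le> ((P ^^ n) a)\<^sup>2 / 2" by blast
  have "(\<lambda>k. (P ^^ k) ((P ^^ n) a)) \<longlonglongrightarrow> c"
    by (rule iterates_tend_high[OF iterate_pos[OF a] n])
  then have "(\<lambda>k. (P ^^ (k + n)) a) \<longlonglongrightarrow> c" by (simp add: funpow_add)
  then show ?thesis by (rule LIMSEQ_offset)
next
  case False
  then have low: "((P ^^ n) a)\<^sup>2 / 2 < E0" for n by (simp add: not_le)
  have lt_c: "(P ^^ n) a < c" for n
    by (rule power2_less_imp_less) (use low[of n] c_high c_pos in auto)
  have "(P ^^ n) a \<le> (P ^^ Suc n) a" for n
    using P_below[OF iterate_pos[OF a] lt_c, of n] by simp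
  then have "incseq (\<lambda>n. (P ^^ n) a)" by (rule incseq_SucI)
  then obtain l where l: "(\<lambda>n. (P ^^ n) a) \<longlonglongrightarrow> l" "\<forall>n. (P ^^ n) a \<le> l"
    using incseq_convergent[of "\<lambda>n. (P ^^ n) a" c] lt_c less_imp_le by blast
  have "0 < l" using l(2)[rule_format, of 0] a by simp
  then show ?thesis using iterate_limit[OF a l(1)] l(1) by simp
qed

section \<open>Uniqueness of the periodic orbit\<close>

text \<open>If \<open>x\<close> never vanished, it would keep one sign and \<open>y\<close> would be
  strictly monotone, against periodicity. A crossing with \<open>y < 0\<close> is followed along the
  left arc up to the positive half axis; \<open>y = 0\<close> would be the equilibrium.\<close>

lemma hits_axis:
  assumes per: "periodic_orbit v \<Delta>"
  shows "\<exists>a>0. (0, a) \<in> \<Delta>"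
proof -
  obtain S where S: "0 < S" "\<And>p. p \<in> \<Delta> \<Longrightarrow> flow v S p = p"
    "\<And>p. p \<in> \<Delta> \<Longrightarrow> \<Delta> = range (\<lambda>t. flow v t p)" "\<And>p. p \<in> \<Delta> \<Longrightarrow> v p \<noteq> 0" "compact \<Delta>" "\<Delta> \<noteq> {}"
    using per by (rule right.periodic_orbitE) blast
  obtain p where p: "p \<in> \<Delta>" using S by blast
  define x y where "x t = fst (flow v t p)" and "y t = snd (flow v t p)" for t
  have "y = (\<lambda>t. snd (flow v t p))" by (simp add: y_def fun_eq_iff)
  then have dy: "(y has_real_derivative - g (x t)) (at t)" for t
    using bounded_linear.has_vector_derivative[OF bounded_linear_snd right.flow_has_derivative[of p t]]
    by (simp add: x_def y_def has_real_derivative_iff_has_vector_derivative case_prod_beta)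
  have cx: "continuous_on A x" for A
    unfolding x_def by (intro continuous_intros right.flow_continuous)
  have yS: "y S = y 0" using S(2)[OF p] by (simp add: y_def right.flow_0)
  have "\<exists>t. x t = 0"
  proof (rule ccontr)
    assume nz: "\<not> ?thesis"
    have "0 < x t * x 0" for t
    proof (rule ccontr)
      assume "\<not> 0 < x t * x 0"
      moreover have "x t * x 0 \<noteq> 0" using nz by auto
      ultimately have neg: "x t * x 0 < 0" by linarith
      have "\<exists>s. x s = 0"
      proof (rule ccontr)
        have con: "connected (range x)" by (intro connected_continuous_image cx connected_UNIV)
        assume "\<nexists>s. x s = 0"
        then have "0 \<notin> range x" by (auto simp: image_iff)
        moreover have "0 \<in> range x"
        proof (cases "x t < 0")
          case True
          then have "0 < x 0" using neg by (simp add: mult_less_0_iff)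
          then show ?thesis using connectedD_interval[OF con, of "x t" "x 0" 0] True by simp
        next
          case False
          then have "0 < x t" "x 0 < 0" using neg by (auto simp: mult_less_0_iff)
          then show ?thesis using connectedD_interval[OF con, of "x 0" "x t" 0] by simp
        qed
        ultimately show False by blast
      qed
      then show False using nz by blast
    qed
    note sgn = this
    show False
    proof (cases "0 < x 0")
      case True
      then have "0 < x t" for t using sgn[of t] by (simp add: zero_less_mult_iff)
      then have "y S < y 0" by (intro deriv_neg_less[OF S(1) dy]) (simp add: right.g_pos)
      then show False using yS by simp
    next
      case False
      then have "x t < 0" for t using sgn[of t] by (auto simp: zero_less_mult_iff)
      then have "y 0 < y S"
        by (intro deriv_pos_less[OF S(1) dy]) (use left.g_pos[of "- x _"] in simp)
      then show False using yS by simp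
    qed
  qed
  then obtain t where t: "x t = 0" by blast
  have mem: "(0, y t) \<in> \<Delta>" using S(3)[OF p] t by (force simp: x_def y_def prod_eq_iff)
  have "y t \<noteq> 0" using S(4)[OF mem] by (auto simp: F_0 g_0 zero_prod_def)
  show ?thesis
  proof (cases "0 < y t")
    case True
    then show ?thesis using mem by blast
  next
    case False
    then have b: "0 < - y t" using \<open>y t \<noteq> 0\<close> by simp
    have "flow v (left.\<tau> (- y t)) (0, y t) \<in> \<Delta>" using S(3)[OF mem] by blast
    then have "(0, left.h (- y t)) \<in> \<Delta>" using flow_left_\<tau>[OF b] by simp
    then show ?thesis using left.h_pos[OF b] by blast
  qed
qed

text \<open>\<open>\<Delta>\<close> is closed and contains all iterates
  \<open>(0, (P ^^ n) a)\<close>, hence their limit \<open>(0, c)\<close>. This avoids asking how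
  often a periodic orbit meets the half axis.\<close>

lemma periodic_unique:
  assumes per: "periodic_orbit v \<Delta>"
  shows "\<Delta> = \<Gamma>"
proof -
  obtain S where "0 < S" "\<And>p. p \<in> \<Delta> \<Longrightarrow> flow v S p = p"
    and *: "\<And>p. p \<in> \<Delta> \<Longrightarrow> \<Delta> = range (\<lambda>t. flow v t p)"
    and "\<And>p. p \<in> \<Delta> \<Longrightarrow> v p \<noteq> 0" "compact \<Delta>" "\<Delta> \<noteq> {}"
    using per by (rule right.periodic_orbitE) blast
  obtain a where a: "0 < a" "(0, a) \<in> \<Delta>" using hits_axis[OF per] by blast
  have "(0, (P ^^ n) a) \<in> \<Delta>" for n
  proof (induction n)
    case (Suc n)
    have "flow v (T ((P ^^ n) a)) (0, (P ^^ n) a) \<in> \<Delta>" using *[OF Suc] by blast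
    then show ?case using flow_T[OF iterate_pos[OF a(1)], of n] by simp
  qed (simp add: a)
  moreover have "(\<lambda>n. (0, (P ^^ n) a)) \<longlonglongrightarrow> (0, c)"
    by (intro tendsto_intros iterates_tend a)
  ultimately have "(0, c) \<in> \<Delta>"
    by (rule closed_sequentially[OF compact_imp_closed[OF \<open>compact \<Delta>\<close>]])
  then show ?thesis using * by (simp add: \<Gamma>_def)
qed

lemma c_mem_\<Gamma>: "(0, c) \<in> \<Gamma>"
  using flow_mem_\<Gamma>[of 0] by (simp only: right.flow_0)

lemma infdist_flow_le:
  assumes "p \<in> \<Gamma>"
  shows "infdist (flow v t q) \<Gamma> \<le> exp (L * \<bar>t\<bar>) * dist q p"
  using infdist_le[OF flow_\<Gamma>[OF assms], of "flow v t q" t] right.flow_dist[of t q p] by linarith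

section \<open>Orbital stability and attraction\<close>

text \<open>Successive returns to the half axis do not move away from \<open>c\<close>, and between
  two of them at most the time \<open>2 * T c\<close> passes, so the Lipschitz constant
  \<open>K\<close> of the flow over that time controls the distance at all times.\<close>

lemma orbits_from_section:
  obtains r K where "0 < r" "0 < K"
    "\<And>a t. \<bar>a - c\<bar> < r \<Longrightarrow> 0 \<le> t \<Longrightarrow> infdist (flow v t (0, a)) \<Gamma> \<le> K * \<bar>a - c\<bar>"
    "\<And>a. \<bar>a - c\<bar> < r \<Longrightarrow> ((\<lambda>t. infdist (flow v t (0, a)) \<Gamma>) \<longlongrightarrow> 0) at_top"
proof -
  have Tc: "0 < T c" by (rule T_pos[OF c_pos])
  then have "0 < T c / 2" by simp
  \<comment> \<open>The lower bound on \<open>T a\<close> makes the return times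
    \<open>S a n\<close> exceed any \<open>t\<close>; the upper bound yields
    \<open>K\<close>.\<close>
  then obtain r1 where r1: "0 < r1" "\<forall>a. dist a c < r1 \<longrightarrow> dist (T a) (T c) < T c / 2"
    using isCont_T[OF c_pos] unfolding continuous_at_eps_delta by blast
  define e where "e = sqrt (2 * E0)"
  have e: "0 < e" "e\<^sup>2 / 2 = E0" using E0_pos by (auto simp: e_def)
  have "e < c" by (rule power2_less_imp_less) (use c_high e c_pos in auto)
  \<comment> \<open>The bound \<open>c - e\<close> keeps the energy at least \<open>E0\<close>,
    where \<open>P a\<close> lies between \<open>a\<close> and \<open>c\<close>.\<close>
  define r where "r = min r1 (c - e)"
  have r: "0 < r" using r1(1) \<open>e < c\<close> by (simp add: r_def)
  have near: "0 < a" "E0 \<le> a\<^sup>2 / 2" "T c / 2 \<le> T a" "T a \<le> 2 * T c" if "\<bar>a - c\<bar> < r" for a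
  proof -
    have "e \<le> a" using that by (auto simp: r_def)
    then show "0 < a" "E0 \<le> a\<^sup>2 / 2" using e high_mono[of e a] by auto
    have "dist (T a) (T c) < T c / 2" using r1(2) that by (simp add: r_def dist_real_def)
    then show "T c / 2 \<le> T a" "T a \<le> 2 * T c" using Tc unfolding dist_real_def by linarith+
  qed
  have P_near: "\<bar>P a - c\<bar> \<le> \<bar>a - c\<bar>" if "\<bar>a - c\<bar> < r" for a
    using P_between[OF near(1,2)[OF that]] by (cases "a \<le> c") auto
  have iter: "\<bar>(P ^^ n) a - c\<bar> \<le> \<bar>a - c\<bar>" if "\<bar>a - c\<bar> < r" for a n
  proof (induction n)
    case (Suc n)
    then show ?case using P_near[of "(P ^^ n) a"] that by simp
  qed simp
  define K where "K = exp (L * (2 * T c))"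
  define S where "S a n = (\<Sum>i<n. T ((P ^^ i) a))" for a n
  have flow_S: "flow v (S a n) (0, a) = (0, (P ^^ n) a)" if "0 < a" for a n
  proof (induction n)
    case (Suc n)
    have "flow v (S a (Suc n)) (0, a) = flow v (T ((P ^^ n) a)) (flow v (S a n) (0, a))"
      by (simp add: S_def right.flow_add[symmetric] add.commute)
    then show ?case using Suc flow_T[OF iterate_pos[OF that], of n] by simp
  qed (simp add: S_def right.flow_0)
  have bound: "infdist (flow v t (0, a)) \<Gamma> \<le> K * \<bar>a - c\<bar>" if a: "\<bar>a - c\<bar> < r" and t: "0 \<le> t" for a t
  proof -
    have near_n: "\<bar>(P ^^ n) a - c\<bar> < r" for n using iter[OF a, of n] a by simp
    have S_lower: "real n * (T c / 2) \<le> S a n" for n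
    proof (induction n)
      case (Suc n)
      then show ?case using near(3)[OF near_n[of n]] by (simp add: S_def algebra_simps)
    qed (simp add: S_def)
    obtain n0 where "t / (T c / 2) < real n0" using reals_Archimedean2 by blast
    then have "t < real n0 * (T c / 2)" using Tc by (simp add: field_simps)
    then have ex: "t < S a n0" using S_lower[of n0] by simp
    \<comment> \<open>\<open>n\<close> is the first return after time \<open>t\<close>, so
      \<open>k = n - 1\<close> is the last one up to \<open>t\<close>; \<open>n\<close> is not 0
      because \<open>S a 0 = 0\<close>.\<close>
    define n where "n = (LEAST n. t < S a n)"
    have n: "t < S a n" unfolding n_def using ex by (rule LeastI)
    have "n \<noteq> 0"
    proof
      assume "n = 0"
      then show False using n t by (simp add: S_def)
    qed
    then obtain k where k: "n = Suc k" by (cases n) auto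
    have "S a k \<le> t" using not_less_Least[of k "\<lambda>n. t < S a n"] k by (simp add: n_def[symmetric])
    moreover have "S a n = S a k + T ((P ^^ k) a)" by (simp add: S_def k)
    ultimately have d: "0 \<le> t - S a k" "t - S a k \<le> 2 * T c" using n near(4)[OF near_n[of k]] by auto
    have "flow v t (0, a) = flow v (t - S a k) (0, (P ^^ k) a)"
      using right.flow_add[of "t - S a k" "S a k" "(0, a)"] flow_S[OF near(1)[OF a], of k] by simp
    also have "infdist \<dots> \<Gamma> \<le> exp (L * \<bar>t - S a k\<bar>) * dist (0 :: real, (P ^^ k) a) (0, c)"
      by (rule infdist_flow_le[OF c_mem_\<Gamma>])
    also have "\<dots> \<le> K * \<bar>a - c\<bar>"
      unfolding K_def using d right.L_nonneg iter[OF a, of k]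
      by (intro mult_mono) (auto simp: dist_Pair_Pair dist_real_def intro: mult_left_mono)
    finally show ?thesis .
  qed
  have lim: "((\<lambda>t. infdist (flow v t (0, a)) \<Gamma>) \<longlongrightarrow> 0) at_top" if a: "\<bar>a - c\<bar> < r" for a
  proof (rule tendstoI)
    fix \<epsilon> :: real assume "0 < \<epsilon>"
    then have "0 < \<epsilon> / K" by (simp add: K_def)
    then obtain n where "dist ((P ^^ n) a) c < \<epsilon> / K"
      using iterates_tend[OF near(1)[OF a]] unfolding lim_sequentially by blast
    then have n: "K * \<bar>(P ^^ n) a - c\<bar> < \<epsilon>" by (simp add: K_def dist_real_def field_simps)
    \<comment> \<open>\<open>bound\<close> is restarted at the \<open>n\<close>-th return, which is
      already close enough to \<open>c\<close>.\<close>
    have "infdist (flow v t (0, a)) \<Gamma> < \<epsilon>" if t: "S a n \<le> t" for t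
    proof -
      have "flow v t (0, a) = flow v (t - S a n) (0, (P ^^ n) a)"
        using right.flow_add[of "t - S a n" "S a n" "(0, a)"] flow_S[OF near(1)[OF a], of n] by simp
      then show ?thesis
        using bound[of "(P ^^ n) a" "t - S a n"] iter[OF a, of n] a t n by simp
    qed
    then show "\<forall>\<^sub>F t in at_top. dist (infdist (flow v t (0, a)) \<Gamma>) 0 < \<epsilon>"
      unfolding eventually_at_top_linorder by (intro exI[of _ "S a n"]) (simp add: infdist_nonneg)
  qed
  show thesis by (rule that[OF r _ bound lim]) (simp_all add: K_def)
qed

text \<open>The cycle crosses the axis at \<open>(0, c)\<close> with \<open>W = c > 0\<close>, so
  shortly before and after it lies on opposite sides. Nearby orbits do the same and cross in
  between.\<close>

lemma reaches_section_locally: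
  assumes "0 < \<eta>"
  shows "\<exists>\<delta>>0. \<forall>q. dist q (0, c) < \<delta> \<longrightarrow> (\<exists>s a. \<bar>s\<bar> \<le> 1 \<and> flow v s q = (0, a) \<and> \<bar>a - c\<bar> < \<eta>)"
proof -
  have "isCont (right.Y c) 0" by (rule DERIV_isCont[OF right.DY])
  moreover have "0 < \<eta> / 2" using assms by simp
  ultimately obtain d1 where d1: "0 < d1" "\<And>t. dist t 0 < d1 \<Longrightarrow> dist (right.Y c t) (right.Y c 0) < \<eta> / 2"
    unfolding continuous_at_eps_delta by blast
  have W0: "0 < right.W c 0" using c_pos by simp
  obtain d2 where d2: "0 < d2" "\<And>h. 0 < h \<Longrightarrow> h < d2 \<Longrightarrow> right.X c 0 < right.X c (0 + h)"
    using DERIV_pos_inc_right[OF right.DX W0] by blast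
  obtain d3 where d3: "0 < d3" "\<And>h. 0 < h \<Longrightarrow> h < d3 \<Longrightarrow> right.X c (0 - h) < right.X c 0"
    using DERIV_pos_inc_left[OF right.DX W0] by blast
  define e where "e = min 1 (min d1 (min d2 d3)) / 2"
  have e: "0 < e" "e < 1" "e < d1" "e < d2" "e < d3" using d1 d2 d3 by (auto simp: e_def)
  \<comment> \<open>The first two entries preserve the sign of \<open>x\<close> at the times
    \<open>e\<close> and \<open>- e\<close>, the third keeps the height of the crossing near that of
    the cycle.\<close>
  define \<mu> where "\<mu> = min (right.X c e) (min (- right.X c (- e)) (\<eta> / 2))"
  have \<mu>: "0 < \<mu>" using d2(2)[of e] d3(2)[of e] e assms by (simp add: \<mu>_def)
  have "\<exists>s a. \<bar>s\<bar> \<le> 1 \<and> flow v s q = (0, a) \<and> \<bar>a - c\<bar> < \<eta>" if q: "dist q (0, c) < \<mu> / exp L" for q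
  proof -
    have close: "dist (flow v t q) (flow v t (0, c)) < \<mu>" if "\<bar>t\<bar> \<le> e" for t
    proof -
      have "dist (flow v t q) (flow v t (0, c)) \<le> exp (L * \<bar>t\<bar>) * dist q (0, c)"
        by (rule right.flow_dist)
      also have "\<dots> \<le> exp L * dist q (0, c)"
        using that e right.L_nonneg by (intro mult_right_mono) (auto intro: mult_left_le)
      also have "\<dots> < \<mu>" using q by (simp add: field_simps)
      finally show ?thesis .
    qed
    have cX: "\<bar>fst (flow v t q) - right.X c t\<bar> < \<mu>" and cY: "\<bar>snd (flow v t q) - right.Y c t\<bar> < \<mu>"
      if "\<bar>t\<bar> \<le> e" for t
      using dist_fst_le[of "flow v t q" "flow v t (0, c)"] dist_snd_le[of "flow v t q" "flow v t (0, c)"] close[OF that]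
      by (simp_all add: right.X_def right.Y_def dist_real_def)
    have "\<mu> \<le> right.X c e" "\<mu> \<le> - right.X c (- e)" by (simp_all add: \<mu>_def)
    then have "fst (flow v (- e) q) < 0" "0 < fst (flow v e q)"
      using cX[of e] cX[of "- e"] e by auto
    moreover have "continuous_on {- e..e} (\<lambda>s. fst (flow v s q))"
      by (intro continuous_intros right.flow_continuous)
    ultimately obtain s where s: "- e \<le> s" "s \<le> e" "fst (flow v s q) = 0"
      using IVT'[of "\<lambda>s. fst (flow v s q)" "- e" 0 e] e by auto
    have "\<bar>snd (flow v s q) - right.Y c s\<bar> < \<eta> / 2" using cY[of s] s by (simp add: \<mu>_def abs_le_iff)
    moreover have "\<bar>right.Y c s - c\<bar> < \<eta> / 2"
      using d1(2)[of s] s e by (simp add: dist_real_def abs_less_iff)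
    ultimately have "\<bar>snd (flow v s q) - c\<bar> < \<eta>" by linarith
    moreover have "flow v s q = (0, snd (flow v s q))" using s(3) by (simp add: prod_eq_iff)
    moreover have "\<bar>s\<bar> \<le> 1" using s e by (simp add: abs_le_iff)
    ultimately show ?thesis by blast
  qed
  then show ?thesis using \<mu> by (intro exI[of _ "\<mu> / exp L"]) simp
qed

lemma compact_\<Gamma>: "compact \<Gamma>" and \<Gamma>_nonempty: "\<Gamma> \<noteq> {}"
  by (rule right.periodic_orbitE[OF periodic_\<Gamma>], assumption)+

lemma nearest_point:
  obtains q where "q \<in> \<Gamma>" "infdist p \<Gamma> = dist p q"
  using infdist_attains_inf[OF compact_imp_closed[OF compact_\<Gamma>] \<Gamma>_nonempty] that by blast

text \<open>The nearest point of the cycle flows to \<open>(0, c)\<close> within the time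
  \<open>T c\<close> and carries \<open>p\<close> along, at the cost of the factor
  \<open>exp (L * T c)\<close>. The last step may go backwards by up to 1, hence the bound on the
  absolute value of \<open>s\<close>.\<close>

lemma reaches_section:
  assumes "0 < \<eta>"
  shows "\<exists>\<delta>>0. \<forall>p. infdist p \<Gamma> < \<delta> \<longrightarrow>
    (\<exists>s a. \<bar>s\<bar> \<le> T c + 1 \<and> flow v s p = (0, a) \<and> \<bar>a - c\<bar> < \<eta>)"
proof -
  have Tc: "0 < T c" by (rule T_pos[OF c_pos])
  obtain \<delta> where \<delta>: "0 < \<delta>"
    "\<And>q. dist q (0, c) < \<delta> \<Longrightarrow> \<exists>s a. \<bar>s\<bar> \<le> 1 \<and> flow v s q = (0, a) \<and> \<bar>a - c\<bar> < \<eta>"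
    using reaches_section_locally[OF assms] by blast
  have "\<exists>s a. \<bar>s\<bar> \<le> T c + 1 \<and> flow v s p = (0, a) \<and> \<bar>a - c\<bar> < \<eta>"
    if p: "infdist p \<Gamma> < \<delta> / exp (L * T c)" for p
  proof -
    obtain q where q: "q \<in> \<Gamma>" "infdist p \<Gamma> = dist p q" by (rule nearest_point)
    then obtain t where t: "q = flow v t (0, c)" by (auto simp: \<Gamma>_def)
    obtain s where s: "s \<in> {0..T c}" "flow v t (0, c) = flow v s (0, c)" "flow v (T c - s) q = (0, c)"
      unfolding t by (rule right.periodic_flow_reduce[OF flow_T_c Tc, of t])
    have "dist (flow v (T c - s) p) (0, c) \<le> exp (L * \<bar>T c - s\<bar>) * dist p q"
      using right.flow_dist[of "T c - s" p q] s by simp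
    also have "\<dots> \<le> exp (L * T c) * dist p q"
      using s right.L_nonneg by (intro mult_right_mono) (auto intro: mult_left_mono)
    also have "\<dots> < \<delta>" using p q by (simp add: field_simps)
    finally obtain s' a where s': "\<bar>s'\<bar> \<le> 1" "flow v s' (flow v (T c - s) p) = (0, a)" "\<bar>a - c\<bar> < \<eta>"
      using \<delta>(2) by blast
    have "flow v (s' + (T c - s)) p = (0, a)" using s'(2) by (simp add: right.flow_add)
    moreover have "\<bar>s' + (T c - s)\<bar> \<le> T c + 1" using s s' by (auto simp: abs_le_iff)
    ultimately show ?thesis using s'(3) by blast
  qed
  then show ?thesis using \<delta>(1) by (intro exI[of _ "\<delta> / exp (L * T c)"]) simp
qed

lemma flow_stable:
  assumes "0 < \<epsilon>"
  shows "\<exists>\<delta>>0. \<forall>p. infdist p \<Gamma> < \<delta> \<longrightarrow> (\<forall>t\<ge>0. infdist (flow v t p) \<Gamma> < \<epsilon>)"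
proof -
  have Tc: "0 < T c" by (rule T_pos[OF c_pos])
  obtain r K where rK: "0 < r" "0 < K"
    "\<And>a t. \<bar>a - c\<bar> < r \<Longrightarrow> 0 \<le> t \<Longrightarrow> infdist (flow v t (0, a)) \<Gamma> \<le> K * \<bar>a - c\<bar>"
    "\<And>a. \<bar>a - c\<bar> < r \<Longrightarrow> ((\<lambda>t. infdist (flow v t (0, a)) \<Gamma>) \<longlongrightarrow> 0) at_top"
    by (rule orbits_from_section) blast
  define \<eta> where "\<eta> = min r (\<epsilon> / K)"
  have \<eta>: "0 < \<eta>" using rK assms by (simp add: \<eta>_def)
  obtain \<delta>1 where \<delta>1: "0 < \<delta>1" "\<And>p. infdist p \<Gamma> < \<delta>1 \<Longrightarrow>
      \<exists>s a. \<bar>s\<bar> \<le> T c + 1 \<and> flow v s p = (0, a) \<and> \<bar>a - c\<bar> < \<eta>"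
    using reaches_section[OF \<eta>] by blast
  \<comment> \<open>Covers the times before the section is reached, which are at most
    \<open>T c + 1\<close>.\<close>
  define D where "D = exp (L * (T c + 1))"
  define \<delta> where "\<delta> = min \<delta>1 (\<epsilon> / D)"
  have "0 < \<delta>" using \<delta>1 assms by (simp add: \<delta>_def D_def)
  moreover have "infdist (flow v t p) \<Gamma> < \<epsilon>" if p: "infdist p \<Gamma> < \<delta>" and t: "0 \<le> t" for p t
  proof -
    obtain s a where s: "\<bar>s\<bar> \<le> T c + 1" "flow v s p = (0, a)" "\<bar>a - c\<bar> < \<eta>"
      using \<delta>1(2)[of p] p by (auto simp: \<delta>_def)
    show ?thesis
    proof (cases "s \<le> t")
      case True
      have "flow v t p = flow v (t - s) (0, a)"
        using right.flow_add[of "t - s" s p] s(2) by simp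
      then have "infdist (flow v t p) \<Gamma> \<le> K * \<bar>a - c\<bar>"
        using rK(3)[of a "t - s"] s(3) True by (simp add: \<eta>_def)
      also have "\<dots> < \<epsilon>" using s(3) rK(2) by (simp add: \<eta>_def field_simps)
      finally show ?thesis .
    next
      case False
      obtain q where q: "q \<in> \<Gamma>" "infdist p \<Gamma> = dist p q" by (rule nearest_point)
      have "infdist (flow v t p) \<Gamma> \<le> exp (L * \<bar>t\<bar>) * dist p q"
        by (rule infdist_flow_le[OF q(1)])
      also have "\<dots> \<le> D * dist p q"
        unfolding D_def using False t s(1) right.L_nonneg
        by (intro mult_right_mono) (auto intro!: mult_left_mono)
      also have "\<dots> < \<epsilon>" using p q(2) by (simp add: \<delta>_def D_def field_simps)
      finally show ?thesis .
    qed
  qed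
  ultimately show ?thesis by blast
qed

lemma flow_attracted:
  "\<exists>\<delta>>0. \<forall>p. infdist p \<Gamma> < \<delta> \<longrightarrow> ((\<lambda>t. infdist (flow v t p) \<Gamma>) \<longlongrightarrow> 0) at_top"
proof -
  obtain r where r: "0 < r"
    "\<And>a. \<bar>a - c\<bar> < r \<Longrightarrow> ((\<lambda>t. infdist (flow v t (0, a)) \<Gamma>) \<longlongrightarrow> 0) at_top"
    by (rule orbits_from_section) blast
  obtain \<delta> where \<delta>: "0 < \<delta>" "\<And>p. infdist p \<Gamma> < \<delta> \<Longrightarrow>
      \<exists>s a. \<bar>s\<bar> \<le> T c + 1 \<and> flow v s p = (0, a) \<and> \<bar>a - c\<bar> < r"
    using reaches_section[OF r(1)] by blast
  have "((\<lambda>t. infdist (flow v t p) \<Gamma>) \<longlongrightarrow> 0) at_top" if p: "infdist p \<Gamma> < \<delta>" for p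
  proof -
    obtain s a where s: "flow v s p = (0, a)" "\<bar>a - c\<bar> < r" using \<delta>(2)[OF p] by blast
    have "filterlim (\<lambda>t. - s + t) at_top (at_top :: real filter)"
      by (intro filterlim_tendsto_add_at_top[OF tendsto_const filterlim_ident])
    then have "((\<lambda>t. infdist (flow v (- s + t) (0, a)) \<Gamma>) \<longlongrightarrow> 0) at_top"
      by (rule filterlim_compose[OF r(2)[OF s(2)]])
    moreover have "flow v (- s + t) (0, a) = flow v t p" for t
      using right.flow_add[of "- s + t" s p] s(1) by simp
    ultimately show ?thesis by simp
  qed
  then show ?thesis using \<delta>(1) by blast
qed

lemma \<Gamma>_bounds:
  assumes R: "\<And>t. t \<in> {0..right.\<tau> c} \<Longrightarrow> right.X c t < \<xi>"
    and L: "\<And>t. t \<in> {0..left.\<tau> (right.h c)} \<Longrightarrow> left.X (right.h c) t < \<xi>'"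
    and p: "p \<in> \<Gamma>"
  shows "- \<xi>' < fst p \<and> fst p < \<xi>"
proof -
  obtain t0 where t0: "p = flow v t0 (0, c)" using p by (auto simp: \<Gamma>_def)
  obtain t where t: "t \<in> {0..T c}" "p = flow v t (0, c)" "flow v (T c - t) p = (0, c)"
    unfolding t0 by (rule right.periodic_flow_reduce[OF flow_T_c T_pos[OF c_pos], of t0])
  have pos: "0 < right.\<tau> c" "0 < right.h c" "0 < left.\<tau> (right.h c)"
    by (simp_all add: right.\<tau>_pos right.h_pos left.\<tau>_pos c_pos)
  have \<xi>: "0 < \<xi>" "0 < \<xi>'" using R[of 0] L[of 0] pos by auto
  show ?thesis
  proof (cases "t \<le> right.\<tau> c")
    case True
    then show ?thesis
      using R[of t] right.X_nonneg[OF c_pos, of t] t \<xi> by (simp add: right.flow_XY)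
  next
    case False
    define s where "s = t - right.\<tau> c"
    have s: "s \<in> {0..left.\<tau> (right.h c)}" using False t by (simp add: s_def T_def)
    have "p = flow v s (0, - right.h c)"
      using right.flow_add[of s "right.\<tau> c" "(0, c)"] t right.flow_\<tau>[OF c_pos] by (simp add: s_def)
    then have "fst p = - left.X (right.h c) s" by (simp add: flow_left_start)
    then show ?thesis using L[OF s] left.X_nonneg[OF pos(2) s] \<xi> by simp
  qed
qed

end

context lienard
begin

text \<open>Apart from \<open>P a0 < a0\<close>, the assumptions involve \<open>F\<close> and
  \<open>G\<close> only between \<open>- \<xi>'\<close> and \<open>\<xi>\<close>, so the same
  numbers serve all large cut-off levels. \<open>a0\<close> bounds the cycle height
  \<open>c\<close>, and \<open>B\<close> bounds \<open>right.h c\<close>, the depth at which the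
  cycle enters the left half plane.\<close>

lemma limit_cycle:
  assumes a0: "0 < a0" "E0 \<le> a0\<^sup>2 / 2" "P a0 < a0"
    and m: "\<And>x. x \<in> {x2..x1} \<Longrightarrow> \<bar>F x\<bar> \<le> m"
    and B: "0 \<le> B" "max (a0\<^sup>2 / 2 + E0) ((m + 1)\<^sup>2 / 2 + E0) + m * E0 \<le> B\<^sup>2 / 2"
    and \<xi>: "x1 \<le> \<xi>" "a0 + (a0 + m) * a0 < G \<xi> + F \<xi>"
    and \<xi>': "- x2 \<le> \<xi>'" "B + (B + m) * B < G (- \<xi>') - F (- \<xi>')"
  obtains \<Gamma> where "periodic_orbit v \<Gamma>" "\<And>\<Delta>. periodic_orbit v \<Delta> \<Longrightarrow> \<Delta> = \<Gamma>"
    "\<And>\<epsilon>. 0 < \<epsilon> \<Longrightarrow> \<exists>\<delta>>0. \<forall>p. infdist p \<Gamma> < \<delta> \<longrightarrow> (\<forall>t\<ge>0. infdist (flow v t p) \<Gamma> < \<epsilon>)"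
    "\<exists>\<delta>>0. \<forall>p. infdist p \<Gamma> < \<delta> \<longrightarrow> ((\<lambda>t. infdist (flow v t p) \<Gamma>) \<longlongrightarrow> 0) at_top"
    "\<And>p. p \<in> \<Gamma> \<Longrightarrow> - \<xi>' < fst p \<and> fst p < \<xi>"
proof -
  obtain c where c: "0 < c" "c < a0" "E0 < c\<^sup>2 / 2" "P c = c"
    "\<And>a. 0 < a \<Longrightarrow> a < c \<Longrightarrow> a < P a" "\<And>a. c < a \<Longrightarrow> P a < a"
    by (rule fixed_point_exists[OF a0]) blast
  interpret lienard_cycle f F g G L x1 x2 c
    by unfold_locales (fact c)+
  have m0: "0 \<le> m" using m[of 0] x1_pos x2_neg by simp
  have b: "0 < right.h c" by (rule right.h_pos[OF c(1)])
  have hB: "right.h c \<le> B"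
  proof (rule power2_le_imp_le)
    have "c\<^sup>2 \<le> a0\<^sup>2" using c by (intro power_mono) auto
    then have "max (c\<^sup>2 / 2 + E0) ((m + 1)\<^sup>2 / 2 + E0) \<le> max (a0\<^sup>2 / 2 + E0) ((m + 1)\<^sup>2 / 2 + E0)"
      by (intro max.mono) auto
    moreover have "(right.h c)\<^sup>2 / 2 \<le> max (c\<^sup>2 / 2 + E0) ((m + 1)\<^sup>2 / 2 + E0) + m * E0"
      using c m x2_neg by (intro right_h_estimate) auto
    ultimately show "(right.h c)\<^sup>2 \<le> B\<^sup>2" using B by linarith
  qed (rule B(1))
  have "- m \<le> F x" if "x \<in> {0..x1}" for x using m[of x] that x2_neg by (simp add: abs_le_iff)
  then have R: "right.X c t < \<xi>" if "t \<in> {0..right.\<tau> c}" for t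
    using right.X_bound[OF c(1) less_imp_le[OF c(2)] m0 _ \<xi> that] by blast
  have "- m \<le> - F (- x)" if "x \<in> {0..- x2}" for x using m[of "- x"] that x1_pos by (simp add: abs_le_iff)
  then have L: "left.X (right.h c) t < \<xi>'" if "t \<in> {0..left.\<tau> (right.h c)}" for t
    using left.X_bound[OF b hB m0 _ \<xi>'(1) _ that] \<xi>'(2) by simp
  show thesis
    by (rule that[of \<Gamma>])
      (use periodic_\<Gamma> periodic_unique flow_stable flow_attracted \<Gamma>_bounds[OF R L] in blast)+
qed

end

section \<open>Cutting off the vector field\<close>

text \<open>Tailored to \<open>P_estimate\<close>: for large \<open>a\<close> the linear loss
  outweighs \<open>E + k + k'\<close>, and the remaining entries of the maximum are
  constants.\<close>

lemma quadratic_beats_estimate: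
  fixes c d E k k' q q' :: real
  assumes "0 < c"
  shows "\<exists>A>0. \<forall>a\<ge>A. max (max (a\<^sup>2 / 2 + E - c * (a - d)) q + k) q' + k' < a\<^sup>2 / 2"
proof -
  define r where "r = d + (E + k + k') / c"
  define A where "A = 1 + \<bar>r\<bar> + 2 * \<bar>q + k + k'\<bar> + 2 * \<bar>q' + k'\<bar>"
  have A: "1 \<le> A" "r < A" "2 * (q + k + k') < A" "2 * (q' + k') < A"
    by (auto simp: A_def abs_if)
  have "max (max (a\<^sup>2 / 2 + E - c * (a - d)) q + k) q' + k' < a\<^sup>2 / 2" if a: "A \<le> a" for a
  proof -
    have a1: "1 \<le> a" using a A by simp
    then have "1 * a \<le> a * a" by (intro mult_right_mono) auto
    then have sq: "a \<le> a\<^sup>2" by (simp add: power2_eq_square)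
    have "(E + k + k') / c < a - d" using a A(2) by (simp add: r_def)
    then have "E + k + k' < c * (a - d)" using assms by (simp add: field_simps)
    moreover have "q + k + k' < a\<^sup>2 / 2" "q' + k' < a\<^sup>2 / 2" using a sq A(3,4) by simp_all
    ultimately show ?thesis by (simp add: max_def)
  qed
  moreover have "0 < A" using A(1) by simp
  ultimately show ?thesis by blast
qed

lemma primitive_0 [simp]: "primitive h 0 = 0"
  by (simp add: primitive_def zero_ereal_def[symmetric])

lemma primitive_has_derivative:
  assumes "continuous_on UNIV h"
  shows "(primitive h has_real_derivative h x) (at x)"
proof -
  define lo hi where "lo = min 0 x - 1" and "hi = max 0 x + 1"
  have "((\<lambda>u. LBINT y=ereal 0..ereal u. h y) has_vector_derivative h x) (at x within {lo..hi})"
    by (rule interval_integral_FTC2) (auto simp: lo_def hi_def intro: continuous_on_subset[OF assms])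
  moreover have "at x within {lo..hi} = at x"
    by (rule at_within_Icc_at) (auto simp: lo_def hi_def)
  moreover have "(\<lambda>u. LBINT y=ereal 0..ereal u. h y) = primitive h"
    by (simp add: primitive_def fun_eq_iff zero_ereal_def)
  ultimately show ?thesis by (simp add: has_real_derivative_iff_has_vector_derivative)
qed

definition clamp_to :: "real \<Rightarrow> real \<Rightarrow> real" where "clamp_to M x = max (- M) (min M x)"

text \<open>Continuing by the boundary values preserves the signs of \<open>f\<close> and
  \<open>g\<close> outside the strip: the primitive of \<open>f\<close> stays monotone there and
  that of \<open>g\<close> grows linearly.\<close>

definition cutoff :: "real \<Rightarrow> (real \<Rightarrow> real) \<Rightarrow> real \<Rightarrow> real" where "cutoff M h x = h (clamp_to M x)"

lemma clamp_to_mem: "0 \<le> M \<Longrightarrow> clamp_to M x \<in> {- M..M}"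
  by (auto simp: clamp_to_def)

lemma clamp_to_dist: "\<bar>clamp_to M x - clamp_to M y\<bar> \<le> \<bar>x - y\<bar>"
  by (auto simp: clamp_to_def min_def max_def)

lemma clamp_to_id: "\<bar>x\<bar> \<le> M \<Longrightarrow> clamp_to M x = x"
  by (auto simp: clamp_to_def abs_le_iff)

lemma cutoff_id: "\<bar>x\<bar> \<le> M \<Longrightarrow> cutoff M h x = h x"
  by (simp add: cutoff_def clamp_to_id)

lemma continuous_cutoff:
  assumes "continuous_on UNIV h"
  shows "continuous_on UNIV (cutoff M h)"
  unfolding cutoff_def clamp_to_def
  by (intro continuous_on_compose2[OF assms] continuous_intros) auto

lemma primitive_cutoff:
  assumes "\<bar>x\<bar> \<le> M"
  shows "primitive (cutoff M h) x = primitive h x"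
  unfolding primitive_def
proof (rule interval_integral_cong)
  fix y assume "y \<in> einterval (min 0 (ereal x)) (max 0 (ereal x))"
  then have "\<bar>y\<bar> \<le> \<bar>x\<bar>"
    by (cases "0 \<le> x") (auto simp: einterval_def min_def max_def zero_ereal_def)
  then show "cutoff M h y = h y" using assms by (intro cutoff_id) simp
qed

lemma lienard_field_cutoff: "\<bar>fst p\<bar> \<le> M \<Longrightarrow> lienard_field (cutoff M f) (cutoff M g) p = lienard_field f g p"
  by (cases p) (simp add: lienard_field_def cutoff_id primitive_cutoff)

text \<open>\<open>f\<close> is bounded on the compact interval, which makes the primitive of its
  cut-off Lipschitz; \<open>g\<close> is Lipschitz there, and clamping does not increase
  distances.\<close>

lemma lipschitz_lienard_field_cutoff:
  assumes f: "continuous_on UNIV f" and g: "local_lipschitz (UNIV :: real set) UNIV (\<lambda>_. g)" and "0 \<le> M"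
  shows "\<exists>L. L-lipschitz_on UNIV (lienard_field (cutoff M f) (cutoff M g))"
proof -
  have "bounded (f ` {- M..M})"
    by (intro compact_imp_bounded compact_continuous_image compact_Icc continuous_on_subset[OF f]) simp
  then obtain C where "\<forall>y\<in>f ` {- M..M}. norm y \<le> C"
    unfolding bounded_iff by blast
  then have C: "\<bar>f x\<bar> \<le> C" if "x \<in> {- M..M}" for x using that by simp
  have C0: "0 \<le> C" using C[of 0] \<open>0 \<le> M\<close> by simp
  have F: "\<bar>primitive (cutoff M f) x - primitive (cutoff M f) y\<bar> \<le> C * \<bar>x - y\<bar>" for x y
  proof -
    have "norm (primitive (cutoff M f) x - primitive (cutoff M f) y) \<le> C * norm (x - y)"
    proof (rule field_differentiable_bound[of UNIV])
      show "(primitive (cutoff M f) has_field_derivative cutoff M f z) (at z)" for z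
        by (rule primitive_has_derivative[OF continuous_cutoff[OF f]])
      show "norm (cutoff M f z) \<le> C" for z
        using C[OF clamp_to_mem[OF \<open>0 \<le> M\<close>]] by (simp add: cutoff_def)
    qed auto
    then show ?thesis by simp
  qed
  obtain D where D: "D-lipschitz_on {- M..M} g"
    using local_lipschitz_compact_implies_lipschitz[of "{0 :: real}" "{- M..M}" "\<lambda>_. g"]
      local_lipschitz_subset[OF g, of "{0}" "{- M..M}"] by auto
  have D0: "0 \<le> D" using D by (rule lipschitz_on_nonneg)
  have G: "\<bar>cutoff M g x - cutoff M g y\<bar> \<le> D * \<bar>x - y\<bar>" for x y
  proof -
    have "\<bar>cutoff M g x - cutoff M g y\<bar> \<le> D * \<bar>clamp_to M x - clamp_to M y\<bar>"
      using lipschitz_onD[OF D clamp_to_mem clamp_to_mem, OF \<open>0 \<le> M\<close> \<open>0 \<le> M\<close>]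
      by (simp add: cutoff_def dist_real_def)
    also have "\<dots> \<le> D * \<bar>x - y\<bar>" using D0 clamp_to_dist by (intro mult_left_mono)
    finally show ?thesis .
  qed
  have "(1 + C + D)-lipschitz_on UNIV (lienard_field (cutoff M f) (cutoff M g))"
  proof (rule lipschitz_onI)
    fix p q :: "real \<times> real"
    obtain x y x' y' where pq: "p = (x, y)" "q = (x', y')" by fastforce
    let ?F = "primitive (cutoff M f)" and ?g = "cutoff M g"
    have xy: "\<bar>x - x'\<bar> \<le> dist p q" "\<bar>y - y'\<bar> \<le> dist p q"
      using dist_fst_le[of p q] dist_snd_le[of p q] by (simp_all add: pq dist_real_def)
    have "dist (lienard_field (cutoff M f) ?g p) (lienard_field (cutoff M f) ?g q)
        \<le> \<bar>(y - ?F x) - (y' - ?F x')\<bar> + \<bar>- ?g x - - ?g x'\<bar>"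
      unfolding pq lienard_field_def dist_Pair_Pair prod.case dist_real_def
      using sqrt_sum_squares_le_sum_abs by simp
    also have "\<dots> \<le> \<bar>y - y'\<bar> + C * \<bar>x - x'\<bar> + D * \<bar>x - x'\<bar>"
      using F[of x x'] G[of x x'] by linarith
    also have "\<dots> \<le> dist p q + C * dist p q + D * dist p q"
      using xy C0 D0 by (intro add_mono mult_left_mono)
    finally show "dist (lienard_field (cutoff M f) ?g p) (lienard_field (cutoff M f) ?g q)
        \<le> (1 + C + D) * dist p q" by (simp add: algebra_simps)
  qed (use C0 D0 in simp)
  then show ?thesis by blast
qed

section \<open>The original system and its cut-offs\<close>

locale lienard_system =
  fixes f g :: "real \<Rightarrow> real" and x1 x2 :: real
  assumes cont_f: "continuous_on UNIV f"
    and lip_g: "local_lipschitz (UNIV :: real set) UNIV (\<lambda>_. g)"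
    and f0: "f 0 < 0"
    and f_pos: "\<exists>\<delta>>0. \<forall>x. \<delta> < \<bar>x\<bar> \<longrightarrow> 0 < f x"
    and xg_pos: "x \<noteq> 0 \<Longrightarrow> 0 < x * g x"
    and x2_neg: "x2 < 0" and x1_pos: "0 < x1"
    and zeros: "primitive f x = 0 \<longleftrightarrow> x = x2 \<or> x = 0 \<or> x = x1"
    and mono: "mono_on {..x2} (primitive f)" "mono_on {x1..} (primitive f)"
    and G_eq: "primitive g x1 = primitive g x2"
    and unbounded_right: "\<exists>x\<ge>b. K < primitive g x + primitive f x"
    and unbounded_left: "\<exists>x\<le>b. K < primitive g x - primitive f x"
begin

definition "F = primitive f"
definition "G = primitive g"

lemma cont_g: "continuous_on UNIV g"
  using local_lipschitz_continuous_on[OF lip_g, of 0] by simp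

lemma DF: "(F has_real_derivative f x) (at x)" and DG: "(G has_real_derivative g x) (at x)"
  unfolding F_def G_def by (intro primitive_has_derivative cont_f cont_g)+

lemma cont_F: "continuous_on S F"
  by (rule deriv_continuous_on, rule DF)

lemma F_zero: "F x = 0 \<longleftrightarrow> x = x2 \<or> x = 0 \<or> x = x1"
  using zeros by (simp add: F_def)

lemma g_0: "g 0 = 0"
proof (rule ccontr)
  assume "g 0 \<noteq> 0"
  have "isCont g 0" using cont_g by (simp add: continuous_on_eq_continuous_at)
  then obtain d where d: "0 < d" "\<And>x. dist x 0 < d \<Longrightarrow> dist (g x) (g 0) < \<bar>g 0\<bar>"
    using \<open>g 0 \<noteq> 0\<close> unfolding continuous_at_eps_delta by (metis zero_less_abs_iff)
  have "0 < g (d / 2)" "g (- d / 2) < 0"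
    using xg_pos[of "d / 2"] xg_pos[of "- d / 2"] d(1) by (auto simp: zero_less_mult_iff mult_less_0_iff zero_less_divide_iff divide_less_0_iff)
  then show False using d(2)[of "d / 2"] d(2)[of "- d / 2"] d(1)
    by (auto simp: dist_real_def abs_if split: if_splits)
qed

text \<open>As \<open>f 0 < 0\<close>, \<open>F\<close> is negative just to the right of 0, and it
  has no zero before \<open>x1\<close>.\<close>

lemma F_neg:
  assumes "0 < x" "x < x1"
  shows "F x < 0"
proof (rule ccontr)
  assume "\<not> F x < 0"
  obtain d where d: "0 < d" "\<And>h. 0 < h \<Longrightarrow> h < d \<Longrightarrow> F (0 + h) < F 0"
    using DERIV_neg_dec_right[OF DF f0] by blast
  define y where "y = min d x / 2"
  have y: "0 < y" "y < d" "y < x" using d(1) assms by (auto simp: y_def)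
  then have "F y < 0" using d(2)[of y] F_zero[of 0] by simp
  then obtain z where "y \<le> z" "z \<le> x" "F z = 0"
    using IVT'[of F y 0 x] \<open>\<not> F x < 0\<close> y cont_F by auto
  then show False using F_zero[of z] y assms x2_neg by auto
qed

lemma F_pos:
  assumes "x2 < x" "x < 0"
  shows "0 < F x"
proof (rule ccontr)
  assume "\<not> 0 < F x"
  obtain d where d: "0 < d" "\<And>h. 0 < h \<Longrightarrow> h < d \<Longrightarrow> F 0 < F (0 - h)"
    using DERIV_neg_dec_left[OF DF f0] by blast
  define y where "y = - (min d (- x) / 2)"
  have y: "y < 0" "- y < d" "x < y" using d(1) assms by (auto simp: y_def)
  then have "0 < F y" using d(2)[of "- y"] F_zero[of 0] by simp
  then obtain z where "x \<le> z" "z \<le> y" "F z = 0"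
    using IVT'[of F x 0 y] \<open>\<not> 0 < F x\<close> y cont_F by auto
  then show False using F_zero[of z] y assms x1_pos by auto
qed

lemma f_nonneg: "x1 < x \<or> x < x2 \<Longrightarrow> 0 \<le> f x"
  using mono_on_imp_deriv_nonneg[OF mono(2) DF[unfolded F_def], of x]
    mono_on_imp_deriv_nonneg[OF mono(1) DF[unfolded F_def], of x] by auto

text \<open>Supplies the level beyond which dissipation takes away energy linearly in the starting
  height.\<close>

lemma F_pos_beyond: "\<exists>\<xi>>x1. 0 < F \<xi>"
proof -
  obtain \<delta> where \<delta>: "0 < \<delta>" "\<And>x. \<delta> < \<bar>x\<bar> \<Longrightarrow> 0 < f x" using f_pos by blast
  define y where "y = max x1 \<delta>"
  have "F y < F (y + 1)"
    by (rule deriv_pos_less[OF _ DF]) (use \<delta> in \<open>auto simp: y_def\<close>)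
  moreover have "0 \<le> F y"
    using mono_onD[OF mono(2), of x1 y] F_zero[of x1] by (simp add: F_def y_def)
  ultimately show ?thesis by (intro exI[of _ "y + 1"]) (simp add: y_def)
qed

abbreviation vc :: "real \<Rightarrow> real \<times> real \<Rightarrow> real \<times> real" where
  "vc M \<equiv> lienard_field (cutoff M f) (cutoff M g)"

lemma vc_eq: "vc M = (\<lambda>(x, y). (y - primitive (cutoff M f) x, - cutoff M g x))"
  by (simp add: lienard_field_def)

lemma lienard_cutoff:
  assumes M: "x1 < M" "- x2 < M"
  obtains L where "lienard (cutoff M f) (primitive (cutoff M f)) (cutoff M g) (primitive (cutoff M g)) L x1 x2"
proof -
  have M0: "0 \<le> M" using M x1_pos by simp
  obtain L where L: "L-lipschitz_on UNIV (vc M)"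
    using lipschitz_lienard_field_cutoff[OF cont_f lip_g M0] by blast
  let ?F = "primitive (cutoff M f)" and ?G = "primitive (cutoff M g)"
  have F: "?F x = F x" and G: "?G x = G x" if "\<bar>x\<bar> \<le> M" for x
    using that by (simp_all add: primitive_cutoff F_def G_def)
  have dF: "(?F has_real_derivative cutoff M f x) (at x)" and dG: "(?G has_real_derivative cutoff M g x) (at x)" for x
    by (intro primitive_has_derivative continuous_cutoff cont_f cont_g)+
  have gM: "0 < g M" "g (- M) < 0"
    using xg_pos[of M] xg_pos[of "- M"] M x1_pos by (auto simp: zero_less_mult_iff mult_less_0_iff)
  show thesis
  proof (rule that, unfold_locales)
    show "L-lipschitz_on UNIV (\<lambda>(x, y). (y - ?F x, - cutoff M g x))"
      using L unfolding vc_eq .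
    show "continuous_on UNIV (cutoff M f)" "continuous_on UNIV (cutoff M g)"
      by (intro continuous_cutoff cont_f cont_g)+
    show "cutoff M g 0 = 0" using g_0 M0 by (simp add: cutoff_id)
    show "0 < x * cutoff M g x" if "x \<noteq> 0" for x
    proof -
      have "0 < clamp_to M x * g (clamp_to M x)"
        by (rule xg_pos) (use that M x1_pos in \<open>auto simp: clamp_to_def min_def max_def\<close>)
      moreover have "0 < x \<longleftrightarrow> 0 < clamp_to M x" "x < 0 \<longleftrightarrow> clamp_to M x < 0"
        using M x1_pos by (auto simp: clamp_to_def min_def max_def)
      ultimately show ?thesis by (simp add: cutoff_def zero_less_mult_iff)
    qed
    show "?F x1 = 0" "?F x2 = 0" "?G x1 = ?G x2"
      using F[of x1] F[of x2] G[of x1] G[of x2] F_zero[of x1] F_zero[of x2] G_eq M x1_pos x2_neg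
      by (simp_all add: G_def)
    show "?F x < 0" if "0 < x" "x < x1" for x using F[of x] F_neg[OF that] that M by simp
    show "0 < ?F x" if "x2 < x" "x < 0" for x using F[of x] F_pos[OF that] that M by simp
    show "mono_on {x1..} ?F"
    proof (rule mono_onI)
      fix r s assume rs: "r \<in> {x1..}" "s \<in> {x1..}" "r \<le> s"
      show "?F r \<le> ?F s"
      proof (rule deriv_nonneg_le[OF rs(3) dF])
        fix t assume "r < t"
        \<comment> \<open>Strictness of \<open>x1 < M\<close> matters: the clamped point stays
          beyond \<open>x1\<close>, where \<open>f\<close> is nonnegative.\<close>
        then have "x1 < clamp_to M t" using rs M by (auto simp: clamp_to_def)
        then show "0 \<le> cutoff M f t" unfolding cutoff_def by (intro f_nonneg) simp
      qed
    qed
    show "mono_on {..x2} ?F"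
    proof (rule mono_onI)
      fix r s assume rs: "r \<in> {..x2}" "s \<in> {..x2}" "r \<le> s"
      show "?F r \<le> ?F s"
      proof (rule deriv_nonneg_le[OF rs(3) dF])
        fix t assume "t < s"
        then have "clamp_to M t < x2" using rs M by (auto simp: clamp_to_def)
        then show "0 \<le> cutoff M f t" unfolding cutoff_def by (intro f_nonneg) simp
      qed
    qed
    show "\<exists>x>0. K < ?G x" for K
    proof -
      \<comment> \<open>Beyond \<open>M\<close> the slope of \<open>?G\<close> is the constant
        \<open>g M > 0\<close>, so it is unbounded even if \<open>G\<close> is not.\<close>
      have "\<exists>t>M. - ?G t < - K"
      proof (rule eventually_below[OF DERIV_minus[OF dG]])
        show "- cutoff M g t \<le> - g M" if "M \<le> t" for t
          using that M0 by (simp add: cutoff_def clamp_to_def)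
      qed (rule gM)
      then obtain t where "M < t" "K < ?G t" by auto
      then show ?thesis using M0 by (intro exI[of _ t]) simp
    qed
    show "\<exists>x<0. K < ?G x" for K
    proof -
      have "\<exists>t>M. - ?G (- t) < - K"
      proof (rule eventually_below)
        show "((\<lambda>t. - ?G (- t)) has_real_derivative cutoff M g (- t)) (at t)" for t
          using DERIV_minus[OF DERIV_chain2[OF dG DERIV_minus[OF DERIV_ident]]] by simp
        show "cutoff M g (- t) \<le> - (- g (- M))" if "M \<le> t" for t
          using that M0 by (simp add: cutoff_def clamp_to_def)
      qed (use gM in simp)
      then obtain t where "M < t" "K < ?G (- t)" by auto
      then show ?thesis using M0 by (intro exI[of _ "- t"]) simp
    qed
  qed (use dF dG x1_pos x2_neg in simp_all)
qed

text \<open>All constants come from the uncut \<open>F\<close> and \<open>G\<close>, and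
  \<open>M\<close> is put beyond all points used; cut-offs at \<open>N >= M\<close> agree with
  \<open>F\<close> and \<open>G\<close> there. The bound \<open>M - 1\<close>, the same for every
  \<open>N\<close>, is what permits the return to the original field.\<close>

lemma cutoff_limit_cycle:
  obtains M where "0 < M" "\<And>N. M \<le> N \<Longrightarrow> \<exists>\<Gamma>. periodic_orbit (vc N) \<Gamma> \<and>
    (\<forall>\<Delta>. periodic_orbit (vc N) \<Delta> \<longrightarrow> \<Delta> = \<Gamma>) \<and>
    (\<forall>\<epsilon>>0. \<exists>\<delta>>0. \<forall>p. infdist p \<Gamma> < \<delta> \<longrightarrow> (\<forall>t\<ge>0. infdist (flow (vc N) t p) \<Gamma> < \<epsilon>)) \<and>
    (\<exists>\<delta>>0. \<forall>p. infdist p \<Gamma> < \<delta> \<longrightarrow> ((\<lambda>t. infdist (flow (vc N) t p) \<Gamma>) \<longlongrightarrow> 0) at_top) \<and>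
    (\<forall>p\<in>\<Gamma>. \<bar>fst p\<bar> \<le> M - 1)"
proof -
  define E where "E = G x1"
  obtain \<zeta> where \<zeta>: "x1 < \<zeta>" "0 < F \<zeta>" using F_pos_beyond by blast
  have "bounded (F ` {x2..\<zeta>})"
    by (intro compact_imp_bounded compact_continuous_image compact_Icc cont_F)
  then obtain m where "\<forall>y\<in>F ` {x2..\<zeta>}. norm y \<le> m"
    unfolding bounded_iff by blast
  then have m: "\<bar>F x\<bar> \<le> m" if "x \<in> {x2..\<zeta>}" for x using that by simp
  define q where "q = (m + 1)\<^sup>2 / 2 + E"
  obtain A where A: "0 < A" "\<And>a. A \<le> a \<Longrightarrow>
      max (max (a\<^sup>2 / 2 + E - F \<zeta> * (a - (G \<zeta> + F \<zeta>))) q + (m * E + E)) q + m * E < a\<^sup>2 / 2"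
    using quadratic_beats_estimate[OF \<zeta>(2)] by blast
  \<comment> \<open>The three entries give the net loss of energy over a turn, the height that
    \<open>P_estimate\<close> requires, and energy at least \<open>E\<close>.\<close>
  define a0 where "a0 = max A (max (G \<zeta> + m + 1) (sqrt (2 * \<bar>E\<bar>)))"
  have a0: "0 < a0" "A \<le> a0" "G \<zeta> + m + 1 \<le> a0" "sqrt (2 * \<bar>E\<bar>) \<le> a0"
    using A(1) by (auto simp: a0_def)
  have "(sqrt (2 * \<bar>E\<bar>))\<^sup>2 \<le> a0\<^sup>2" using a0(4) by (intro power_mono) auto
  then have a0_high: "E \<le> a0\<^sup>2 / 2" by simp
  define S where "S = max (a0\<^sup>2 / 2 + E) ((m + 1)\<^sup>2 / 2 + E) + m * E"
  \<comment> \<open>\<open>S\<close> bounds the energy with which the cycle leaves the right half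
    plane, so \<open>B\<close> bounds the depth there; the absolute value avoids a discussion of its
    sign.\<close>
  define B where "B = sqrt (2 * \<bar>S\<bar>)"
  have B: "0 \<le> B" "S \<le> B\<^sup>2 / 2" by (auto simp: B_def)
  obtain \<xi> where \<xi>: "x1 \<le> \<xi>" "a0 + (a0 + m) * a0 < G \<xi> + F \<xi>"
    using unbounded_right[of x1] unfolding F_def G_def by blast
  obtain \<xi>0 where \<xi>0: "\<xi>0 \<le> x2" "B + (B + m) * B < G \<xi>0 - F \<xi>0"
    using unbounded_left[of x2] unfolding F_def G_def by blast
  define \<xi>' where "\<xi>' = - \<xi>0"
  have \<xi>': "- x2 \<le> \<xi>'" "B + (B + m) * B < G (- \<xi>') - F (- \<xi>')"
    using \<xi>0 by (simp_all add: \<xi>'_def)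
  \<comment> \<open>The summand 1 leaves room for a neighbourhood of the cycle within the strip
    where the fields agree.\<close>
  define M where "M = 1 + max \<zeta> (max \<xi> \<xi>')"
  have M: "0 < M" "\<zeta> < M" "\<xi> \<le> M - 1" "\<xi>' \<le> M - 1" using \<zeta>(1) x1_pos by (auto simp: M_def)
  show thesis
  proof (rule that[OF M(1)])
    fix N assume N: "M \<le> N"
    have N': "x1 < N" "- x2 < N" using N M \<zeta> \<xi>'(1) by auto
    obtain L where "lienard (cutoff N f) (primitive (cutoff N f)) (cutoff N g) (primitive (cutoff N g)) L x1 x2"
      by (rule lienard_cutoff[OF N'])
    then interpret cut: lienard "cutoff N f" "primitive (cutoff N f)" "cutoff N g" "primitive (cutoff N g)" L x1 x2 .
    have F: "primitive (cutoff N f) x = F x" and G: "primitive (cutoff N g) x = G x" if "\<bar>x\<bar> \<le> N" for x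
      using that by (simp_all add: primitive_cutoff F_def G_def)
    have E: "cut.E0 = E" using G[of x1] N' x1_pos by (simp add: cut.E0_def E_def)
    have in_N: "\<bar>x\<bar> \<le> N" if "x \<in> {x2..\<zeta>}" for x using that N M N' by (simp add: abs_le_iff)
    have mN: "\<bar>primitive (cutoff N f) x\<bar> \<le> m" if "x \<in> {x2..\<zeta>}" for x
      using m[OF that] F[OF in_N[OF that]] by simp
    have \<zeta>N: "primitive (cutoff N f) \<zeta> = F \<zeta>" "primitive (cutoff N g) \<zeta> = G \<zeta>"
      using F G in_N[of \<zeta>] \<zeta>(1) x1_pos x2_neg by auto
    have "(cut.P a0)\<^sup>2 / 2
        \<le> max (max (a0\<^sup>2 / 2 + E - F \<zeta> * (a0 - G \<zeta> - F \<zeta>)) q + m * E + E) q + m * E"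
      using cut.P_estimate[OF a0(1) _ \<zeta>(1) mN] a0_high a0(3) unfolding E \<zeta>N q_def by blast
    also have "\<dots> < a0\<^sup>2 / 2"
      using A(2)[OF a0(2)] by (simp only: diff_diff_eq add.assoc)
    finally have "(cut.P a0)\<^sup>2 < a0\<^sup>2" by simp
    then have Pa0: "cut.P a0 < a0" by (rule power2_less_imp_less) (use a0 in simp)
    have mN': "\<bar>primitive (cutoff N f) x\<bar> \<le> m" if "x \<in> {x2..x1}" for x
      using mN[of x] that \<zeta>(1) by simp
    have \<xi>N: "a0 + (a0 + m) * a0 < primitive (cutoff N g) \<xi> + primitive (cutoff N f) \<xi>"
      using F[of \<xi>] G[of \<xi>] \<xi> M N x1_pos by simp
    have \<xi>N': "B + (B + m) * B < primitive (cutoff N g) (- \<xi>') - primitive (cutoff N f) (- \<xi>')"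
      using F[of "- \<xi>'"] G[of "- \<xi>'"] \<xi>' M N x2_neg by simp
    have BN: "max (a0\<^sup>2 / 2 + cut.E0) ((m + 1)\<^sup>2 / 2 + cut.E0) + m * cut.E0 \<le> B\<^sup>2 / 2"
      using B(2) by (simp add: S_def E)
    have a0N: "cut.E0 \<le> a0\<^sup>2 / 2" using a0_high by (simp add: E)
    obtain \<Gamma> where \<Gamma>: "periodic_orbit cut.v \<Gamma>" "\<And>\<Delta>. periodic_orbit cut.v \<Delta> \<Longrightarrow> \<Delta> = \<Gamma>"
      "\<And>\<epsilon>. 0 < \<epsilon> \<Longrightarrow> \<exists>\<delta>>0. \<forall>p. infdist p \<Gamma> < \<delta> \<longrightarrow> (\<forall>t\<ge>0. infdist (flow cut.v t p) \<Gamma> < \<epsilon>)"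
      "\<exists>\<delta>>0. \<forall>p. infdist p \<Gamma> < \<delta> \<longrightarrow> ((\<lambda>t. infdist (flow cut.v t p) \<Gamma>) \<longlongrightarrow> 0) at_top"
      "\<And>p. p \<in> \<Gamma> \<Longrightarrow> - \<xi>' < fst p \<and> fst p < \<xi>"
      by (rule cut.limit_cycle[OF a0(1) a0N Pa0 mN' B(1) BN \<xi>(1) \<xi>N \<xi>'(1) \<xi>N']) blast+
    have "\<bar>fst p\<bar> \<le> M - 1" if "p \<in> \<Gamma>" for p
      using \<Gamma>(5)[OF that] M(3,4) by (simp add: abs_le_iff)
    then show "\<exists>\<Gamma>. periodic_orbit (vc N) \<Gamma> \<and>
      (\<forall>\<Delta>. periodic_orbit (vc N) \<Delta> \<longrightarrow> \<Delta> = \<Gamma>) \<and>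
      (\<forall>\<epsilon>>0. \<exists>\<delta>>0. \<forall>p. infdist p \<Gamma> < \<delta> \<longrightarrow> (\<forall>t\<ge>0. infdist (flow (vc N) t p) \<Gamma> < \<epsilon>)) \<and>
      (\<exists>\<delta>>0. \<forall>p. infdist p \<Gamma> < \<delta> \<longrightarrow> ((\<lambda>t. infdist (flow (vc N) t p) \<Gamma>) \<longlongrightarrow> 0) at_top) \<and>
      (\<forall>p\<in>\<Gamma>. \<bar>fst p\<bar> \<le> M - 1)"
      unfolding vc_eq by (intro exI[of _ \<Gamma>] conjI) (use \<Gamma>(1-4) in blast)+
  qed
qed

text \<open>Over \<open>{0..t}\<close> both curves are compact, hence in a strip where the field
  equals a globally Lipschitz cut-off, and \<open>solution_dist_le\<close> applies.\<close>

lemma forward_solution_unique: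
  assumes z: "solution_on {0..} (lienard_field f g) z" and w: "solution_on {0..} (lienard_field f g) w"
    and "z 0 = w 0" "0 \<le> t"
  shows "z t = w t"
proof -
  have "compact (z ` {0..t})" "compact (w ` {0..t})"
    using continuous_on_subset[OF solution_on_continuous[OF z], of "{0..t}"]
      continuous_on_subset[OF solution_on_continuous[OF w], of "{0..t}"]
    by (auto intro: compact_continuous_image)
  then have "bounded (z ` {0..t} \<union> w ` {0..t})" by (simp add: compact_imp_bounded)
  then obtain N where N: "\<forall>p\<in>z ` {0..t} \<union> w ` {0..t}. norm p \<le> N"
    unfolding bounded_iff by blast
  have le: "\<bar>fst (z s)\<bar> \<le> N" "\<bar>fst (w s)\<bar> \<le> N" if "s \<in> {0..t}" for s
    using N that norm_fst_le[of "fst (z s)" "snd (z s)"] norm_fst_le[of "fst (w s)" "snd (w s)"]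
    by (force simp: image_iff)+
  have "0 \<le> N" using le(1)[of 0] \<open>0 \<le> t\<close> by simp
  then obtain L where L: "L-lipschitz_on UNIV (vc N)"
    using lipschitz_lienard_field_cutoff[OF cont_f lip_g] by blast
  have "solution_on {0..t} (vc N) z \<longleftrightarrow> solution_on {0..t} (lienard_field f g) z"
    "solution_on {0..t} (vc N) w \<longleftrightarrow> solution_on {0..t} (lienard_field f g) w"
    using le by (auto intro!: solution_on_cong lienard_field_cutoff)
  then have "solution_on {0..t} (vc N) z" "solution_on {0..t} (vc N) w"
    using solution_on_subset[OF z, of "{0..t}"] solution_on_subset[OF w, of "{0..t}"] by auto
  then have "dist (z t) (w t) \<le> exp (L * t) * dist (z 0) (w 0)"
    by (rule solution_dist_le) (use L \<open>0 \<le> t\<close> in \<open>auto intro: lipschitz_on_normD\<close>)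
  then show ?thesis using \<open>z 0 = w 0\<close> by simp
qed

text \<open>Existence and stability are read off at the single level \<open>M\<close>; uniqueness
  needs a level that depends on the rival orbit.\<close>

lemma unique_stable_limit_cycle:
  "\<exists>\<Gamma>. stable_limit_cycle (lienard_field f g) \<Gamma> \<and> (\<forall>\<Delta>. periodic_orbit (lienard_field f g) \<Delta> \<longrightarrow> \<Delta> = \<Gamma>)"
proof -
  let ?v = "lienard_field f g"
  obtain M where M: "0 < M" "\<And>N. M \<le> N \<Longrightarrow> \<exists>\<Gamma>. periodic_orbit (vc N) \<Gamma> \<and>
    (\<forall>\<Delta>. periodic_orbit (vc N) \<Delta> \<longrightarrow> \<Delta> = \<Gamma>) \<and>
    (\<forall>\<epsilon>>0. \<exists>\<delta>>0. \<forall>p. infdist p \<Gamma> < \<delta> \<longrightarrow> (\<forall>t\<ge>0. infdist (flow (vc N) t p) \<Gamma> < \<epsilon>)) \<and>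
    (\<exists>\<delta>>0. \<forall>p. infdist p \<Gamma> < \<delta> \<longrightarrow> ((\<lambda>t. infdist (flow (vc N) t p) \<Gamma>) \<longlongrightarrow> 0) at_top) \<and>
    (\<forall>p\<in>\<Gamma>. \<bar>fst p\<bar> \<le> M - 1)"
    by (rule cutoff_limit_cycle) blast
  obtain \<Gamma> where per: "periodic_orbit (vc M) \<Gamma>"
    and stab: "\<And>\<epsilon>. 0 < \<epsilon> \<Longrightarrow> \<exists>\<delta>>0. \<forall>p. infdist p \<Gamma> < \<delta> \<longrightarrow> (\<forall>t\<ge>0. infdist (flow (vc M) t p) \<Gamma> < \<epsilon>)"
    and attr: "\<exists>\<delta>>0. \<forall>p. infdist p \<Gamma> < \<delta> \<longrightarrow> ((\<lambda>t. infdist (flow (vc M) t p) \<Gamma>) \<longlongrightarrow> 0) at_top"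
    and inside: "\<And>p. p \<in> \<Gamma> \<Longrightarrow> \<bar>fst p\<bar> \<le> M - 1"
    using M(2)[OF order_refl] by blast
  obtain L where "L-lipschitz_on UNIV (vc M)"
    using lipschitz_lienard_field_cutoff[OF cont_f lip_g less_imp_le[OF M(1)]] by blast
  then interpret cut: lipschitz_field "vc M" L by (rule lipschitz_field.intro)
  have \<Gamma>: "compact \<Gamma>" "\<Gamma> \<noteq> {}"
    using periodic_orbit_compact[OF per] per by (auto simp: periodic_orbit_def)
  have transfer: "periodic_orbit (vc N) \<Delta> \<longleftrightarrow> periodic_orbit ?v \<Delta>" if "\<And>p. p \<in> \<Delta> \<Longrightarrow> \<bar>fst p\<bar> \<le> N" for N \<Delta>
    by (rule periodic_orbit_cong) (use that lienard_field_cutoff in blast)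
  have per_v: "periodic_orbit ?v \<Gamma>" using transfer[of \<Gamma> M] inside per by force
  have unique: "\<Delta> = \<Gamma>" if \<Delta>: "periodic_orbit ?v \<Delta>" for \<Delta>
  proof -
    have "bounded \<Delta>" using periodic_orbit_compact[OF \<Delta>] by (rule compact_imp_bounded)
    then obtain C where C: "\<forall>p\<in>\<Delta>. norm p \<le> C" unfolding bounded_iff by blast
    \<comment> \<open>At this level both \<open>\<Delta>\<close> and \<open>\<Gamma>\<close> are
      periodic orbits of the same cut-off field, which has only one.\<close>
    define N where "N = max M C"
    have "\<bar>fst p\<bar> \<le> N" if "p \<in> \<Delta>" for p
      using C that norm_fst_le[of "fst p" "snd p"] by (force simp: N_def)
    then have 1: "periodic_orbit (vc N) \<Delta>" using transfer \<Delta> by blast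
    have "\<bar>fst p\<bar> \<le> N" if "p \<in> \<Gamma>" for p using inside[OF that] by (simp add: N_def)
    then have 2: "periodic_orbit (vc N) \<Gamma>" using transfer per_v by blast
    have "M \<le> N" by (simp add: N_def)
    then obtain \<Gamma>' where "\<forall>\<Delta>. periodic_orbit (vc N) \<Delta> \<longrightarrow> \<Delta> = \<Gamma>'"
      by (meson M(2))
    then show ?thesis using 1 2 by metis
  qed
  have near: "\<bar>fst p\<bar> \<le> M" if p: "infdist p \<Gamma> < 1" for p
  proof -
    obtain q where q: "q \<in> \<Gamma>" "infdist p \<Gamma> = dist p q"
      using infdist_attains_inf[OF compact_imp_closed[OF \<Gamma>(1)] \<Gamma>(2)] by blast
    then show ?thesis
      using inside[OF q(1)] dist_fst_le[of p q] p by (simp add: dist_real_def abs_le_iff abs_less_iff)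
  qed
  \<comment> \<open>Starting this close, the cut-off flow stays within distance 1 of
    \<open>\<Gamma>\<close>, hence in the strip of \<open>near\<close>, and thus solves the original
    equation for all \<open>t >= 0\<close>. This excludes blow-up as well.\<close>
  obtain \<delta>1 where \<delta>1: "0 < \<delta>1" "\<And>p t. infdist p \<Gamma> < \<delta>1 \<Longrightarrow> 0 \<le> t \<Longrightarrow> infdist (flow (vc M) t p) \<Gamma> < 1"
    using stab[of 1] by auto
  have sol: "solution_on {0..} ?v (\<lambda>t. flow (vc M) t p)" if p: "infdist p \<Gamma> < \<delta>1" for p
  proof -
    have "solution_on {0..} (vc M) (\<lambda>t. flow (vc M) t p) \<longleftrightarrow> solution_on {0..} ?v (\<lambda>t. flow (vc M) t p)"
    proof (rule solution_on_cong)
      show "vc M (flow (vc M) t p) = ?v (flow (vc M) t p)" if "t \<in> {0..}" for t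
        using \<delta>1(2)[OF p, of t] that near by (intro lienard_field_cutoff) simp
    qed
    moreover have "solution_on {0..} (vc M) (\<lambda>t. flow (vc M) t p)"
      by (rule solution_on_subset[OF cut.flow_solution]) simp
    ultimately show ?thesis by (rule iffD1)
  qed
  have sol_unique: "z t = flow (vc M) t (z 0)"
    if "solution_on {0..} ?v z" "infdist (z 0) \<Gamma> < \<delta>1" "0 \<le> t" for z t
    by (rule forward_solution_unique[OF that(1) sol[OF that(2)] _ that(3)]) (simp only: cut.flow_0)
  have "orbitally_stable ?v \<Gamma>"
    unfolding orbitally_stable_def
  proof (intro allI impI)
    fix \<epsilon> :: real assume \<epsilon>: "0 < \<epsilon>"
    obtain \<delta> where \<delta>: "0 < \<delta>" "\<And>p t. infdist p \<Gamma> < \<delta> \<Longrightarrow> 0 \<le> t \<Longrightarrow> infdist (flow (vc M) t p) \<Gamma> < \<epsilon>"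
      using stab[OF \<epsilon>] by blast
    show "\<exists>\<delta>>0. \<forall>p. infdist p \<Gamma> < \<delta> \<longrightarrow>
        (\<exists>z. solution_on {0..} ?v z \<and> z 0 = p) \<and>
        (\<forall>z. solution_on {0..} ?v z \<and> z 0 = p \<longrightarrow> (\<forall>t\<ge>0. infdist (z t) \<Gamma> < \<epsilon>))"
    proof (intro exI[of _ "min \<delta> \<delta>1"] conjI allI impI)
      fix p assume p: "infdist p \<Gamma> < min \<delta> \<delta>1"
      show "\<exists>z. solution_on {0..} ?v z \<and> z 0 = p"
        using sol[of p] p by (intro exI[of _ "\<lambda>t. flow (vc M) t p"]) (simp add: cut.flow_0)
      fix z t assume z: "solution_on {0..} ?v z \<and> z 0 = p" and t: "0 \<le> (t :: real)"
      then have "z t = flow (vc M) t p" using sol_unique[of z t] p by simp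
      then show "infdist (z t) \<Gamma> < \<epsilon>" using \<delta>(2)[OF _ t, of p] p by simp
    qed (use \<delta> \<delta>1 in simp)
  qed
  moreover have "\<exists>\<eta>>0. \<forall>z. solution_on {0..} ?v z \<and> infdist (z 0) \<Gamma> < \<eta> \<longrightarrow>
      ((\<lambda>t. infdist (z t) \<Gamma>) \<longlongrightarrow> 0) at_top"
  proof -
    obtain \<delta> where \<delta>: "0 < \<delta>"
      "\<And>p. infdist p \<Gamma> < \<delta> \<Longrightarrow> ((\<lambda>t. infdist (flow (vc M) t p) \<Gamma>) \<longlongrightarrow> 0) at_top"
      using attr by blast
    have "((\<lambda>t. infdist (z t) \<Gamma>) \<longlongrightarrow> 0) at_top"
      if z: "solution_on {0..} ?v z" "infdist (z 0) \<Gamma> < min \<delta> \<delta>1" for z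
    proof (rule Lim_transform_eventually)
      show "((\<lambda>t. infdist (flow (vc M) t (z 0)) \<Gamma>) \<longlongrightarrow> 0) at_top" using \<delta>(2) z(2) by simp
      show "\<forall>\<^sub>F t in at_top. infdist (flow (vc M) t (z 0)) \<Gamma> = infdist (z t) \<Gamma>"
        using eventually_ge_at_top[of 0]
      proof eventually_elim
        case (elim t)
        have "z t = flow (vc M) t (z 0)" by (rule sol_unique[OF z(1) _ elim]) (use z(2) in simp)
        then show ?case by simp
      qed
    qed
    then show ?thesis using \<delta>(1) \<delta>1(1) by (intro exI[of _ "min \<delta> \<delta>1"]) simp
  qed
  ultimately have "stable_limit_cycle ?v \<Gamma>" using per_v by (simp add: stable_limit_cycle_def)
  then show ?thesis using unique by blast
qed

end

lemma Limsup_at_top_unbounded: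
  fixes u :: "real \<Rightarrow> real"
  assumes "Limsup at_top (\<lambda>x. ereal (u x)) = \<infinity>"
  shows "\<exists>x\<ge>b. K < u x"
proof (rule ccontr)
  assume "\<not> ?thesis"
  then have "\<forall>\<^sub>F x in at_top. ereal (u x) \<le> ereal K"
    unfolding eventually_at_top_linorder by (intro exI[of _ b]) (auto simp: not_less)
  then have "Limsup at_top (\<lambda>x. ereal (u x)) \<le> ereal K" by (rule Limsup_bounded)
  then show False using assms by simp
qed

lemma Limsup_at_bot_unbounded:
  fixes u :: "real \<Rightarrow> real"
  assumes "Limsup at_bot (\<lambda>x. ereal (u x)) = \<infinity>"
  shows "\<exists>x\<le>b. K < u x"
proof (rule ccontr)
  assume "\<not> ?thesis"
  then have "\<forall>\<^sub>F x in at_bot. ereal (u x) \<le> ereal K"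
    unfolding eventually_at_bot_linorder by (intro exI[of _ b]) (auto simp: not_less)
  then have "Limsup at_bot (\<lambda>x. ereal (u x)) \<le> ereal K" by (rule Limsup_bounded)
  then show False using assms by simp
qed

theorem theorem1p1:
  fixes f g F G :: "real \<Rightarrow> real" and x1 x2 :: real
  defines "F \<equiv> primitive f" and "G \<equiv> primitive g"
  assumes A_f: "continuous_on UNIV f"
    and A_g: "local_lipschitz (UNIV :: real set) UNIV (\<lambda>_. g)"
    and B_f0: "f 0 < 0"
    and B_f: "\<exists>\<delta>>0. \<forall>x. \<bar>x\<bar> > \<delta> \<longrightarrow> f x > 0"
    and B_g: "\<forall>x. x \<noteq> 0 \<longrightarrow> x * g x > 0"
    and C_order: "x2 < 0" "0 < x1"
    and C_zeros: "{x. F x = 0} = {x2, 0, x1}"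
    and C_transversal: "f x2 \<noteq> 0" "f 0 \<noteq> 0" "f x1 \<noteq> 0"
    and C_mono: "mono_on {..x2} F" "mono_on {x1..} F"
    and D: "G x1 = G x2"
    and E_right: "Limsup at_top (\<lambda>x. ereal (G x + F x)) = \<infinity>"
    and E_left: "Limsup at_bot (\<lambda>x. ereal (G x - F x)) = \<infinity>"
  shows "(\<exists>!\<Gamma>. periodic_orbit (lienard_field f g) \<Gamma>) \<and>
         (\<forall>\<Gamma>. periodic_orbit (lienard_field f g) \<Gamma> \<longrightarrow>
              stable_limit_cycle (lienard_field f g) \<Gamma>)"
proof -
  interpret lienard_system f g x1 x2
  proof
    show "primitive f x = 0 \<longleftrightarrow> x = x2 \<or> x = 0 \<or> x = x1" for x
      using C_zeros unfolding F_def set_eq_iff by simp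
    show "\<exists>x\<ge>b. K < primitive g x + primitive f x" for b K
      using Limsup_at_top_unbounded[OF E_right] unfolding F_def G_def .
    show "\<exists>x\<le>b. K < primitive g x - primitive f x" for b K
      using Limsup_at_bot_unbounded[OF E_left] unfolding F_def G_def .
    show "0 < x * g x" if "x \<noteq> 0" for x using B_g that by simp
    show "\<exists>\<delta>>0. \<forall>x. \<delta> < \<bar>x\<bar> \<longrightarrow> 0 < f x" by (rule B_f)
  qed (use C_mono D in \<open>simp_all add: F_def G_def A_f A_g B_f0 C_order\<close>)
  obtain \<Gamma> where "stable_limit_cycle (lienard_field f g) \<Gamma>"
    "\<forall>\<Delta>. periodic_orbit (lienard_field f g) \<Delta> \<longrightarrow> \<Delta> = \<Gamma>"
    using unique_stable_limit_cycle by blast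
  moreover from this have "periodic_orbit (lienard_field f g) \<Gamma>"
    by (simp add: stable_limit_cycle_def)
  ultimately show ?thesis by blast
qed

end
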